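(* There exist $\ell_0\in\mathbb{N}$ and, for each $\ell\ge\ell_0$, an open interval $M^\ell$ depending only on $v_2$, $v_3$ and $\ell$, with $\mu^{\rm us}_\ell\in M^\ell$, such that: 1. The mapping $\mu\mapsto E(\mathcal{F}_\mu^* )=E_{\rm min}(\mu)$ is smooth and strictly convex on $M^\ell$ and attains its minimum in $\mu^{\rm us}_\ell$. In particular, $\frac{d^2}{d\mu^2}E_{\rm min}(\mu^{\rm us}_\ell)\ge cn$ for some $c>0$ depending only on $v_2$, $v_3$. 2. The lengths $\lambda_1^\mu,\lambda_2^\mu$ increase continuously for $\mu\in M^\ell$. In particular, $\lambda_1^\mu,\lambda_2^\mu>1$ for $\mu>\mu^{\rm us}_\ell$ and $\lambda_1^\mu,\lambda_2^\mu<1$ for $\mu<\mu^{\rm us}_\ell$. 3. The angle $\alpha^\mu\in(\pi/2,\pi)$ corresponding to $\lambda_1^\mu,\lambda_2^\mu$, given by $\sin\alpha^\mu=\sqrt{1-(\sigma^\mu/\lambda_2^\mu)^2}$ with $\sigma^\mu=\mu/2-\lambda_1^\mu$, satisfies $\alpha^\mu\in(\alpha^{\rm ch}_\ell,\alpha^{\rm ru})$ for all $\mu\in M^\ell$. 4. Whenever $v_2''(1)\ne6v_3''(2\pi/3)$, the radius $\rho^\mu>0$ corresponding to $\lambda_1^\mu,\lambda_2^\mu$, given by $(\sigma^\mu)^2+4(\rho^\mu)^2\sin^2(\pi/(2\ell))=(\lambda_2^\mu)^2$, is continuously increasing for $\mu\in M^\ell$ if $v_2''(1)<6v_3''(2\pi/3)$,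 and continuously decreasing for $\mu\in M^\ell$ if $v_2''(1)>6v_3''(2\pi/3)$.
   Context: Potentials: $v_2:(0,\infty)\to[-1,\infty)$ is smooth, attains its minimum value only at $1$, $v_2(1)=-1$, $v_2''(1)>0$, and $v_2(r)=0$ for $r\ge1.1$. $v_3:[0,2\pi]\to[0,\infty)$ is smooth, $v_3(\alpha)=v_3(2\pi-\alpha)$, its minimum value $0$ is attained only at $2\pi/3$ and $4\pi/3$, and $v_3''(2\pi/3)>0$. Energy: with $e_1=(1,0,0)$, a nanotube is a periodic configuration $\mathcal{C}=C_n+Le_1\mathbb{Z}$, identified with $(C_n,L)$, where $L>0$ and $C_n=\{x_1,\dots,x_n\}\subset\mathbb{R}^3$ is the $n$-cell, $x_i\cdot e_1\in[0,L)$. Put $|x_i-x_j|_L=\min_{t\in\{-1,0,1\}}|x_i-x_j+Lte_1|$, $\mathcal{N}=\{(i,j): i\ne j,\ |x_i-x_j|_L<1.1\}$ (bonded pairs), $\mathcal{T}=\{(i,j,k): i\neq k,\ (i,j)\in\mathcal{N},\ (j,k)\in\mathcal{N}\}$, and let $\alpha_{ijk}\in[0,\pi]$ be the angle formed by $x_i-x_j$ and $x_k-x_j$ (taking the nearest periodic images). Then $$E(\mathcal{C})=E(C_n,L)=\tfrac12\sum_{(i,j)\in\mathcal{N}}v_2(|x_i-x_j|_L)+\tfrac12\sum_{(i,j,k)\in\mathcal{T}}v_3(\alpha_{ijk}).$$ Zigzag nanotubes: for an integer $\ell>3$ and $\mu\in(2.6,3.1)$, $\mathscr{F}(\mu)$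 is the family of configurations that coincide, up to isometries, with the set of points $$x_{i,k}^{j,l}=\Big(k(\lambda_1+\sigma)+j(2\sigma+2\lambda_1)+l(2\sigma+\lambda_1),\ \rho\cos\tfrac{\pi(2i+k)}{\ell},\ \rho\sin\tfrac{\pi(2i+k)}{\ell}\Big),$$ $i=1,\dots,\ell$, $j\in\mathbb{Z}$, $k,l\in\{0,1\}$, for some $\lambda_1,\lambda_2,\sigma\in(0,\mu/2)$ and $\rho\in(0,\mu/(4\sin(\pi/(2\ell))))$ with $2\sigma+2\lambda_1=\mu$ and $\sigma^2+4\rho^2\sin^2(\pi/(2\ell))=\lambda_2^2$. The configuration is determined by $\lambda_1,\lambda_2,\mu$ and denoted $\mathcal{F}_{\lambda_1,\lambda_2,\mu}$. Here $m\in\mathbb{N}$ is an arbitrary fixed number of minimal periods: $\mathcal{F}_{\lambda_1,\lambda_2,\mu}$ is identified with $(F_n,L^\mu_m)$, $L^\mu_m=m\mu$, $n=4m\ell$, and its energy is $E(F_n,L_m^\mu)$. Unstretched period: $\gamma_\ell=\pi(1-1/\ell)$, $\beta(\alpha,\gamma)=2\arcsin(\sin\alpha\sin(\gamma/2))$. Let $\alpha^{\rm ru}=2\pi/3$ and let $\alpha^{\rm ch}_\ell$ be the unique solution of $\beta(\alpha,\gamma_\ell)=\alpha$ in $(\arccos(-0.4),\arccos(-0.6))$. It is known that there are an open interval $A$ and an integer, depending only on $v_3$, such that for all larger $\ell$ there is a unique $\alpha^{\rm us}_\ell\in A$ minimizing $\alpha\mapsto E(\mathcal{F}_{1,1,2(1-\cos\alpha)})$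 over $A$ (equivalently $\alpha\mapsto 2v_3(\alpha)+v_3(\beta(\alpha,\gamma_\ell))$), and $\alpha^{\rm us}_\ell\in(\alpha^{\rm ch}_\ell,\alpha^{\rm ru})\subset A$. Set $\mu^{\rm us}_\ell=2-2\cos\alpha^{\rm us}_\ell$. Minimizers: $E_{\rm min}(\mu)=\min\{E(\mathcal{F}_{\lambda_1,\lambda_2,\mu}):\lambda_1,\lambda_2\in(0.9,1.1)\}$. For $\ell$ large and $\mu$ in a suitable open interval containing $\mu_\ell^{\rm us}$ and depending only on $v_2,v_3,\ell$, this problem has a unique solution; the minimizing pair is denoted $(\lambda_1^\mu,\lambda_2^\mu)$ and $\mathcal{F}^*_\mu=\mathcal{F}_{\lambda_1^\mu,\lambda_2^\mu,\mu}$ (the interval $M^\ell$ in the claim is understood to lie inside this interval). *)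

theory Defs
  imports "HOL-Analysis.Analysis"
begin

subsection \<open>Smoothness and strict convexity\<close>

text \<open>
  Infinite differentiability, witnessed by the sequence \<open>D\<close> of successive derivatives. On a closed
  interval the derivatives are one-sided at the end points.
\<close>

definition smooth_on :: "real set \<Rightarrow> (real \<Rightarrow> real) \<Rightarrow> bool" where
  "smooth_on S f \<longleftrightarrow>
     (\<exists>D :: nat \<Rightarrow> real \<Rightarrow> real.
        (\<forall>x\<in>S. D 0 x = f x) \<and>
        (\<forall>k. \<forall>x\<in>S. (D k has_real_derivative D (Suc k) x) (at x within S)))"

definition strictly_convex_on :: "real set \<Rightarrow> (real \<Rightarrow> real) \<Rightarrow> bool" where
  "strictly_convex_on S f \<longleftrightarrow> convex S \<and>
     (\<forall>x\<in>S. \<forall>y\<in>S. \<forall>t\<in>{0<..<1}. x \<noteq> y \<longrightarrow>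
        f ((1 - t) * x + t * y) < (1 - t) * f x + t * f y)"

subsection \<open>Potentials\<close>

text \<open>
  The potentials are total functions; only their values on \<open>{0<..}\<close> and \<open>{0..2 * pi}\<close>,
  respectively, are constrained, and only those enter the energy.
\<close>

definition two_body_potential :: "(real \<Rightarrow> real) \<Rightarrow> bool" where
  "two_body_potential v2 \<longleftrightarrow>
     smooth_on {0<..} v2 \<and>
     v2 1 = -1 \<and>
     (\<forall>r>0. r \<noteq> 1 \<longrightarrow> v2 r > -1) \<and>
     deriv (deriv v2) 1 > 0 \<and>
     (\<forall>r\<ge>1.1. v2 r = 0)"

definition three_body_potential :: "(real \<Rightarrow> real) \<Rightarrow> bool" where
  "three_body_potential v3 \<longleftrightarrow>
     smooth_on {0..2 * pi} v3 \<and>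
     (\<forall>\<alpha>\<in>{0..2 * pi}. v3 \<alpha> = v3 (2 * pi - \<alpha>)) \<and>
     v3 (2 * pi / 3) = 0 \<and> v3 (4 * pi / 3) = 0 \<and>
     (\<forall>\<alpha>\<in>{0..2 * pi}. \<alpha> \<noteq> 2 * pi / 3 \<and> \<alpha> \<noteq> 4 * pi / 3 \<longrightarrow> v3 \<alpha> > 0) \<and>
     deriv (deriv v3) (2 * pi / 3) > 0"

subsection \<open>Configurational energy of a periodic configuration\<close>

definition e1 :: "real ^ 3" where
  "e1 = vector [1, 0, 0]"

definition periodic_dist :: "real \<Rightarrow> real ^ 3 \<Rightarrow> real ^ 3 \<Rightarrow> real" where
  "periodic_dist L x y = Min ((\<lambda>t::int. norm (x - y + (L * of_int t) *\<^sub>R e1)) ` {-1, 0, 1})"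

text \<open>
  The difference vector realizing \<open>periodic_dist\<close>. The choice of \<open>t\<close> is unique for bonded points
  as soon as \<open>L > 2.2\<close>, which holds for all configurations considered below.
\<close>

definition nearest_diff :: "real \<Rightarrow> real ^ 3 \<Rightarrow> real ^ 3 \<Rightarrow> real ^ 3" where
  "nearest_diff L x y =
     (let t = arg_min_on (\<lambda>t::int. norm (x - y + (L * of_int t) *\<^sub>R e1)) {-1, 0, 1}
      in x - y + (L * of_int t) *\<^sub>R e1)"

definition bond_angle :: "real \<Rightarrow> real ^ 3 \<Rightarrow> real ^ 3 \<Rightarrow> real ^ 3 \<Rightarrow> real" where
  "bond_angle L x y z =
     (let u = nearest_diff L x y; w = nearest_diff L z y
      in arccos (u \<bullet> w / (norm u * norm w)))"

text \<open>
  An \<open>n\<close>-cell is given as a finite set of points, so that indices of points are the points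
  themselves.
\<close>

definition bonded :: "(real ^ 3) set \<Rightarrow> real \<Rightarrow> ((real ^ 3) \<times> (real ^ 3)) set" where
  "bonded C L = {(x, y). x \<in> C \<and> y \<in> C \<and> x \<noteq> y \<and> periodic_dist L x y < 1.1}"

definition bond_triples ::
  "(real ^ 3) set \<Rightarrow> real \<Rightarrow> ((real ^ 3) \<times> (real ^ 3) \<times> (real ^ 3)) set" where
  "bond_triples C L = {(x, y, z). x \<noteq> z \<and> (x, y) \<in> bonded C L \<and> (y, z) \<in> bonded C L}"

definition energy ::
  "(real \<Rightarrow> real) \<Rightarrow> (real \<Rightarrow> real) \<Rightarrow> (real ^ 3) set \<Rightarrow> real \<Rightarrow> real" where
  "energy v2 v3 C L =
     1/2 * (\<Sum>(x, y)\<in>bonded C L. v2 (periodic_dist L x y)) +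
     1/2 * (\<Sum>(x, y, z)\<in>bond_triples C L. v3 (bond_angle L x y z))"

definition cell :: "(real ^ 3) set \<Rightarrow> real \<Rightarrow> (real ^ 3) set" where
  "cell C L = {x \<in> C. x \<bullet> e1 \<in> {0..<L}}"

subsection \<open>Zigzag nanotubes\<close>

definition zigzag_points :: "nat \<Rightarrow> real \<Rightarrow> real \<Rightarrow> real \<Rightarrow> (real ^ 3) set" where
  "zigzag_points ell lam1 \<sigma> \<rho> =
     {vector [real k * (lam1 + \<sigma>) + of_int j * (2 * \<sigma> + 2 * lam1) + real l * (2 * \<sigma> + lam1),
              \<rho> * cos (pi * real (2 * i + k) / real ell),
              \<rho> * sin (pi * real (2 * i + k) / real ell)] | i (j::int) k l.
        i \<in> {1..ell} \<and> k \<in> {0, 1} \<and> l \<in> {0, 1}}"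

definition sigma_of :: "real \<Rightarrow> real \<Rightarrow> real" where
  "sigma_of \<mu> lam1 = \<mu> / 2 - lam1"

definition rho_of :: "nat \<Rightarrow> real \<Rightarrow> real \<Rightarrow> real \<Rightarrow> real" where
  "rho_of ell \<mu> lam1 lam2 =
     (THE \<rho>. \<rho> > 0 \<and> (sigma_of \<mu> lam1)\<^sup>2 + 4 * \<rho>\<^sup>2 * (sin (pi / (2 * real ell)))\<^sup>2 = lam2\<^sup>2)"

definition alpha_of :: "real \<Rightarrow> real \<Rightarrow> real \<Rightarrow> real" where
  "alpha_of \<mu> lam1 lam2 =
     (THE \<alpha>. \<alpha> \<in> {pi/2<..<pi} \<and> sin \<alpha> = sqrt (1 - (sigma_of \<mu> lam1 / lam2)\<^sup>2))"

text \<open>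
  For \<open>ell > 3\<close>, \<open>lam1\<close> and \<open>lam2\<close> in \<open>{0.9<..<1.1}\<close> and \<open>\<mu>\<close> in \<open>{2.6<..<3.1}\<close>, the side conditions
  \<open>lam1, lam2, \<sigma> \<in> {0<..<\<mu>/2}\<close> and \<open>0 < \<rho> < \<mu> / (4 * sin (pi / (2 * ell)))\<close> hold automatically. Among
  all isometric copies of the zigzag tube, the one with axis \<open>e1\<close> is taken.
\<close>

definition zigzag :: "nat \<Rightarrow> real \<Rightarrow> real \<Rightarrow> real \<Rightarrow> (real ^ 3) set" where
  "zigzag ell lam1 lam2 \<mu> = zigzag_points ell lam1 (sigma_of \<mu> lam1) (rho_of ell \<mu> lam1 lam2)"

text \<open>Energy of the zigzag tube, identified with its cell consisting of \<open>m\<close> minimal periods.\<close>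

definition zigzag_energy ::
  "(real \<Rightarrow> real) \<Rightarrow> (real \<Rightarrow> real) \<Rightarrow> nat \<Rightarrow> nat \<Rightarrow> real \<Rightarrow> real \<Rightarrow> real \<Rightarrow> real" where
  "zigzag_energy v2 v3 ell m lam1 lam2 \<mu> =
     energy v2 v3 (cell (zigzag ell lam1 lam2 \<mu>) (real m * \<mu>)) (real m * \<mu>)"

subsection \<open>The unstretched period\<close>

definition gamma_ang :: "nat \<Rightarrow> real" where
  "gamma_ang ell = pi * (1 - 1 / real ell)"

definition beta_ang :: "real \<Rightarrow> real \<Rightarrow> real" where
  "beta_ang \<alpha> \<gamma> = 2 * arcsin (sin \<alpha> * sin (\<gamma> / 2))"

definition alpha_ru :: real where
  "alpha_ru = 2 * pi / 3"

definition alpha_ch :: "nat \<Rightarrow> real" where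
  "alpha_ch ell =
     (THE \<alpha>. \<alpha> \<in> {arccos (-0.4)<..<arccos (-0.6)} \<and> beta_ang \<alpha> (gamma_ang ell) = \<alpha>)"

text \<open>
  \<open>us_angle v3 A ell \<alpha>\<close>: \<open>\<alpha>\<close> is the unique minimizer over \<open>A\<close> of the energy of the tube with unit bonds.
  \<open>us_interval v3 A N\<close>: \<open>A\<close> and \<open>N\<close> are as in the result on unstretched nanotubes, i.e. for all
  \<open>ell > N\<close> there is such a minimizer, located between \<open>alpha_ch ell\<close> and \<open>alpha_ru\<close>. The quantification
  over \<open>v2\<close> and \<open>m\<close> expresses that \<open>A\<close>, \<open>N\<close> and the minimizer depend on neither of them: at unit
  bond lengths \<open>v2\<close> contributes a constant and \<open>m\<close> a factor. The condition on \<open>2 * (1 - cos \<alpha>)\<close> keeps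
  the periods in the range for which the tubes are defined.
\<close>

definition us_angle :: "(real \<Rightarrow> real) \<Rightarrow> real set \<Rightarrow> nat \<Rightarrow> real \<Rightarrow> bool" where
  "us_angle v3 A ell \<alpha> \<longleftrightarrow>
     (\<forall>v2 m. two_body_potential v2 \<and> m \<ge> 1 \<longrightarrow>
        (\<forall>\<alpha>'. is_arg_min (\<lambda>a. zigzag_energy v2 v3 ell m 1 1 (2 * (1 - cos a))) (\<lambda>a. a \<in> A) \<alpha>'
              \<longleftrightarrow> \<alpha>' = \<alpha>))"

definition us_interval :: "(real \<Rightarrow> real) \<Rightarrow> real set \<Rightarrow> nat \<Rightarrow> bool" where
  "us_interval v3 A N \<longleftrightarrow>
     (\<exists>a b. A = {a<..<b}) \<and>
     (\<forall>\<alpha>\<in>A. 2 * (1 - cos \<alpha>) \<in> {2.6<..<3.1}) \<and>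
     N \<ge> 3 \<and>
     (\<forall>ell>N. {alpha_ch ell<..<alpha_ru} \<subseteq> A \<and>
             (\<exists>\<alpha>\<in>{alpha_ch ell<..<alpha_ru}. us_angle v3 A ell \<alpha>))"

text \<open>
  The minimizer does not depend on the choice of \<open>A\<close>: for two admissible intervals, both minimizers
  lie in \<open>{alpha_ch ell<..<alpha_ru}\<close>, hence in the intersection of the two intervals.
\<close>

definition alpha_us :: "(real \<Rightarrow> real) \<Rightarrow> nat \<Rightarrow> real" where
  "alpha_us v3 ell = (THE \<alpha>. \<exists>A N. us_interval v3 A N \<and> ell > N \<and> us_angle v3 A ell \<alpha>)"

definition mu_us :: "(real \<Rightarrow> real) \<Rightarrow> nat \<Rightarrow> real" where
  "mu_us v3 ell = 2 - 2 * cos (alpha_us v3 ell)"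

subsection \<open>Minimizers at prescribed period\<close>

definition E_min :: "(real \<Rightarrow> real) \<Rightarrow> (real \<Rightarrow> real) \<Rightarrow> nat \<Rightarrow> nat \<Rightarrow> real \<Rightarrow> real" where
  "E_min v2 v3 ell m \<mu> =
     (LEAST e. e \<in> {zigzag_energy v2 v3 ell m lam1 lam2 \<mu> | lam1 lam2.
                      lam1 \<in> {0.9<..<1.1} \<and> lam2 \<in> {0.9<..<1.1}})"

definition is_minimizing_pair ::
  "(real \<Rightarrow> real) \<Rightarrow> (real \<Rightarrow> real) \<Rightarrow> nat \<Rightarrow> nat \<Rightarrow> real \<Rightarrow> real \<times> real \<Rightarrow> bool" where
  "is_minimizing_pair v2 v3 ell m \<mu> p \<longleftrightarrow>
     is_arg_min (\<lambda>(lam1, lam2). zigzag_energy v2 v3 ell m lam1 lam2 \<mu>)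
                (\<lambda>q. q \<in> {0.9<..<1.1} \<times> {0.9<..<1.1}) p"

definition lambda1_min :: "(real \<Rightarrow> real) \<Rightarrow> (real \<Rightarrow> real) \<Rightarrow> nat \<Rightarrow> nat \<Rightarrow> real \<Rightarrow> real" where
  "lambda1_min v2 v3 ell m \<mu> = fst (THE p. is_minimizing_pair v2 v3 ell m \<mu> p)"

definition lambda2_min :: "(real \<Rightarrow> real) \<Rightarrow> (real \<Rightarrow> real) \<Rightarrow> nat \<Rightarrow> nat \<Rightarrow> real \<Rightarrow> real" where
  "lambda2_min v2 v3 ell m \<mu> = snd (THE p. is_minimizing_pair v2 v3 ell m \<mu> p)"

definition alpha_min :: "(real \<Rightarrow> real) \<Rightarrow> (real \<Rightarrow> real) \<Rightarrow> nat \<Rightarrow> nat \<Rightarrow> real \<Rightarrow> real" where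
  "alpha_min v2 v3 ell m \<mu> = alpha_of \<mu> (lambda1_min v2 v3 ell m \<mu>) (lambda2_min v2 v3 ell m \<mu>)"

definition rho_min :: "(real \<Rightarrow> real) \<Rightarrow> (real \<Rightarrow> real) \<Rightarrow> nat \<Rightarrow> nat \<Rightarrow> real \<Rightarrow> real" where
  "rho_min v2 v3 ell m \<mu> = rho_of ell \<mu> (lambda1_min v2 v3 ell m \<mu>) (lambda2_min v2 v3 ell m \<mu>)"

end

theory Submission
  imports Defs
begin

text \<open>
  Every point of a zigzag tube has one bond of length \<open>l1\<close> parallel to the axis and two bonds of length
  \<open>l2\<close>. Hence the energy of a tube with \<open>n\<close> points is \<open>n * (v2 l1 / 2 + v2 l2 + G \<alpha>)\<close>, where \<open>G\<close> is the
  angle energy \<open>2 * v3 \<alpha> + v3 (beta_ang \<alpha> (gamma_ang ell))\<close> and \<open>cos \<alpha> = - (\<mu> / 2 - l1) / l2\<close> (lemma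
  \<open>zigzag_energy_eq\<close>).

  As \<open>ell\<close> grows, \<open>G''\<close> tends to \<open>6 * v3'' (2 * pi / 3)\<close> near \<open>2 * pi / 3\<close>, and the unstretched angle \<open>a0\<close>
  becomes the strict global minimizer of \<open>G\<close> over the obtuse angles (lemma \<open>unstretched_angle\<close>).

  Everything else is one-dimensional calculus. Because \<open>G\<close> depends on the angle alone, the critical points
  of the energy at prescribed period near \<open>(1, 1)\<close> form a curve that can be parametrized by \<open>\<alpha>\<close> with the
  inverse functions of \<open>v2'\<close> and of \<open>r * v2' r\<close> (lemma \<open>equilibrium_curve\<close>). Along it the bond lengths, the
  tension \<open>T = G' \<alpha> / (l2 * sin \<alpha>)\<close> and the period \<open>\<mu>\<close> are smooth and increasing near \<open>a0\<close>, so that they are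
  also smooth, increasing functions of the period. At the unstretched period the bond lengths and the
  angle are all at their unique global minimizers; by compactness, minimizers for nearby periods stay
  near \<open>(1, 1)\<close>, hence lie on the curve and are unique (lemma \<open>tube_minimizer\<close>).

  By the envelope theorem the minimal energy has derivative \<open>n * T / 2\<close> in \<open>\<mu>\<close>. This is increasing, which
  gives strict convexity, and smooth. Its derivative at the unstretched period is explicit and bounded
  below uniformly in \<open>ell\<close>. The radius of the tube is proportional to \<open>l2 * sin \<alpha>\<close>, whose derivative at \<open>a0\<close>
  is \<open>- cos a0 * (G'' a0 / v2'' 1 - 1)\<close>; this produces the comparison of \<open>v2'' 1\<close> with
  \<open>6 * v3'' (2 * pi / 3)\<close>.
\<close>

section \<open>Smooth functions of one real variable\<close>

text \<open>
  \<open>Ck_on k S f\<close>: \<open>f\<close> is \<open>k\<close> times differentiable on \<open>S\<close>, in the recursive form that makes closure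
  properties inductions on \<open>k\<close>. Continuity of the last derivative is not required, so \<open>Ck_on 0\<close> holds
  trivially; the quantification over all \<open>k\<close> makes this irrelevant.
\<close>

fun Ck_on :: "nat \<Rightarrow> real set \<Rightarrow> (real \<Rightarrow> real) \<Rightarrow> bool" where
  "Ck_on 0 S f \<longleftrightarrow> True"
| "Ck_on (Suc k) S f \<longleftrightarrow>
     (\<exists>f'. (\<forall>x\<in>S. (f has_real_derivative f' x) (at x within S)) \<and> Ck_on k S f')"

lemma has_field_derivative_on_cong:
  assumes "x \<in> S" "\<And>x. x \<in> S \<Longrightarrow> g x = f x" "(f has_field_derivative f') (at x within S)"
  shows "(g has_field_derivative f') (at x within S)"
  using assms unfolding has_field_derivative_def by (rule has_derivative_transform)

lemma smooth_on_derivE: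
  assumes "smooth_on S f"
  obtains f' where "smooth_on S f'" "\<And>x. x \<in> S \<Longrightarrow> (f has_real_derivative f' x) (at x within S)"
proof -
  obtain D where D: "\<And>x. x \<in> S \<Longrightarrow> D 0 x = f x"
    "\<And>k x. x \<in> S \<Longrightarrow> (D k has_real_derivative D (Suc k) x) (at x within S)"
    using assms unfolding smooth_on_def by blast
  show thesis
  proof
    show "smooth_on S (D 1)"
      unfolding smooth_on_def by (rule exI[of _ "\<lambda>k. D (Suc k)"]) (auto intro: D(2))
    fix x assume "x \<in> S"
    then show "(f has_real_derivative D 1 x) (at x within S)"
      using D(2)[of x 0] has_field_derivative_on_cong[of x S f "D 0" "D 1 x"] D(1) by simp
  qed
qed

lemma smooth_on_coinduct:
  assumes "P f"
    and step: "\<And>g. P g \<Longrightarrow> \<exists>g'. P g' \<and> (\<forall>x\<in>S. (g has_real_derivative g' x) (at x within S))"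
  shows "smooth_on S f"
proof -
  have "\<exists>D. \<forall>k::nat. P (D k) \<and> (k = 0 \<longrightarrow> D k = f) \<and>
          (\<forall>x\<in>S. (D k has_real_derivative D (Suc k) x) (at x within S))"
    using dependent_nat_choice[of "\<lambda>k g. P g \<and> (k = 0 \<longrightarrow> g = f)"
        "\<lambda>k g g'. \<forall>x\<in>S. (g has_real_derivative g' x) (at x within S)"] assms by blast
  then show ?thesis unfolding smooth_on_def by metis
qed

lemma Ck_on_SucI:
  assumes "\<And>x. x \<in> S \<Longrightarrow> (f has_real_derivative f' x) (at x within S)" "Ck_on k S f'"
  shows "Ck_on (Suc k) S f"
  using assms by auto

lemma Ck_on_cong:
  assumes "Ck_on k S f" "\<And>x. x \<in> S \<Longrightarrow> f x = g x"
  shows "Ck_on k S g"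
proof (cases k)
  case (Suc j)
  then obtain f' where "\<And>x. x \<in> S \<Longrightarrow> (f has_real_derivative f' x) (at x within S)" "Ck_on j S f'"
    using assms(1) by auto
  moreover have "(g has_real_derivative f' x) (at x within S)" if "x \<in> S" for x
    by (rule has_field_derivative_on_cong[of x S g f]) (use that assms(2) calculation in auto)
  ultimately show ?thesis using Suc by auto
qed simp

lemma Ck_on_Suc_imp: "Ck_on (Suc k) S f \<Longrightarrow> Ck_on k S f"
  by (induction k arbitrary: f) auto

lemma smooth_on_imp_Ck_on: "smooth_on S f \<Longrightarrow> Ck_on k S f"
proof (induction k arbitrary: f)
  case (Suc k)
  then show ?case by (metis Ck_on.simps(2) smooth_on_derivE)
qed simp

text \<open>
  On an open set the derivatives obtained for different orders agree, so that they can be assembled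
  into a single sequence.
\<close>

lemma smooth_on_iff_Ck_on:
  assumes "open S"
  shows "smooth_on S f \<longleftrightarrow> (\<forall>k. Ck_on k S f)"
proof
  assume "\<forall>k. Ck_on k S f"
  then show "smooth_on S f"
  proof (rule smooth_on_coinduct[of "\<lambda>g. \<forall>k. Ck_on k S g"])
    fix g assume g: "\<forall>k. Ck_on k S g"
    then have "Ck_on (Suc 0) S g" by blast
    then obtain g' where g': "\<And>x. x \<in> S \<Longrightarrow> (g has_real_derivative g' x) (at x within S)" by auto
    have "Ck_on k S g'" for k
    proof -
      have "Ck_on (Suc k) S g" using g by blast
      then obtain d where d: "\<And>x. x \<in> S \<Longrightarrow> (g has_real_derivative d x) (at x within S)"
        and "Ck_on k S d" by auto
      moreover have "d x = g' x" if "x \<in> S" for x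
        using DERIV_unique d[OF that] g'[OF that] at_within_open[OF that assms] by metis
      ultimately show ?thesis using Ck_on_cong by blast
    qed
    then show "\<exists>g'. (\<forall>k. Ck_on k S g') \<and> (\<forall>x\<in>S. (g has_real_derivative g' x) (at x within S))"
      using g' by blast
  qed
qed (simp add: smooth_on_imp_Ck_on)

lemma Ck_on_const: "Ck_on k S (\<lambda>x. c)"
  by (induction k arbitrary: c) (auto intro!: exI[of _ "\<lambda>x. 0"])

lemma Ck_on_add: "Ck_on k S f \<Longrightarrow> Ck_on k S g \<Longrightarrow> Ck_on k S (\<lambda>x. f x + g x)"
proof (induction k arbitrary: f g)
  case (Suc k)
  obtain f' g' where "\<And>x. x \<in> S \<Longrightarrow> (f has_real_derivative f' x) (at x within S)" "Ck_on k S f'"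
    "\<And>x. x \<in> S \<Longrightarrow> (g has_real_derivative g' x) (at x within S)" "Ck_on k S g'"
    using Suc.prems by (metis Ck_on.simps(2))
  with Suc.IH show ?case by (intro Ck_on_SucI[of S _ "\<lambda>x. f' x + g' x"] DERIV_add) blast+
qed simp

lemma Ck_on_mult: "Ck_on k S f \<Longrightarrow> Ck_on k S g \<Longrightarrow> Ck_on k S (\<lambda>x. f x * g x)"
proof (induction k arbitrary: f g)
  case (Suc k)
  obtain f' g' where d: "\<And>x. x \<in> S \<Longrightarrow> (f has_real_derivative f' x) (at x within S)" "Ck_on k S f'"
    "\<And>x. x \<in> S \<Longrightarrow> (g has_real_derivative g' x) (at x within S)" "Ck_on k S g'"
    using Suc.prems by (metis Ck_on.simps(2))
  have "Ck_on k S (\<lambda>x. f' x * g x + f x * g' x)"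
    by (intro Ck_on_add Suc.IH[OF d(2) Ck_on_Suc_imp[OF Suc.prems(2)]]
        Suc.IH[OF Ck_on_Suc_imp[OF Suc.prems(1)] d(4)])
  then show ?case
    by (rule Ck_on_SucI[rotated]) (auto intro!: derivative_eq_intros d)
qed simp

lemma Ck_on_compose:
  assumes "Ck_on k T f" "Ck_on k S g" "g ` S \<subseteq> T"
  shows "Ck_on k S (\<lambda>x. f (g x))"
  using assms
proof (induction k arbitrary: f)
  case (Suc k)
  obtain f' g' where d: "\<And>x. x \<in> T \<Longrightarrow> (f has_real_derivative f' x) (at x within T)" "Ck_on k T f'"
    "\<And>x. x \<in> S \<Longrightarrow> (g has_real_derivative g' x) (at x within S)" "Ck_on k S g'"
    using Suc.prems by (metis Ck_on.simps(2))
  have "((\<lambda>x. f (g x)) has_real_derivative f' (g x) * g' x) (at x within S)" if "x \<in> S" for x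
  proof -
    have "(f has_real_derivative f' (g x)) (at (g x) within g ` S)"
      using d(1)[of "g x"] that Suc.prems(3) by (meson DERIV_subset image_subset_iff)
    from DERIV_image_chain[OF this d(3)[OF that]] show ?thesis by (simp add: o_def)
  qed
  moreover have "Ck_on k S (\<lambda>x. f' (g x) * g' x)"
    by (intro Ck_on_mult Suc.IH[OF d(2) Ck_on_Suc_imp[OF Suc.prems(2)] Suc.prems(3)] d(4))
  ultimately show ?case by (rule Ck_on_SucI)
qed simp

lemma Ck_on_inverse:
  assumes "Ck_on k S f" "\<And>x. x \<in> S \<Longrightarrow> f x \<noteq> 0"
  shows "Ck_on k S (\<lambda>x. inverse (f x))"
  using assms
proof (induction k)
  case (Suc k)
  obtain f' where d: "\<And>x. x \<in> S \<Longrightarrow> (f has_real_derivative f' x) (at x within S)" "Ck_on k S f'"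
    using Suc.prems(1) by (metis Ck_on.simps(2))
  have "Ck_on k S (\<lambda>x. (-1) * (inverse (f x) * f' x * inverse (f x)))"
    by (intro Ck_on_mult Ck_on_const Suc.IH[OF Ck_on_Suc_imp[OF Suc.prems(1)] Suc.prems(2)] d(2))
  moreover have "((\<lambda>x. inverse (f x)) has_real_derivative (-1) * (inverse (f x) * f' x * inverse (f x)))
    (at x within S)" if "x \<in> S" for x
    using DERIV_inverse'[OF d(1)[OF that]] Suc.prems(2)[OF that] by simp
  ultimately show ?case by (rule Ck_on_SucI[rotated])
qed simp

lemma smooth_on_const: "smooth_on S (\<lambda>x. c)"
  unfolding smooth_on_def by (rule exI[of _ "\<lambda>k x. if k = 0 then c else 0"]) simp

lemma smooth_onI:
  assumes "smooth_on S f'" "\<And>x. x \<in> S \<Longrightarrow> (f has_real_derivative f' x) (at x within S)"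
  shows "smooth_on S f"
proof (rule smooth_on_coinduct[of "\<lambda>g. g = f \<or> smooth_on S g"])
  fix g assume g: "g = f \<or> smooth_on S g"
  show "\<exists>g'. (g' = f \<or> smooth_on S g') \<and> (\<forall>x\<in>S. (g has_real_derivative g' x) (at x within S))"
  proof (cases "g = f")
    case True
    then show ?thesis using assms by blast
  next
    case False
    then have "smooth_on S g" using g by blast
    then show ?thesis by (rule smooth_on_derivE) blast
  qed
qed simp

lemma smooth_on_ident: "smooth_on S (\<lambda>x. x)"
  by (rule smooth_onI[OF smooth_on_const[of S 1]]) auto

lemma smooth_on_cong:
  assumes "smooth_on S f" "\<And>x. x \<in> S \<Longrightarrow> f x = g x"
  shows "smooth_on S g"
  using assms unfolding smooth_on_def by metis

lemma smooth_on_subset: "smooth_on T f \<Longrightarrow> S \<subseteq> T \<Longrightarrow> smooth_on S f"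
  unfolding smooth_on_def by (meson DERIV_subset subsetD)

lemma smooth_on_add: "open S \<Longrightarrow> smooth_on S f \<Longrightarrow> smooth_on S g \<Longrightarrow> smooth_on S (\<lambda>x. f x + g x)"
  by (simp add: smooth_on_iff_Ck_on Ck_on_add)

lemma smooth_on_mult: "open S \<Longrightarrow> smooth_on S f \<Longrightarrow> smooth_on S g \<Longrightarrow> smooth_on S (\<lambda>x. f x * g x)"
  by (simp add: smooth_on_iff_Ck_on Ck_on_mult)

lemma smooth_on_minus: "open S \<Longrightarrow> smooth_on S f \<Longrightarrow> smooth_on S (\<lambda>x. - f x)"
  using smooth_on_mult[OF _ smooth_on_const[of S "-1"]] by simp

lemma smooth_on_diff: "open S \<Longrightarrow> smooth_on S f \<Longrightarrow> smooth_on S g \<Longrightarrow> smooth_on S (\<lambda>x. f x - g x)"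
  using smooth_on_add[OF _ _ smooth_on_minus] by simp

lemma smooth_on_divide:
  "open S \<Longrightarrow> smooth_on S f \<Longrightarrow> smooth_on S g \<Longrightarrow> (\<And>x. x \<in> S \<Longrightarrow> g x \<noteq> 0) \<Longrightarrow> smooth_on S (\<lambda>x. f x / g x)"
  unfolding divide_inverse by (simp add: smooth_on_iff_Ck_on Ck_on_mult Ck_on_inverse)

lemma smooth_on_compose:
  "open S \<Longrightarrow> smooth_on T f \<Longrightarrow> smooth_on S g \<Longrightarrow> (\<And>x. x \<in> S \<Longrightarrow> g x \<in> T) \<Longrightarrow> smooth_on S (\<lambda>x. f (g x))"
  using Ck_on_compose[of _ T f S g] smooth_on_imp_Ck_on smooth_on_iff_Ck_on[of S] by blast

lemma smooth_on_sin: "smooth_on S sin" and smooth_on_cos: "smooth_on S cos"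
proof -
  let ?P = "\<lambda>f. \<exists>a b. f = (\<lambda>x::real. a * sin x + b * cos x)"
  have *: "smooth_on S f" if "?P f" for f
  proof (rule smooth_on_coinduct[of ?P, OF that])
    fix g assume "?P g"
    then obtain a b where g: "g = (\<lambda>x. a * sin x + b * cos x)" by blast
    have "(g has_real_derivative (- b) * sin x + a * cos x) (at x within S)" for x
      unfolding g by (auto intro!: derivative_eq_intros)
    then show "\<exists>g'. ?P g' \<and> (\<forall>x\<in>S. (g has_real_derivative g' x) (at x within S))" by blast
  qed
  have "sin = (\<lambda>x::real. 1 * sin x + 0 * cos x)" "cos = (\<lambda>x::real. 0 * sin x + 1 * cos x)" by auto
  then show "smooth_on S sin" "smooth_on S cos" using * by blast+
qed

lemma smooth_on_has_deriv:
  assumes "smooth_on S f" "open S" "x \<in> S"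
  shows "(f has_real_derivative deriv f x) (at x)"
proof -
  obtain f' where "(f has_real_derivative f' x) (at x within S)"
    using assms by (blast elim: smooth_on_derivE)
  then have "(f has_real_derivative f' x) (at x)" using at_within_open[OF assms(3,2)] by simp
  then show ?thesis by (simp add: DERIV_imp_deriv)
qed

lemma smooth_on_deriv:
  assumes "smooth_on S f" "open S"
  shows "smooth_on S (deriv f)"
proof -
  obtain f' where f': "smooth_on S f'" "\<And>x. x \<in> S \<Longrightarrow> (f has_real_derivative f' x) (at x within S)"
    using assms(1) by (blast elim: smooth_on_derivE)
  have "f' x = deriv f x" if "x \<in> S" for x
    using f'(2)[OF that] at_within_open[OF that assms(2)] DERIV_imp_deriv by fastforce
  then show ?thesis using f'(1) smooth_on_cong by blast
qed

lemma smooth_on_isCont: "smooth_on S f \<Longrightarrow> open S \<Longrightarrow> x \<in> S \<Longrightarrow> isCont f x"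
  by (meson DERIV_isCont smooth_on_has_deriv)

lemma smooth_on_continuous: "smooth_on S f \<Longrightarrow> open S \<Longrightarrow> continuous_on S f"
  by (simp add: continuous_at_imp_continuous_on smooth_on_isCont)

lemma deriv_pos_imp_strict_mono_on:
  fixes f :: "real \<Rightarrow> real"
  assumes "\<And>x. x \<in> {a<..<b} \<Longrightarrow> (f has_real_derivative f' x) (at x)"
    and "\<And>x. x \<in> {a<..<b} \<Longrightarrow> f' x > 0"
  shows "strict_mono_on {a<..<b} f"
proof (rule strict_mono_onI)
  fix x y assume xy: "x \<in> {a<..<b}" "y \<in> {a<..<b}" "x < y"
  show "f x < f y"
  proof (rule DERIV_pos_imp_increasing[OF xy(3)])
    fix z assume "x \<le> z" "z \<le> y"
    then have "z \<in> {a<..<b}" using xy by auto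
    then show "\<exists>d. DERIV f z :> d \<and> d > 0" using assms by blast
  qed
qed

text \<open>
  A smooth function with positive derivative on an open interval has a smooth inverse: the derivative
  of the inverse \<open>g\<close> is \<open>inverse (deriv f (g y))\<close>, so one more derivative of \<open>g\<close> is gained from
  those already known.
\<close>

lemma smooth_inverse:
  fixes f :: "real \<Rightarrow> real"
  assumes f: "smooth_on {a<..<b} f" and pos: "\<And>x. x \<in> {a<..<b} \<Longrightarrow> deriv f x > 0"
  obtains g where "open (f ` {a<..<b})" "smooth_on (f ` {a<..<b}) g"
    "\<And>x. x \<in> {a<..<b} \<Longrightarrow> g (f x) = x"
    "\<And>y. y \<in> f ` {a<..<b} \<Longrightarrow> (g has_real_derivative inverse (deriv f (g y))) (at y)"
proof -
  let ?I = "{a<..<b}" let ?T = "f ` ?I" let ?g = "the_inv_into ?I f"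
  have mono: "strict_mono_on ?I f"
    by (rule deriv_pos_imp_strict_mono_on) (use f pos smooth_on_has_deriv[OF f] in auto)
  then have inj: "inj_on f ?I" by (rule strict_mono_on_imp_inj_on)
  have cont: "continuous_on ?I f" by (rule smooth_on_continuous[OF f]) simp
  have op: "open ?T" by (rule invariance_of_domain[OF cont _ inj]) simp
  have gf: "?g (f x) = x" if "x \<in> ?I" for x by (rule the_inv_into_f_f[OF inj that])
  have dg: "(?g has_real_derivative inverse (deriv f (?g y))) (at y)" if y: "y \<in> ?T" for y
  proof -
    obtain x where x: "x \<in> ?I" "y = f x" using y by auto
    have "((\<lambda>y. ?g y) has_derivative (\<lambda>h. inverse (deriv f x) * h)) (at (f x))"
    proof (rule has_derivative_inverse_strong[of ?I x f ?g "\<lambda>h. deriv f x * h"])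
      show "(f has_derivative (*) (deriv f x)) (at x)"
        using smooth_on_has_deriv[OF f _ x(1)] by (simp add: has_field_derivative_def)
    qed (use x cont gf pos[OF x(1)] in \<open>auto simp: fun_eq_iff\<close>)
    then show ?thesis using x gf by (simp add: has_field_derivative_def)
  qed
  have "Ck_on k ?T ?g" for k
  proof (induction k)
    case (Suc k)
    have "Ck_on k ?T (\<lambda>y. inverse (deriv f (?g y)))"
    proof (rule Ck_on_inverse)
      show "Ck_on k ?T (\<lambda>y. deriv f (?g y))"
        by (rule Ck_on_compose[OF smooth_on_imp_Ck_on[OF smooth_on_deriv[OF f]] Suc]) (auto simp: gf)
      show "deriv f (?g y) \<noteq> 0" if "y \<in> ?T" for y using that pos gf by force
    qed
    then show ?case by (rule Ck_on_SucI[rotated]) (rule has_field_derivative_at_within[OF dg])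
  qed simp
  then have "smooth_on ?T ?g" using op by (simp add: smooth_on_iff_Ck_on)
  then show thesis using that[OF op _ gf dg] by blast
qed

lemma smooth_deriv_pos_nbhd:
  assumes "smooth_on S f" "open S" "x \<in> S" "deriv f x > 0"
  shows "\<forall>\<^sub>F y in nhds x. y \<in> S \<and> deriv f y > 0"
proof -
  have "isCont (deriv f) x" using assms smooth_on_deriv smooth_on_isCont by blast
  then have "(deriv f \<longlongrightarrow> deriv f x) (nhds x)" by (simp add: continuous_at tendsto_nhds_iff)
  then have "\<forall>\<^sub>F y in nhds x. deriv f y > 0" using assms(4) order_tendstoD(1) by blast
  then show ?thesis using eventually_nhds_in_open[OF assms(2,3)] by eventually_elim auto
qed

lemma eventually_nhds_real_interval:
  fixes x :: real
  assumes "\<forall>\<^sub>F y in nhds x. P y"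
  obtains e where "e > 0" "\<And>y. y \<in> {x - e<..<x + e} \<Longrightarrow> P y"
  using assms unfolding eventually_nhds_metric by (metis dist_real_def greaterThanLessThan_iff abs_diff_less_iff)

lemma smooth_on_arcsin: "smooth_on {-1<..<1} arcsin"
proof -
  obtain g where g: "smooth_on (sin ` {-(pi/2)<..<pi/2}) g"
    "\<And>x. x \<in> {-(pi/2)<..<pi/2} \<Longrightarrow> g (sin x) = x"
    using smooth_inverse[of "-(pi/2)" "pi/2" sin]
    by (smt (verit) smooth_on_sin DERIV_imp_deriv DERIV_sin cos_gt_zero_pi greaterThanLessThan_iff)
  have "arcsin y \<in> {-(pi/2)<..<pi/2}" "sin (arcsin y) = y" if "y \<in> {-1<..<1}" for y
    using that arcsin_lt_bounded[of y] by auto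
  then have "{-1<..<1} \<subseteq> sin ` {-(pi/2)<..<pi/2}" "\<And>y. y \<in> {-1<..<1} \<Longrightarrow> g y = arcsin y"
    using g(2) by (metis image_eqI subsetI, metis)
  then show ?thesis using smooth_on_cong smooth_on_subset g(1) by metis
qed

section \<open>Energies of periodic three-coordinated configurations\<close>

lemma inner_e1_e1: "e1 \<bullet> e1 = 1" and norm_e1: "norm e1 = 1"
proof -
  show "e1 \<bullet> e1 = 1" by (simp add: e1_def inner_vec_def sum_3)
  then show "norm e1 = 1" by (simp add: norm_eq_sqrt_inner)
qed

lemma nearest_diffE:
  obtains t :: int where "t \<in> {-1, 0, 1}" "nearest_diff L x y = x - y + (L * of_int t) *\<^sub>R e1"
    "periodic_dist L x y = norm (nearest_diff L x y)"
proof -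
  let ?f = "\<lambda>t::int. norm (x - y + (L * of_int t) *\<^sub>R e1)" and ?S = "{-1, 0, 1} :: int set"
  let ?t = "arg_min_on ?f ?S"
  have t: "?t \<in> ?S" "\<not> (\<exists>s\<in>?S. ?f s < ?f ?t)"
    using arg_min_if_finite[of ?S ?f] by auto
  have nd: "nearest_diff L x y = x - y + (L * of_int ?t) *\<^sub>R e1"
    unfolding nearest_diff_def Let_def by simp
  have "Min (?f ` ?S) = ?f ?t"
    by (rule Min_eqI) (use t in \<open>auto simp: not_less\<close>)
  then have "periodic_dist L x y = norm (nearest_diff L x y)"
    unfolding periodic_dist_def nd by simp
  with that t(1) nd show thesis by blast
qed

lemma norm_shift_e1:
  assumes "L > 0"
  shows "norm ((L * of_int t) *\<^sub>R e1) = L * of_int \<bar>t\<bar>"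
  using assms by (simp add: norm_e1 abs_mult)

lemma nearest_diff_eqI:
  assumes "L > 2.2" "t \<in> {-1, 0, 1::int}" "norm (x - y + (L * of_int t) *\<^sub>R e1) < 1.1"
  shows "nearest_diff L x y = x - y + (L * of_int t) *\<^sub>R e1"
proof -
  obtain s :: int where s: "s \<in> {-1, 0, 1}" "nearest_diff L x y = x - y + (L * of_int s) *\<^sub>R e1"
    "periodic_dist L x y = norm (nearest_diff L x y)" by (rule nearest_diffE)
  have "periodic_dist L x y \<le> norm (x - y + (L * of_int t) *\<^sub>R e1)"
    unfolding periodic_dist_def using assms(2) by (intro Min_le) auto
  then have le: "norm (x - y + (L * of_int s) *\<^sub>R e1) < 1.1" using assms(3) s by simp
  have "(x - y + (L * of_int s) *\<^sub>R e1) - (x - y + (L * of_int t) *\<^sub>R e1) = (L * of_int (s - t)) *\<^sub>R e1"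
    by (simp add: algebra_simps)
  then have "norm ((L * of_int (s - t)) *\<^sub>R e1) < 2.2"
    using norm_triangle_ineq4[of "x - y + (L * of_int s) *\<^sub>R e1" "x - y + (L * of_int t) *\<^sub>R e1"]
      le assms(3) by simp
  then have "L * of_int \<bar>s - t\<bar> < 2.2" using norm_shift_e1[of L "s - t"] assms(1) by simp
  moreover have "L * 1 \<le> L * of_int \<bar>s - t\<bar>" if "s \<noteq> t"
    using that assms(1) by (intro mult_left_mono) auto
  ultimately have "s = t" using assms(1) by linarith
  then show ?thesis using s by simp
qed

lemma periodic_dist_commute: "periodic_dist L x y = periodic_dist L y x"
proof -
  have "norm (x - y + (L * of_int t) *\<^sub>R e1) = norm (y - x + (L * of_int (- t)) *\<^sub>R e1)" for t :: int
    using norm_minus_cancel[of "x - y + (L * of_int t) *\<^sub>R e1"] by (simp add: algebra_simps)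
  then show ?thesis unfolding periodic_dist_def by (simp add: insert_commute)
qed

lemma bonded_commute: "(x, y) \<in> bonded C L \<longleftrightarrow> (y, x) \<in> bonded C L"
  unfolding bonded_def using periodic_dist_commute by auto

lemma cell_shift_unique:
  assumes "x \<in> cell Z L" "y \<in> cell Z L" "x = y + (L * of_int t) *\<^sub>R e1" "L > 0"
  shows "x = y"
proof -
  have "x \<bullet> e1 = y \<bullet> e1 + L * of_int t" by (simp add: assms(3) inner_add_left inner_e1_e1)
  moreover have "0 \<le> x \<bullet> e1" "x \<bullet> e1 < L" "0 \<le> y \<bullet> e1" "y \<bullet> e1 < L"
    using assms(1,2) by (auto simp: cell_def)
  ultimately have "L * of_int t < L * 1" "L * (-1) < L * of_int t" by linarith+
  then have "of_int t < (1::real)" "(-1::real) < of_int t"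
    using assms(4) by (simp_all only: mult_less_cancel_left_pos)
  then have "t = 0" by linarith
  then show ?thesis using assms(3) by simp
qed

text \<open>
  The difference vectors from a point \<open>y\<close> of the cell to its bonded partners in the cell are exactly
  the bond vectors of length less than \<open>1.1\<close> leaving \<open>y\<close> in the infinite periodic configuration.
  Since \<open>L > 2.2\<close>, no two images of the same point lie within bonding distance of \<open>y\<close>.
\<close>

lemma bij_betw_nearest_diff:
  fixes Z :: "(real ^ 3) set"
  assumes L: "L > 2.2" and per: "\<And>x t. x \<in> Z \<Longrightarrow> x + (L * of_int t) *\<^sub>R e1 \<in> Z"
    and y: "y \<in> cell Z L"
  shows "bij_betw (\<lambda>x. nearest_diff L x y) {x. (x, y) \<in> bonded (cell Z L) L}
           {v. v \<noteq> 0 \<and> y + v \<in> Z \<and> norm v < 1.1}"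
    (is "bij_betw ?f ?N ?V")
  unfolding bij_betw_def
proof (intro conjI equalityI subsetI inj_onI)
  fix x x' assume x: "x \<in> ?N" "x' \<in> ?N" and eq: "?f x = ?f x'"
  obtain t where t: "?f x = x - y + (L * of_int t) *\<^sub>R e1" by (rule nearest_diffE[of L x y])
  obtain t' where t': "?f x' = x' - y + (L * of_int t') *\<^sub>R e1" by (rule nearest_diffE[of L x' y])
  have "x = x' + (L * of_int (t' - t)) *\<^sub>R e1" using eq t t' by (simp add: algebra_simps)
  moreover have "x \<in> cell Z L" "x' \<in> cell Z L" using x by (auto simp: bonded_def)
  ultimately show "x = x'" using L by (intro cell_shift_unique[of x Z L x' "t' - t"]) auto
next
  fix v assume "v \<in> ?f ` ?N"
  then obtain x where x: "(x, y) \<in> bonded (cell Z L) L" "v = ?f x" by auto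
  obtain t where t: "?f x = x - y + (L * of_int t) *\<^sub>R e1" "periodic_dist L x y = norm (?f x)"
    by (rule nearest_diffE[of L x y])
  have "v \<noteq> 0"
  proof
    assume "v = 0"
    then have "y = x + (L * of_int t) *\<^sub>R e1" using x t by (simp add: algebra_simps)
    then show False using cell_shift_unique[of y Z L x t] x y L by (auto simp: bonded_def)
  qed
  moreover have "y + v = x + (L * of_int t) *\<^sub>R e1" using x t by simp
  then have "y + v \<in> Z" using per x by (auto simp: bonded_def cell_def)
  moreover have "norm v < 1.1" using x t by (auto simp: bonded_def)
  ultimately show "v \<in> ?V" by simp
next
  fix v assume v: "v \<in> ?V"
  have "\<bar>v \<bullet> e1\<bar> < 1.1" using v Cauchy_Schwarz_ineq2[of v e1] by (simp add: norm_e1)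
  moreover have "0 \<le> y \<bullet> e1" "y \<bullet> e1 < L" using y by (auto simp: cell_def)
  ultimately have b: "- L < (y + v) \<bullet> e1" "(y + v) \<bullet> e1 < 2 * L"
    using L by (auto simp: inner_add_left)
  define s :: int where "s = (if (y + v) \<bullet> e1 < 0 then 1 else if (y + v) \<bullet> e1 < L then 0 else -1)"
  define x where "x = y + v + (L * of_int s) *\<^sub>R e1"
  have "x \<bullet> e1 = (y + v) \<bullet> e1 + L * of_int s" by (simp add: x_def inner_add_left inner_e1_e1)
  then have "x \<bullet> e1 \<in> {0..<L}" using b by (auto simp: s_def)
  moreover have "x \<in> Z" unfolding x_def using v per by blast
  ultimately have xC: "x \<in> cell Z L" by (simp add: cell_def)
  have veq: "v = x - y + (L * of_int (- s)) *\<^sub>R e1" by (simp add: x_def algebra_simps)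
  have "-s \<in> {-1, 0, 1}" by (simp add: s_def)
  then have fx: "?f x = v" using nearest_diff_eqI[OF L, of "-s" x y] veq v by auto
  have "periodic_dist L x y = norm v" using fx by (metis nearest_diffE)
  moreover have "x \<noteq> y"
  proof
    assume "x = y"
    then have "v = (L * of_int (- s)) *\<^sub>R e1" using veq by simp
    then have "norm v = L * of_int \<bar>s\<bar>" using norm_shift_e1[of L "- s"] L by simp
    moreover have "s \<noteq> 0" using v \<open>v = (L * of_int (- s)) *\<^sub>R e1\<close> by auto
    then have "\<bar>s\<bar> = 1" by (auto simp: s_def split: if_splits)
    ultimately have "norm v = L" by simp
    then show False using v L by simp
  qed
  ultimately have "(x, y) \<in> bonded (cell Z L) L" using xC y v by (auto simp: bonded_def)
  then show "v \<in> ?f ` ?N" using fx by (auto intro!: image_eqI[of _ _ x])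
qed

text \<open>
  If every point has three bonds, one of length \<open>l1\<close> and two of length \<open>l2\<close>, with angle \<open>al\<close> between
  bonds of different kind and \<open>be\<close> between the two of the same kind, then all points contribute equally
  to the energy. Each point is the vertex of six ordered triples.
\<close>

lemma energy_three_coordinated:
  fixes Z :: "(real ^ 3) set"
  assumes L: "L > 2.2" and per: "\<And>x t. x \<in> Z \<Longrightarrow> x + (L * of_int t) *\<^sub>R e1 \<in> Z"
    and fin: "finite (cell Z L)"
    and nb: "\<And>y. y \<in> cell Z L \<Longrightarrow> \<exists>u v w. u \<noteq> v \<and> u \<noteq> w \<and> v \<noteq> w \<and>
          {v. v \<noteq> 0 \<and> y + v \<in> Z \<and> norm v < 1.1} = {u, v, w} \<and>
          norm u = l1 \<and> norm v = l2 \<and> norm w = l2 \<and>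
          arccos (u \<bullet> v / (l1 * l2)) = al \<and> arccos (u \<bullet> w / (l1 * l2)) = al \<and>
          arccos (v \<bullet> w / (l2 * l2)) = be"
  shows "energy v2 v3 (cell Z L) L =
    real (card (cell Z L)) * (v2 l1 / 2 + v2 l2 + 2 * v3 al + v3 be)"
proof -
  let ?C = "cell Z L" and ?N = "\<lambda>y. {x. (x, y) \<in> bonded (cell Z L) L}"
    and ?V = "\<lambda>y. {v. v \<noteq> 0 \<and> y + v \<in> Z \<and> norm v < 1.1}"
    and ?f = "\<lambda>y x. nearest_diff L x y"
  have bij: "bij_betw (?f y) (?N y) (?V y)" if "y \<in> ?C" for y
    using bij_betw_nearest_diff[OF L per that] .
  have finN: "finite (?N y)" for y by (rule finite_subset[OF _ fin]) (auto simp: bonded_def)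
  have "(\<Sum>(x, y)\<in>bonded ?C L. v2 (periodic_dist L x y)) =
      (\<Sum>(y, x)\<in>Sigma ?C ?N. v2 (periodic_dist L x y))"
    by (rule sum.reindex_bij_witness[of _ prod.swap prod.swap]) (auto simp: bonded_def)
  also have "\<dots> = (\<Sum>y\<in>?C. \<Sum>x\<in>?N y. v2 (periodic_dist L x y))"
    by (rule sum.Sigma[symmetric]) (use fin finN in auto)
  also have "\<dots> = (\<Sum>y\<in>?C. v2 l1 + 2 * v2 l2)"
  proof (rule sum.cong[OF refl])
    fix y assume y: "y \<in> ?C"
    obtain u v w where uvw: "u \<noteq> v" "u \<noteq> w" "v \<noteq> w" "?V y = {u, v, w}"
      "norm u = l1" "norm v = l2" "norm w = l2" using nb[OF y] by blast
    have "(\<Sum>x\<in>?N y. v2 (periodic_dist L x y)) = (\<Sum>x\<in>?N y. v2 (norm (?f y x)))"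
      by (metis nearest_diffE)
    also have "\<dots> = (\<Sum>v\<in>?V y. v2 (norm v))" using bij[OF y] by (rule sum.reindex_bij_betw)
    also have "\<dots> = v2 l1 + 2 * v2 l2" unfolding uvw(4) using uvw by simp
    finally show "(\<Sum>x\<in>?N y. v2 (periodic_dist L x y)) = v2 l1 + 2 * v2 l2" .
  qed
  finally have two: "(\<Sum>(x, y)\<in>bonded ?C L. v2 (periodic_dist L x y)) = real (card ?C) * (v2 l1 + 2 * v2 l2)"
    by simp
  have "(\<Sum>(x, y, z)\<in>bond_triples ?C L. v3 (bond_angle L x y z)) =
      (\<Sum>(y, x, z)\<in>(SIGMA y:?C. SIGMA x:?N y. ?N y - {x}). v3 (bond_angle L x y z))"
    by (rule sum.reindex_bij_witness[of _ "\<lambda>(y, x, z). (x, y, z)" "\<lambda>(x, y, z). (y, x, z)"])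
      (auto simp: bond_triples_def bonded_commute[of _ _ "cell Z L"] bonded_def periodic_dist_commute)
  also have "\<dots> = (\<Sum>y\<in>?C. \<Sum>(x, z)\<in>(SIGMA x:?N y. ?N y - {x}). v3 (bond_angle L x y z))"
    by (subst sum.Sigma) (use fin finN in auto)
  also have "\<dots> = (\<Sum>y\<in>?C. 4 * v3 al + 2 * v3 be)"
  proof (rule sum.cong[OF refl])
    fix y assume y: "y \<in> ?C"
    obtain u v w where uvw: "u \<noteq> v" "u \<noteq> w" "v \<noteq> w" "?V y = {u, v, w}"
      "norm u = l1" "norm v = l2" "norm w = l2"
      "arccos (u \<bullet> v / (l1 * l2)) = al" "arccos (u \<bullet> w / (l1 * l2)) = al"
      "arccos (v \<bullet> w / (l2 * l2)) = be" using nb[OF y] by blast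
    let ?g = "\<lambda>u w. v3 (arccos (u \<bullet> w / (norm u * norm w)))"
    have "(\<Sum>(x, z)\<in>(SIGMA x:?N y. ?N y - {x}). v3 (bond_angle L x y z)) =
        (\<Sum>x\<in>?N y. \<Sum>z\<in>?N y - {x}. ?g (?f y x) (?f y z))"
      by (subst sum.Sigma) (use finN in \<open>auto simp: bond_angle_def Let_def\<close>)
    also have "\<dots> = (\<Sum>x\<in>?N y. \<Sum>v\<in>?V y - {?f y x}. ?g (?f y x) v)"
    proof (rule sum.cong[OF refl])
      fix x assume x: "x \<in> ?N y"
      have "bij_betw (?f y) (?N y - {x}) (?V y - {?f y x})"
        using bij_betw_DiffI[OF bij[OF y], of "{x}" "{?f y x}"] x bij_betw_apply[OF bij[OF y] x]
        by (simp add: bij_betw_def)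
      then show "(\<Sum>z\<in>?N y - {x}. ?g (?f y x) (?f y z)) = (\<Sum>v\<in>?V y - {?f y x}. ?g (?f y x) v)"
        by (rule sum.reindex_bij_betw)
    qed
    also have "\<dots> = (\<Sum>u\<in>?V y. \<Sum>v\<in>?V y - {u}. ?g u v)"
      using bij[OF y] by (rule sum.reindex_bij_betw)
    also have "\<dots> = ?g u v + ?g u w + (?g v u + ?g v w) + (?g w u + ?g w v)"
    proof -
      have "{u, v, w} - {u} = {v, w}" "{u, v, w} - {v} = {u, w}" "{u, v, w} - {w} = {u, v}"
        using uvw(1-3) by auto
      then show ?thesis unfolding uvw(4) using uvw(1-3) by simp
    qed
    also have "\<dots> = 4 * v3 al + 2 * v3 be"
    proof -
      have "?g u v = v3 al" "?g u w = v3 al" "?g v w = v3 be"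
        using uvw(5-) by auto
      moreover have "?g a b = ?g b a" for a b :: "real ^ 3" by (simp add: inner_commute mult.commute)
      ultimately show ?thesis by (smt (verit))
    qed
    finally show "(\<Sum>(x, z)\<in>(SIGMA x:?N y. ?N y - {x}). v3 (bond_angle L x y z)) = 4 * v3 al + 2 * v3 be" .
  qed
  finally have three: "(\<Sum>(x, y, z)\<in>bond_triples ?C L. v3 (bond_angle L x y z)) =
      real (card ?C) * (4 * v3 al + 2 * v3 be)" by simp
  show ?thesis unfolding energy_def two three by (simp add: algebra_simps)
qed

section \<open>Geometry and energy of zigzag tubes\<close>

text \<open>
  The tube is a stack of rings, numbered along the axis by integers. \<open>axial_pos \<mu> \<sigma> p\<close> is the first
  coordinate of ring \<open>p\<close>: consecutive rings are alternately \<open>\<sigma>\<close> and \<open>\<mu> / 2 - \<sigma>\<close> apart.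
\<close>

definition axial_pos :: "real \<Rightarrow> real \<Rightarrow> int \<Rightarrow> real" where
  "axial_pos \<mu> \<sigma> p = of_int (p div 2) * (\<mu> / 2) + of_int (p mod 2) * \<sigma>"

text \<open>
  The point on ring \<open>p\<close> at angle \<open>a * pi / ell\<close> about the axis. The ring carries the angles with
  \<open>a\<close> of the same parity as \<open>(p + 1) div 2\<close>, i.e. parities even, odd, odd, even, and so on.
\<close>

definition node :: "nat \<Rightarrow> real \<Rightarrow> real \<Rightarrow> real \<Rightarrow> int \<Rightarrow> int \<Rightarrow> real ^ 3" where
  "node ell \<mu> \<sigma> \<rho> p a =
     vector [axial_pos \<mu> \<sigma> p, \<rho> * cos (pi * of_int a / real ell), \<rho> * sin (pi * of_int a / real ell)]"

lemma cos_sin_mod: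
  assumes "ell > 0"
  shows "cos (pi * of_int (a mod (2 * int ell)) / real ell) = cos (pi * of_int a / real ell)"
    and "sin (pi * of_int (a mod (2 * int ell)) / real ell) = sin (pi * of_int a / real ell)"
proof -
  let ?q = "a div (2 * int ell)" and ?r = "a mod (2 * int ell)"
  have "real_of_int a = real_of_int (2 * int ell * ?q + ?r)" by simp
  then have "pi * of_int a / real ell = pi * of_int ?r / real ell + 2 * pi * of_int ?q"
    using assms by (simp add: field_simps)
  then show "cos (pi * of_int ?r / real ell) = cos (pi * of_int a / real ell)"
    "sin (pi * of_int ?r / real ell) = sin (pi * of_int a / real ell)"
    by (simp_all add: cos_add sin_add cos_int_2pin sin_int_2pin)
qed

lemma cos_le_of_mod:
  fixes b k :: int
  assumes "ell > 0" "0 \<le> k" "k \<le> b mod (2 * int ell)" "b mod (2 * int ell) \<le> 2 * int ell - k"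
  shows "cos (pi * of_int b / real ell) \<le> cos (pi * of_int k / real ell)"
proof -
  let ?r = "b mod (2 * int ell)"
  have k: "k \<le> int ell" using assms by linarith
  have le: "cos (pi * of_int r / real ell) \<le> cos (pi * of_int k / real ell)" if "k \<le> r" "r \<le> int ell" for r
  proof (rule cos_monotone_0_pi_le)
    show "0 \<le> pi * of_int k / real ell" using assms by simp
    show "pi * of_int k / real ell \<le> pi * of_int r / real ell"
      using that assms by (intro divide_right_mono mult_left_mono) auto
    have "pi * of_int r \<le> pi * real ell" using that by (intro mult_left_mono) (auto simp: of_int_le_iff[of r "int ell", where ?'a=real, simplified])
    then show "pi * of_int r / real ell \<le> pi" using assms by (simp add: field_simps)
  qed
  show ?thesis
  proof (cases "?r \<le> int ell")
    case True
    then show ?thesis using le[of ?r] assms cos_sin_mod(1)[of ell b] by simp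
  next
    case False
    have "pi * of_int (2 * int ell - ?r) / real ell = 2 * pi - pi * of_int ?r / real ell"
      using assms(1) by (simp add: field_simps)
    then have "cos (pi * of_int (2 * int ell - ?r) / real ell) = cos (pi * of_int ?r / real ell)"
      by (simp only: cos_2pi_minus)
    then show ?thesis using le[of "2 * int ell - ?r"] assms cos_sin_mod(1)[of ell b] False by simp
  qed
qed

lemma node_cong:
  assumes "ell > 0" "a mod (2 * int ell) = b mod (2 * int ell)"
  shows "node ell \<mu> \<sigma> \<rho> p a = node ell \<mu> \<sigma> \<rho> p b"
  unfolding node_def using cos_sin_mod[OF assms(1), of a] cos_sin_mod[OF assms(1), of b] assms(2) by metis

lemma inner_node_diff:
  "(node ell \<mu> \<sigma> \<rho> p a - node ell \<mu> \<sigma> \<rho> q b) \<bullet> (node ell \<mu> \<sigma> \<rho> p' a' - node ell \<mu> \<sigma> \<rho> q b) =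
     (axial_pos \<mu> \<sigma> p - axial_pos \<mu> \<sigma> q) * (axial_pos \<mu> \<sigma> p' - axial_pos \<mu> \<sigma> q) +
     \<rho>\<^sup>2 * (cos (pi * of_int (a - a') / real ell) - cos (pi * of_int (a - b) / real ell)
         - cos (pi * of_int (a' - b) / real ell) + 1)"
proof -
  have *: "cos (pi * of_int (x - y) / real ell) = cos (pi * of_int x / real ell) * cos (pi * of_int y / real ell)
    + sin (pi * of_int x / real ell) * sin (pi * of_int y / real ell)" for x y
    by (simp add: diff_divide_distrib right_diff_distrib cos_diff)
  have "(\<rho> * c - \<rho> * c'') * (\<rho> * c' - \<rho> * c'') + (\<rho> * s - \<rho> * s'') * (\<rho> * s' - \<rho> * s'')
      = \<rho>\<^sup>2 * ((c * c' + s * s') - (c * c'' + s * s'') - (c' * c'' + s' * s'') + 1)"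
    if "c'' * c'' + s'' * s'' = 1" for c c' c'' s s' s'' :: real
    using that by algebra
  note this[OF sin_cos_squared_add3]
  then show ?thesis unfolding *
    by (simp add: node_def inner_vec_def sum_3 vector_3)
qed

lemma norm_node_diff:
  "(norm (node ell \<mu> \<sigma> \<rho> p a - node ell \<mu> \<sigma> \<rho> q b))\<^sup>2 =
     (axial_pos \<mu> \<sigma> p - axial_pos \<mu> \<sigma> q)\<^sup>2 + 2 * \<rho>\<^sup>2 * (1 - cos (pi * of_int (a - b) / real ell))"
  unfolding power2_norm_eq_inner inner_node_diff by (simp add: power2_eq_square algebra_simps)

text \<open>
  Seen from an odd ring, the stack looks like its mirror image seen from an even ring.
\<close>

lemma axial_pos_diff:
  fixes p d :: int
  defines "s \<equiv> (if even p then 1 else -1 :: int)"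
  shows "axial_pos \<mu> \<sigma> (p + s * d) - axial_pos \<mu> \<sigma> p = of_int s * axial_pos \<mu> \<sigma> d"
proof (cases "even p")
  case True
  then obtain q where "p = 2 * q" by blast
  then show ?thesis by (simp add: axial_pos_def s_def algebra_simps)
next
  case False
  then obtain q where p: "p = 2 * q + 1" by (elim oddE)
  show ?thesis
  proof (cases "even d")
    case True
    then obtain e where "d = 2 * e" by blast
    moreover have "2 * q + 1 - 2 * e = 2 * (q - e) + 1" by simp
    then have "(2 * q + 1 - 2 * e) div 2 = q - e" "(2 * q + 1 - 2 * e) mod 2 = 1" by presburger+
    ultimately show ?thesis using p by (auto simp: axial_pos_def s_def) (simp add: field_simps)?
  next
    case False
    then obtain e where "d = 2 * e + 1" by (elim oddE)
    then show ?thesis using p by (auto simp: axial_pos_def s_def) (simp add: field_simps)?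
  qed
qed

lemma axial_pos_strict_mono:
  assumes "0 < \<sigma>" "\<sigma> < \<mu> / 2" "p < q"
  shows "axial_pos \<mu> \<sigma> p < axial_pos \<mu> \<sigma> q"
proof -
  have step: "axial_pos \<mu> \<sigma> x < axial_pos \<mu> \<sigma> (x + 1)" for x
  proof (cases "even x")
    case True
    then obtain y where "x = 2 * y" by blast
    then show ?thesis using assms(1) by (simp add: axial_pos_def)
  next
    case False
    then obtain y where x: "x = 2 * y + 1" by (elim oddE)
    have "x + 1 = 2 * (y + 1)" using x by simp
    then have "axial_pos \<mu> \<sigma> (x + 1) = of_int (y + 1) * (\<mu> / 2)"
      unfolding axial_pos_def by simp
    then show ?thesis using x assms(2) by (simp add: axial_pos_def algebra_simps)
  qed
  show ?thesis using assms(3)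
  proof (induction q rule: int_gr_induct)
    case (step i)
    then show ?case using \<open>\<And>x. axial_pos \<mu> \<sigma> x < axial_pos \<mu> \<sigma> (x + 1)\<close> less_trans by blast
  qed (use step in auto)
qed

text \<open>
  All points of the tube in the numbering by rings.
\<close>

definition zigzag_nodes :: "nat \<Rightarrow> real \<Rightarrow> real \<Rightarrow> real \<Rightarrow> (real ^ 3) set" where
  "zigzag_nodes ell \<mu> \<sigma> \<rho> = {node ell \<mu> \<sigma> \<rho> p a | p a. even (a - (p + 1) div 2)}"

text \<open>
  The point with indices \<open>i\<close>, \<open>j\<close>, \<open>k\<close>, \<open>l\<close> lies on ring \<open>4 * j + 2 * k + 3 * l\<close> at the angle
  numbered \<open>2 * i + k\<close>.
\<close>

lemma zigzag_points_eq_nodes: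
  assumes "ell > 0" "\<mu> = 2 * \<sigma> + 2 * lam1"
  shows "zigzag_points ell lam1 \<sigma> \<rho> = zigzag_nodes ell \<mu> \<sigma> \<rho>"
proof (intro equalityI subsetI)
  have pt: "vector [real k * (lam1 + \<sigma>) + of_int j * (2 * \<sigma> + 2 * lam1) + real l * (2 * \<sigma> + lam1),
              \<rho> * cos (pi * real (2 * i + k) / real ell),
              \<rho> * sin (pi * real (2 * i + k) / real ell)] =
            node ell \<mu> \<sigma> \<rho> (4 * j + 2 * int k + 3 * int l) (2 * int i + int k)"
    if "k \<in> {0, 1}" "l \<in> {0, 1}" for k l i :: nat and j :: int
  proof -
    have "(4 * j + 2) div 2 = 2 * j + 1" "(4 * j + 3) div 2 = 2 * j + 1" "(4 * j + 5) div 2 = 2 * j + 2"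
      "(4 * j + 2) mod 2 = 0" "(4 * j + 3) mod 2 = 1" "(4 * j + 5) mod 2 = 1" by presburger+
    then have "real k * (lam1 + \<sigma>) + of_int j * (2 * \<sigma> + 2 * lam1) + real l * (2 * \<sigma> + lam1)
        = axial_pos \<mu> \<sigma> (4 * j + 2 * int k + 3 * int l)"
      using that assms(2) by (auto simp: axial_pos_def algebra_simps)
    then show ?thesis by (simp add: node_def)
  qed
  {
    fix x assume "x \<in> zigzag_points ell lam1 \<sigma> \<rho>"
    then obtain i k l :: nat and j :: int where kl: "k \<in> {0, 1}" "l \<in> {0, 1}" and
      "x = vector [real k * (lam1 + \<sigma>) + of_int j * (2 * \<sigma> + 2 * lam1) + real l * (2 * \<sigma> + lam1),
              \<rho> * cos (pi * real (2 * i + k) / real ell),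
              \<rho> * sin (pi * real (2 * i + k) / real ell)]"
      unfolding zigzag_points_def by blast
    then have x: "x = node ell \<mu> \<sigma> \<rho> (4 * j + 2 * int k + 3 * int l) (2 * int i + int k)"
      using pt[OF kl, of j i] by simp
    have "even (2 * int i + int k - (4 * j + 2 * int k + 3 * int l + 1) div 2)"
      using kl by (elim insertE emptyE; simp; presburger?)
    then show "x \<in> zigzag_nodes ell \<mu> \<sigma> \<rho>" unfolding zigzag_nodes_def x by blast
  }
  {
    fix x assume "x \<in> zigzag_nodes ell \<mu> \<sigma> \<rho>"
    then obtain p a where x: "x = node ell \<mu> \<sigma> \<rho> p a" and ev: "even (a - (p + 1) div 2)"
      unfolding zigzag_nodes_def by blast
    define k where "k = nat (((p + 1) div 2) mod 2)"
    define l where "l = nat (p mod 2)"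
    define j where "j = (p - 2 * int k - 3 * int l) div 4"
    have kl: "k \<in> {0, 1}" "l \<in> {0, 1}" unfolding k_def l_def by auto
    have p: "p = 4 * j + 2 * int k + 3 * int l" unfolding j_def k_def l_def by simp presburger
    define r where "r = (a - int k) mod (2 * int ell)"
    have "even (a - int k)" using ev unfolding k_def by simp
    then have "even r" unfolding r_def by (simp add: dvd_mod_iff)
    moreover have r: "0 \<le> r" "r < 2 * int ell" using assms(1) by (simp_all add: r_def)
    ultimately obtain i0 where "r = 2 * i0" "0 \<le> i0" "i0 < int ell" by (elim evenE) auto
    then obtain i' where i': "r = 2 * int i'" "i' < ell"
      by (metis of_nat_less_iff zero_le_imp_eq_int)
    define i where "i = (if i' = 0 then ell else i')"
    have "(a - int k) mod (2 * int ell) = (2 * int i) mod (2 * int ell)"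
      using i' by (auto simp: i_def r_def)
    then have "(a - int k + int k) mod (2 * int ell) = (2 * int i + int k) mod (2 * int ell)"
      by (metis mod_add_left_eq)
    then have "x = node ell \<mu> \<sigma> \<rho> p (2 * int i + int k)"
      using x node_cong[OF assms(1), of a "2 * int i + int k"] by simp
    then have "x = vector [real k * (lam1 + \<sigma>) + of_int j * (2 * \<sigma> + 2 * lam1) + real l * (2 * \<sigma> + lam1),
              \<rho> * cos (pi * real (2 * i + k) / real ell),
              \<rho> * sin (pi * real (2 * i + k) / real ell)]"
      using pt[OF kl, of j i] p by simp
    moreover have "i \<in> {1..ell}" using i' assms(1) by (auto simp: i_def)
    ultimately show "x \<in> zigzag_points ell lam1 \<sigma> \<rho>"
      unfolding zigzag_points_def using kl by blast
  }
qed

lemma node_shift: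
  "node ell \<mu> \<sigma> \<rho> (p + 4 * t) a = node ell \<mu> \<sigma> \<rho> p a + (\<mu> * of_int t) *\<^sub>R e1"
proof -
  have "(p + 4 * t) div 2 = p div 2 + 2 * t" "(p + 4 * t) mod 2 = p mod 2" by presburger+
  then have "axial_pos \<mu> \<sigma> (p + 4 * t) = axial_pos \<mu> \<sigma> p + \<mu> * of_int t"
    unfolding axial_pos_def by (simp add: algebra_simps)
  then show ?thesis by (simp add: node_def vec_eq_iff forall_3 e1_def)
qed

lemma zigzag_nodes_periodic:
  assumes "x \<in> zigzag_nodes ell \<mu> \<sigma> \<rho>"
  shows "x + (real m * \<mu> * of_int t) *\<^sub>R e1 \<in> zigzag_nodes ell \<mu> \<sigma> \<rho>"
proof -
  obtain p a where x: "x = node ell \<mu> \<sigma> \<rho> p a" and ev: "even (a - (p + 1) div 2)"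
    using assms unfolding zigzag_nodes_def by blast
  have "x + (real m * \<mu> * of_int t) *\<^sub>R e1 = node ell \<mu> \<sigma> \<rho> (p + 4 * (int m * t)) a"
    unfolding x node_shift by (simp add: algebra_simps)
  moreover have "(p + 4 * (int m * t) + 1) div 2 = (p + 1) div 2 + 2 * (int m * t)" by presburger
  then have "even (a - (p + 4 * (int m * t) + 1) div 2)" using ev by simp
  ultimately show ?thesis unfolding zigzag_nodes_def by blast
qed

lemma node_inner_e1: "node ell \<mu> \<sigma> \<rho> p a \<bullet> e1 = axial_pos \<mu> \<sigma> p"
  by (simp add: node_def e1_def inner_vec_def sum_3 vector_3)

lemma node_eqD:
  assumes "ell > 0" "\<rho> > 0" "0 < \<sigma>" "\<sigma> < \<mu> / 2" "node ell \<mu> \<sigma> \<rho> p a = node ell \<mu> \<sigma> \<rho> q b"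
  shows "p = q" "(a - b) mod (2 * int ell) = 0"
proof -
  have "axial_pos \<mu> \<sigma> p = axial_pos \<mu> \<sigma> q" by (metis assms(5) node_inner_e1)
  then show pq: "p = q"
    using axial_pos_strict_mono[OF assms(3,4), of p q] axial_pos_strict_mono[OF assms(3,4), of q p]
    by (cases p q rule: linorder_cases) auto
  have "2 * \<rho>\<^sup>2 * (1 - cos (pi * of_int (a - b) / real ell)) = 0"
    using norm_node_diff[of ell \<mu> \<sigma> \<rho> p a q b] assms(5) pq by simp
  then have "cos (pi * of_int (a - b) / real ell) = 1" using assms(2) by simp
  moreover have "cos (pi * of_int 1 / real ell) < 1"
    using cos_monotone_0_pi[of 0 "pi / real ell"] assms(1) by (simp add: field_simps)
  ultimately have "\<not> (1 \<le> (a - b) mod (2 * int ell) \<and> (a - b) mod (2 * int ell) \<le> 2 * int ell - 1)"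
    using cos_le_of_mod[OF assms(1), of 1 "a - b"] by auto
  moreover have "0 \<le> (a - b) mod (2 * int ell)" "(a - b) mod (2 * int ell) < 2 * int ell"
    using assms(1) by simp_all
  ultimately show "(a - b) mod (2 * int ell) = 0" by linarith
qed

lemma card_cell_zigzag_nodes:
  assumes "ell > 0" "\<rho> > 0" "0 < \<sigma>" "\<sigma> < \<mu> / 2"
  shows "finite (cell (zigzag_nodes ell \<mu> \<sigma> \<rho>) (real m * \<mu>))"
    and "card (cell (zigzag_nodes ell \<mu> \<sigma> \<rho>) (real m * \<mu>)) = 4 * m * ell"
proof -
  let ?C = "cell (zigzag_nodes ell \<mu> \<sigma> \<rho>) (real m * \<mu>)"
  let ?I = "{0..<4 * int m} \<times> {0..<int ell}"
  let ?f = "\<lambda>(p, i). node ell \<mu> \<sigma> \<rho> p (2 * i + (p + 1) div 2)"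
  have ax0: "axial_pos \<mu> \<sigma> 0 = 0" by (simp add: axial_pos_def)
  have "(4 * int m) div 2 = 2 * int m" by presburger
  then have axm: "axial_pos \<mu> \<sigma> (4 * int m) = real m * \<mu>" by (simp add: axial_pos_def)
  have mono: "axial_pos \<mu> \<sigma> p < axial_pos \<mu> \<sigma> q \<longleftrightarrow> p < q" for p q
    using axial_pos_strict_mono[OF assms(3,4), of p q] axial_pos_strict_mono[OF assms(3,4), of q p]
    by (cases p q rule: linorder_cases) auto
  have incell: "0 \<le> axial_pos \<mu> \<sigma> p \<and> axial_pos \<mu> \<sigma> p < real m * \<mu> \<longleftrightarrow> p \<in> {0..<4 * int m}" for p
    using mono[of p 0] mono[of p "4 * int m"] ax0 axm by auto
  have inj: "inj_on ?f ?I"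
  proof (rule inj_onI; clarify)
    fix p i q j assume i: "i \<in> {0..<int ell}" and j: "j \<in> {0..<int ell}"
      and eq: "node ell \<mu> \<sigma> \<rho> p (2 * i + (p + 1) div 2) = node ell \<mu> \<sigma> \<rho> q (2 * j + (q + 1) div 2)"
    have "p = q" by (rule node_eqD[OF assms eq])
    moreover have "(2 * i + (p + 1) div 2 - (2 * j + (q + 1) div 2)) mod (2 * int ell) = 0"
      by (rule node_eqD[OF assms eq])
    ultimately have "(2 * (i - j)) mod (2 * int ell) = 0" by (simp add: right_diff_distrib)
    then have "(i - j) mod int ell = 0" by (simp only: mult_mod_right[symmetric])
    then have "i mod int ell = j mod int ell" by (simp add: mod_eq_dvd_iff dvd_eq_mod_eq_0)
    then have "i - j = 0" using i j by simp
    then show "p = q \<and> i = j" using \<open>p = q\<close> by simp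
  qed
  have img: "?C = ?f ` ?I"
  proof (intro equalityI subsetI)
    fix x assume "x \<in> ?C"
    then obtain p a where x: "x = node ell \<mu> \<sigma> \<rho> p a" and ev: "even (a - (p + 1) div 2)"
      and "axial_pos \<mu> \<sigma> p \<in> {0..<real m * \<mu>}"
      unfolding cell_def zigzag_nodes_def mem_Collect_eq by (metis node_inner_e1)
    then have p: "p \<in> {0..<4 * int m}" using incell by simp
    obtain b where b: "a - (p + 1) div 2 = 2 * b" using ev by blast
    have "2 * (b mod int ell) = (2 * b) mod (2 * int ell)" by (rule mult_mod_right)
    then have "(2 * (b mod int ell) + (p + 1) div 2) mod (2 * int ell) = (2 * b + (p + 1) div 2) mod (2 * int ell)"
      by (simp only: mod_add_left_eq)
    moreover have "a = 2 * b + (p + 1) div 2" using b by simp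
    ultimately have "node ell \<mu> \<sigma> \<rho> p a = node ell \<mu> \<sigma> \<rho> p (2 * (b mod int ell) + (p + 1) div 2)"
      using node_cong[OF assms(1), of a "2 * (b mod int ell) + (p + 1) div 2"] by simp
    then have "x = ?f (p, b mod int ell)" using x by simp
    moreover have "b mod int ell \<in> {0..<int ell}" using assms(1) by simp
    ultimately show "x \<in> ?f ` ?I" using p by blast
  next
    fix x assume "x \<in> ?f ` ?I"
    then obtain p i where x: "x = node ell \<mu> \<sigma> \<rho> p (2 * i + (p + 1) div 2)" "p \<in> {0..<4 * int m}" by auto
    have "even (2 * i + (p + 1) div 2 - (p + 1) div 2)" by simp
    then have "x \<in> zigzag_nodes ell \<mu> \<sigma> \<rho>" unfolding zigzag_nodes_def x by blast
    then show "x \<in> ?C"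
      using x incell[of p] by (auto simp: cell_def node_inner_e1)
  qed
  show "finite (?C)" unfolding img by simp
  show "card (?C) = 4 * m * ell"
    unfolding img card_image[OF inj] by (simp add: card_cartesian_product nat_mult_distrib)
qed

text \<open>
  The bonds of the point with coordinates \<open>p\<close>, \<open>a\<close>: one parallel to the axis, of length \<open>l1\<close>, and
  two to the adjacent ring at distance \<open>\<sigma>\<close>, of length \<open>l2\<close>. A point whose angle differs by at least
  two steps is at squared distance more than \<open>1.21\<close>, because two steps alone give
  \<open>2 * (l2\<^sup>2 - \<sigma>\<^sup>2) * (1 + cos (pi / ell))\<close>; a point two or more rings away is at axial distance at least
  \<open>\<mu> / 2\<close>.
\<close>

lemma zigzag_node_neighbours:
  fixes ell :: nat and p a :: int and \<mu> \<sigma> \<rho> l1 l2 :: real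
  defines "s \<equiv> (if even p then 1 else -1 :: int)"
  defines "N \<equiv> \<lambda>q b. node ell \<mu> \<sigma> \<rho> q b - node ell \<mu> \<sigma> \<rho> p a"
  assumes ell: "ell \<ge> 4" and l1: "l1 \<in> {0.9<..<1.1}" and l2: "l2 \<in> {0.9<..<1.1}"
    and \<mu>: "\<mu> \<in> {2.6<..<3.1}" "\<mu> = 2 * \<sigma> + 2 * l1"
    and \<rho>: "\<rho> > 0" "\<sigma>\<^sup>2 + 2 * \<rho>\<^sup>2 * (1 - cos (pi / real ell)) = l2\<^sup>2"
    and pa: "even (a - (p + 1) div 2)"
  shows "{v. v \<noteq> 0 \<and> node ell \<mu> \<sigma> \<rho> p a + v \<in> zigzag_nodes ell \<mu> \<sigma> \<rho> \<and> norm v < 1.1} =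
      {N (p - s) a, N (p + s) (a + 1), N (p + s) (a - 1)}" (is "?V = _")
    and "N (p - s) a \<noteq> N (p + s) (a + 1)" "N (p - s) a \<noteq> N (p + s) (a - 1)"
      "N (p + s) (a + 1) \<noteq> N (p + s) (a - 1)"
    and "norm (N (p - s) a) = l1" "norm (N (p + s) (a + 1)) = l2" "norm (N (p + s) (a - 1)) = l2"
    and "N (p - s) a \<bullet> N (p + s) (a + 1) = - l1 * \<sigma>" "N (p - s) a \<bullet> N (p + s) (a - 1) = - l1 * \<sigma>"
      "N (p + s) (a + 1) \<bullet> N (p + s) (a - 1) = l2\<^sup>2 - 2 * \<rho>\<^sup>2 * (sin (pi / real ell))\<^sup>2"
proof -
  let ?x = "pi / real ell" and ?ax = "axial_pos \<mu> \<sigma>"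
  have \<sigma>: "0.2 < \<sigma>" "\<sigma> < 0.65" "\<sigma> < \<mu> / 2" using \<mu> l1 by auto
  have ell0: "ell > 0" using ell by simp
  have s2: "s * s = 1" "of_int s * of_int s = (1::real)" by (auto simp: s_def)
  have ax: "?ax 1 = \<sigma>" "?ax (-1) = - l1" "?ax 0 = 0" "?ax 2 = \<mu> / 2" "?ax (-2) = - (\<mu> / 2)"
    using \<mu>(2) by (simp_all add: axial_pos_def field_simps)
  have axd: "?ax (p + s * d) - ?ax p = of_int s * ?ax d" for d
    unfolding s_def by (rule axial_pos_diff)
  have ax1: "?ax (p + s) - ?ax p = of_int s * \<sigma>" "?ax (p - s) - ?ax p = - (of_int s * l1)"
    using axd[of 1] axd[of "-1"] ax by auto
  have normN: "(norm (N (p + s * d) b))\<^sup>2 = (?ax d)\<^sup>2 + 2 * \<rho>\<^sup>2 * (1 - cos (pi * of_int (b - a) / real ell))"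
    for d b unfolding N_def norm_node_diff axd by (simp add: power_mult_distrib s2 power2_eq_square[of "of_int s"])
  have inj: "q = q' \<and> (b - b') mod (2 * int ell) = 0" if "N q b = N q' b'" for q q' b b'
    using node_eqD[OF ell0 \<rho>(1), of \<sigma> \<mu> q b q' b'] that \<sigma> unfolding N_def by simp
  have cx: "cos ?x \<ge> 0.6"
  proof -
    have "cos (pi / 4) \<le> cos ?x"
      by (rule cos_monotone_0_pi_le) (use ell in \<open>auto simp: field_simps\<close>)
    moreover have "cos (pi / 4) \<ge> 0.6"
      unfolding cos_45 using real_le_rsqrt[of "1.2" 2] by (simp add: power2_eq_square)
    ultimately show ?thesis by linarith
  qed
  have H1: "2 * \<rho>\<^sup>2 * (1 - cos ?x) \<ge> 0.3875"
  proof -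
    have "\<sigma>\<^sup>2 \<le> 0.65\<^sup>2" using \<sigma> by (intro power_mono) auto
    moreover have "0.9\<^sup>2 \<le> l2\<^sup>2" using l2 by (intro power_mono) auto
    ultimately show ?thesis using \<rho>(2) by (simp add: power2_eq_square)
  qed
  have H2: "2 * \<rho>\<^sup>2 * (1 - cos (pi * of_int b / real ell)) > 121/100"
    if "2 \<le> b mod (2 * int ell)" "b mod (2 * int ell) \<le> 2 * int ell - 2" for b
  proof -
    have "cos (pi * of_int b / real ell) \<le> cos (2 * ?x)"
      using cos_le_of_mod[OF ell0, of 2 b] that by (simp add: mult.commute)
    then have "2 * \<rho>\<^sup>2 * (1 - cos (2 * ?x)) \<le> 2 * \<rho>\<^sup>2 * (1 - cos (pi * of_int b / real ell))"
      by (intro mult_left_mono) auto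
    moreover have e: "2 * \<rho>\<^sup>2 * (1 - cos (2 * ?x)) = (2 * \<rho>\<^sup>2 * (1 - cos ?x)) * (2 * (1 + cos ?x))"
      unfolding cos_double_cos by (simp add: power2_eq_square algebra_simps)
    moreover have "0.3875 * 3.2 \<le> (2 * \<rho>\<^sup>2 * (1 - cos ?x)) * (2 * (1 + cos ?x))"
      using H1 cx by (intro mult_mono) auto
    moreover have "(121/100::real) < 0.3875 * 3.2" by simp
    ultimately show ?thesis unfolding e by (meson less_le_trans)
  qed
  have nu: "norm (N (p - s) a) = l1"
  proof -
    have "(norm (N (p - s) a))\<^sup>2 = l1\<^sup>2" using normN[of "-1" a] ax by simp
    then show ?thesis by (rule power2_eq_imp_eq) (use l1 in auto)
  qed
  have nv: "norm (N (p + s) (a + 1)) = l2"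
  proof -
    have "(norm (N (p + s) (a + 1)))\<^sup>2 = l2\<^sup>2" using normN[of 1 "a + 1"] ax \<rho> by simp
    then show ?thesis by (rule power2_eq_imp_eq) (use l2 in auto)
  qed
  have nw: "norm (N (p + s) (a - 1)) = l2"
  proof -
    have "(norm (N (p + s) (a - 1)))\<^sup>2 = l2\<^sup>2" using normN[of 1 "a - 1"] ax \<rho> by simp
    then show ?thesis by (rule power2_eq_imp_eq) (use l2 in auto)
  qed
  show "?V = {N (p - s) a, N (p + s) (a + 1), N (p + s) (a - 1)}"
  proof (intro equalityI subsetI)
    fix v assume v: "v \<in> ?V"
    then obtain q b where qb: "node ell \<mu> \<sigma> \<rho> p a + v = node ell \<mu> \<sigma> \<rho> q b" "even (b - (q + 1) div 2)"
      unfolding zigzag_nodes_def by auto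
    \<comment> \<open>The offset between the rings, counted in the direction in which the gap \<open>\<sigma>\<close> comes first.\<close>
    define d where "d = s * (q - p)"
    have q: "q = p + s * d" unfolding d_def using s2 by (simp add: mult.assoc[symmetric])
    have vN: "v = N (p + s * d) b" using qb(1) q by (simp add: N_def algebra_simps)
    have "(norm v)\<^sup>2 < 1.1\<^sup>2" using v by (intro power_strict_mono) auto
    then have lt: "(?ax d)\<^sup>2 + 2 * \<rho>\<^sup>2 * (1 - cos (pi * of_int (b - a) / real ell)) < 121/100"
      unfolding vN normN by (simp add: power2_eq_square)
    have cn: "2 * \<rho>\<^sup>2 * (1 - cos (pi * of_int (b - a) / real ell)) \<ge> 0" by (intro mult_nonneg_nonneg) auto
    have "\<bar>?ax d\<bar> < 1.3"
    proof (rule ccontr)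
      assume "\<not> ?thesis"
      then have "1.3\<^sup>2 \<le> \<bar>?ax d\<bar>\<^sup>2" by (intro power_mono) auto
      then have "169/100 \<le> (?ax d)\<^sup>2" by (simp add: power2_eq_square)
      then show False using lt cn by linarith
    qed
    moreover have "?ax 2 \<le> ?ax d" if "d \<ge> 2"
      using axial_pos_strict_mono[of \<sigma> \<mu> 2 d] \<sigma> that by (cases "d = 2") auto
    moreover have "?ax d \<le> ?ax (-2)" if "d \<le> -2"
      using axial_pos_strict_mono[of \<sigma> \<mu> d "-2"] \<sigma> that by (cases "d = -2") auto
    moreover have "2.6 < \<mu>" using \<mu>(1) by simp
    ultimately have "\<not> d \<ge> 2" "\<not> d \<le> -2" using ax(4,5) by auto
    then have d: "d = -1 \<or> d = 0 \<or> d = 1" by linarith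
    let ?r = "(b - a) mod (2 * int ell)"
    have "\<not> (2 \<le> ?r \<and> ?r \<le> 2 * int ell - 2)"
      using H2[of "b - a"] lt zero_le_power2[of "?ax d"] by linarith
    moreover have "0 \<le> ?r" "?r < 2 * int ell" using ell by simp_all
    ultimately have r: "?r = 0 \<or> ?r = 1 \<or> ?r = 2 * int ell - 1" by linarith
    have par: "even ?r \<longleftrightarrow> even (b - a)" by (simp add: dvd_mod_iff)
    have bc: "N q b = N q c" if "?r = (c - a) mod (2 * int ell)" for c
    proof -
      have "b mod (2 * int ell) = c mod (2 * int ell)"
        using that by (metis diff_add_cancel mod_add_left_eq)
      then show ?thesis unfolding N_def using node_cong[OF ell0] by metis
    qed
    from d show "v \<in> {N (p - s) a, N (p + s) (a + 1), N (p + s) (a - 1)}"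
    proof (elim disjE)
      assume d: "d = -1"
      then have "(q + 1) div 2 = (p + 1) div 2" unfolding q s_def by (cases "even p"; simp; presburger)
      then have "even ?r" using par qb(2) pa by (metis (no_types) dvd_diff_right_iff diff_add_cancel even_add even_diff)
      then have "?r = 0" using r by auto
      then have "N q b = N q a" using bc[of a] by simp
      then show ?thesis using d vN q by simp
    next
      assume d: "d = 0"
      then have "even ?r" using par qb(2) pa q by (metis even_diff even_add add.right_neutral mult_zero_right)
      then have "?r = 0" using r by auto
      then have "N q b = N q a" using bc[of a] by simp
      then have "v = 0" using d vN q by (simp add: N_def)
      then show ?thesis using v by simp
    next
      assume d: "d = 1"
      then have "(q + 1) div 2 = (p + 1) div 2 + s" unfolding q s_def by (cases "even p"; simp; presburger)
      moreover have "odd s" by (simp add: s_def)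
      ultimately have "odd ?r" using par qb(2) pa by (metis even_diff even_add)
      then have "?r = 1 \<or> ?r = 2 * int ell - 1" using r by auto
      then have "N q b = N q (a + 1) \<or> N q b = N q (a - 1)"
        using bc[of "a + 1"] bc[of "a - 1"] ell by (auto simp: zmod_minus1)
      then show ?thesis using d vN q by auto
    qed
  next
    fix v assume v: "v \<in> {N (p - s) a, N (p + s) (a + 1), N (p + s) (a - 1)}"
    then have "norm v = l1 \<or> norm v = l2" using nu nv nw by auto
    then have "v \<noteq> 0 \<and> norm v < 1.1" using l1 l2 by auto
    moreover have "even (a - (p - s + 1) div 2)" "even (a + 1 - (p + s + 1) div 2)" "even (a - 1 - (p + s + 1) div 2)"
      using pa unfolding s_def by (cases "even p"; simp; presburger)+
    then have "node ell \<mu> \<sigma> \<rho> (p - s) a \<in> zigzag_nodes ell \<mu> \<sigma> \<rho>"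
      "node ell \<mu> \<sigma> \<rho> (p + s) (a + 1) \<in> zigzag_nodes ell \<mu> \<sigma> \<rho>"
      "node ell \<mu> \<sigma> \<rho> (p + s) (a - 1) \<in> zigzag_nodes ell \<mu> \<sigma> \<rho>"
      unfolding zigzag_nodes_def by blast+
    then have "node ell \<mu> \<sigma> \<rho> p a + v \<in> zigzag_nodes ell \<mu> \<sigma> \<rho>"
      using v by (auto simp: N_def)
    ultimately show "v \<in> ?V" by simp
  qed
  have "p - s \<noteq> p + s" by (simp add: s_def)
  then show "N (p - s) a \<noteq> N (p + s) (a + 1)" "N (p - s) a \<noteq> N (p + s) (a - 1)" using inj by blast+
  have "(a + 1 - (a - 1)) mod (2 * int ell) \<noteq> 0" using ell by simp
  then show "N (p + s) (a + 1) \<noteq> N (p + s) (a - 1)" using inj by blast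
  show "norm (N (p - s) a) = l1" "norm (N (p + s) (a + 1)) = l2" "norm (N (p + s) (a - 1)) = l2"
    by (fact nu nv nw)+
  show "N (p - s) a \<bullet> N (p + s) (a + 1) = - l1 * \<sigma>" "N (p - s) a \<bullet> N (p + s) (a - 1) = - l1 * \<sigma>"
    unfolding N_def inner_node_diff ax1 using s2(2) by (simp_all add: algebra_simps)
  have c2: "cos (pi * 2 / real ell) = 2 * (cos ?x)\<^sup>2 - 1" using cos_double_cos[of ?x] by (simp add: mult.commute)
  have "N (p + s) (a + 1) \<bullet> N (p + s) (a - 1) = \<sigma>\<^sup>2 + \<rho>\<^sup>2 * (2 * (cos ?x)\<^sup>2 - 2 * cos ?x)"
    unfolding N_def inner_node_diff ax1 using s2(2) c2
    by (simp add: algebra_simps power2_eq_square)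
  then show "N (p + s) (a + 1) \<bullet> N (p + s) (a - 1) = l2\<^sup>2 - 2 * \<rho>\<^sup>2 * (sin ?x)\<^sup>2"
    unfolding \<rho>(2)[symmetric] sin_squared_eq by (simp add: algebra_simps)
qed

lemma rho_of:
  assumes "ell > 0" "(sigma_of \<mu> lam1)\<^sup>2 < lam2\<^sup>2"
  shows "rho_of ell \<mu> lam1 lam2 > 0"
    and "(sigma_of \<mu> lam1)\<^sup>2 + 4 * (rho_of ell \<mu> lam1 lam2)\<^sup>2 * (sin (pi / (2 * real ell)))\<^sup>2 = lam2\<^sup>2"
    and "rho_of ell \<mu> lam1 lam2 = sqrt (lam2\<^sup>2 - (sigma_of \<mu> lam1)\<^sup>2) / (2 * sin (pi / (2 * real ell)))"
proof -
  let ?S = "sin (pi / (2 * real ell))" and ?\<sigma> = "sigma_of \<mu> lam1"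
  let ?r = "sqrt (lam2\<^sup>2 - ?\<sigma>\<^sup>2) / (2 * ?S)"
  have "pi / (2 * real ell) < pi" using assms(1) by (simp add: field_simps)
  then have S: "?S > 0" using assms(1) by (intro sin_gt_zero) auto
  have r: "?r > 0" using S assms(2) by simp
  have eq: "?\<sigma>\<^sup>2 + 4 * ?r\<^sup>2 * ?S\<^sup>2 = lam2\<^sup>2"
    using S assms(2) by (simp add: power_divide power_mult_distrib field_simps)
  have "rho_of ell \<mu> lam1 lam2 = ?r"
    unfolding rho_of_def
  proof (rule the_equality)
    show "?r > 0 \<and> ?\<sigma>\<^sup>2 + 4 * ?r\<^sup>2 * ?S\<^sup>2 = lam2\<^sup>2" using r eq by blast
    fix r' assume r': "r' > 0 \<and> ?\<sigma>\<^sup>2 + 4 * r'\<^sup>2 * ?S\<^sup>2 = lam2\<^sup>2"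
    then have "r'\<^sup>2 * ?S\<^sup>2 = ?r\<^sup>2 * ?S\<^sup>2" using eq by linarith
    then have "r'\<^sup>2 = ?r\<^sup>2" using S by simp
    then show "r' = ?r"
      by (rule power2_eq_imp_eq) (use r r' in \<open>simp_all only: less_imp_le\<close>)
  qed
  with r eq show "rho_of ell \<mu> lam1 lam2 > 0"
    "?\<sigma>\<^sup>2 + 4 * (rho_of ell \<mu> lam1 lam2)\<^sup>2 * ?S\<^sup>2 = lam2\<^sup>2" "rho_of ell \<mu> lam1 lam2 = ?r" by simp_all
qed

text \<open>
  The energy of a tube, for all bond lengths and periods under consideration. The three-body part
  depends only on the angle \<open>\<alpha>\<close>.
\<close>

lemma zigzag_energy_eq:
  fixes lam1 lam2 \<mu> :: real
  defines "\<alpha> \<equiv> arccos (- (sigma_of \<mu> lam1) / lam2)"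
  assumes ell: "ell \<ge> 4" and m: "m \<ge> 1"
    and l1: "lam1 \<in> {0.9<..<1.1}" and l2: "lam2 \<in> {0.9<..<1.1}" and \<mu>: "\<mu> \<in> {2.6<..<3.1}"
  shows "zigzag_energy v2 v3 ell m lam1 lam2 \<mu> =
    real (4 * m * ell) * (v2 lam1 / 2 + v2 lam2 + (2 * v3 \<alpha> + v3 (beta_ang \<alpha> (gamma_ang ell))))"
proof -
  let ?\<sigma> = "sigma_of \<mu> lam1" and ?\<rho> = "rho_of ell \<mu> lam1 lam2" and ?L = "real m * \<mu>" and ?x = "pi / real ell"
  let ?Z = "zigzag_nodes ell \<mu> ?\<sigma> ?\<rho>"
  let ?\<beta> = "beta_ang \<alpha> (gamma_ang ell)"
  let ?S = "sin \<alpha> * sin (gamma_ang ell / 2)"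
  have ell0: "ell > 0" using ell by simp
  have \<sigma>: "0.2 < ?\<sigma>" "?\<sigma> < 0.65" "?\<sigma> < \<mu> / 2" "\<mu> = 2 * ?\<sigma> + 2 * lam1" using \<mu> l1 by (auto simp: sigma_of_def)
  have \<sigma>l: "?\<sigma> < lam2" using \<sigma> l2 by simp
  then have "?\<sigma>\<^sup>2 < lam2\<^sup>2" using \<sigma> by (intro power_strict_mono) auto
  note r = rho_of[OF ell0 this]
  have "1 - cos ?x = 2 * (sin (pi / (2 * real ell)))\<^sup>2"
    using cos_double_sin[of "pi / (2 * real ell)"] by (simp add: field_simps)
  then have r2: "?\<sigma>\<^sup>2 + 2 * ?\<rho>\<^sup>2 * (1 - cos ?x) = lam2\<^sup>2" using r(2) by simp
  have Z: "zigzag ell lam1 lam2 \<mu> = ?Z"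
    unfolding zigzag_def by (rule zigzag_points_eq_nodes[OF ell0 \<sigma>(4)])
  have "1 * 2.6 \<le> ?L" using m \<mu> by (intro mult_mono) auto
  then have L: "?L > 2.2" by simp
  have c1: "-1 \<le> - ?\<sigma> / lam2" "- ?\<sigma> / lam2 \<le> 1" using \<sigma> \<sigma>l l2 by (auto simp: field_simps)
  have cosa: "cos \<alpha> = - ?\<sigma> / lam2" unfolding \<alpha>_def using c1 by simp
  have sina0: "sin \<alpha> \<ge> 0" unfolding \<alpha>_def using c1 by (intro sin_ge_zero arccos_lbound arccos_ubound)
  have g: "sin (gamma_ang ell / 2) = cos (pi / (2 * real ell))"
    by (simp add: sin_cos_eq gamma_ang_def field_simps)
  have cg: "cos (pi / (2 * real ell)) \<ge> 0"
  proof (rule cos_ge_zero)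
    have "0 \<le> pi / (2 * real ell)" by simp
    then show "- (pi / 2) \<le> pi / (2 * real ell)" using pi_gt_zero by linarith
  qed (use ell in \<open>auto simp: field_simps\<close>)
  have sg: "0 \<le> ?S" "?S \<le> 1"
    unfolding g using sina0 cg by (auto intro: mult_le_one)
  have asb: "0 \<le> arcsin (?S)" "arcsin (?S) \<le> pi / 2"
    using sg arcsin_le_arcsin[of 0 "?S"]
      arcsin_ubound[of "?S"] by auto
  have b: "0 \<le> ?\<beta>" "?\<beta> \<le> pi" using asb by (auto simp: beta_ang_def)
  have "cos ?\<beta> = 1 - 2 * (?S)\<^sup>2"
    unfolding beta_ang_def cos_double_sin using sg by simp
  also have "\<dots> = 1 - (1 - (cos \<alpha>)\<^sup>2) * (1 + cos ?x)"
  proof -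
    have "1 + cos ?x = 2 * (cos (pi / (2 * real ell)))\<^sup>2"
      using cos_double_cos[of "pi / (2 * real ell)"] by (simp add: field_simps)
    then show ?thesis unfolding g power_mult_distrib sin_squared_eq by simp
  qed
  also have "\<dots> = (lam2\<^sup>2 - 2 * ?\<rho>\<^sup>2 * (sin ?x)\<^sup>2) / (lam2 * lam2)"
  proof -
    have "lam2\<^sup>2 * (1 - (cos \<alpha>)\<^sup>2) = 2 * ?\<rho>\<^sup>2 * (1 - cos ?x)"
    proof -
      have "lam2\<^sup>2 * (1 - (cos \<alpha>)\<^sup>2) = lam2\<^sup>2 - ?\<sigma>\<^sup>2"
        unfolding cosa using l2 by (simp add: power_divide right_diff_distrib)
      then show ?thesis using r2 by linarith
    qed
    then have "lam2\<^sup>2 * ((1 - (cos \<alpha>)\<^sup>2) * (1 + cos ?x)) = 2 * ?\<rho>\<^sup>2 * ((1 - cos ?x) * (1 + cos ?x))"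
      by (simp only: mult.assoc[symmetric])
    also have "(1 - cos ?x) * (1 + cos ?x) = (sin ?x)\<^sup>2"
      unfolding sin_squared_eq by (simp add: algebra_simps power2_eq_square)
    finally show ?thesis using l2 by (simp add: field_simps power2_eq_square)
  qed
  finally have cosb: "arccos ((lam2\<^sup>2 - 2 * ?\<rho>\<^sup>2 * (sin ?x)\<^sup>2) / (lam2 * lam2)) = ?\<beta>"
    using arccos_cos[OF b] by simp
  have aa: "arccos (- lam1 * ?\<sigma> / (lam1 * lam2)) = \<alpha>" unfolding \<alpha>_def using l1 by simp
  have "energy v2 v3 (cell ?Z ?L) ?L =
    real (card (cell ?Z ?L)) * (v2 lam1 / 2 + v2 lam2 + 2 * v3 \<alpha> + v3 ?\<beta>)"
  proof (rule energy_three_coordinated[OF L])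
    show "finite (cell ?Z ?L)" by (rule card_cell_zigzag_nodes(1)) (use ell0 r \<sigma> in auto)
    fix y assume "y \<in> cell ?Z ?L"
    then obtain p a where y: "y = node ell \<mu> ?\<sigma> ?\<rho> p a" and pa: "even (a - (p + 1) div 2)"
      unfolding cell_def zigzag_nodes_def by blast
    note nb = zigzag_node_neighbours[OF ell l1 l2 \<mu> \<sigma>(4) r(1) r2 pa]
    let ?s = "if even p then 1 else -1 :: int"
    let ?N = "\<lambda>q b. node ell \<mu> ?\<sigma> ?\<rho> q b - node ell \<mu> ?\<sigma> ?\<rho> p a"
    show "\<exists>u v w. u \<noteq> v \<and> u \<noteq> w \<and> v \<noteq> w \<and>
          {v. v \<noteq> 0 \<and> y + v \<in> ?Z \<and> norm v < 1.1} = {u, v, w} \<and>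
          norm u = lam1 \<and> norm v = lam2 \<and> norm w = lam2 \<and>
          arccos (u \<bullet> v / (lam1 * lam2)) = \<alpha> \<and> arccos (u \<bullet> w / (lam1 * lam2)) = \<alpha> \<and>
          arccos (v \<bullet> w / (lam2 * lam2)) = ?\<beta>"
      unfolding y
      by (rule exI[of _ "?N (p - ?s) a"], rule exI[of _ "?N (p + ?s) (a + 1)"], rule exI[of _ "?N (p + ?s) (a - 1)"])
        (simp only: nb aa cosb simp_thms power2_eq_square[of lam2, symmetric] cosb[unfolded power2_eq_square[of lam2, symmetric]])
  qed (rule zigzag_nodes_periodic)
  moreover have "card (cell ?Z ?L) = 4 * m * ell"
    by (rule card_cell_zigzag_nodes(2)) (use ell0 r \<sigma> in auto)
  ultimately show ?thesis unfolding zigzag_energy_def Z by (simp add: add.assoc)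
qed

section \<open>The angle energy and its derivatives\<close>

text \<open>
  The three-body energy per point, as a function of the angle \<open>\<alpha>\<close>; in a tube, \<open>\<gamma>\<close> is \<open>gamma_ang ell\<close>. Its
  first two derivatives in \<open>\<alpha>\<close> are given in closed form, as they are needed uniformly for \<open>\<gamma>\<close> near \<open>pi\<close>.
\<close>

definition angle_energy :: "(real \<Rightarrow> real) \<Rightarrow> real \<Rightarrow> real \<Rightarrow> real" where
  "angle_energy v3 \<gamma> \<alpha> = 2 * v3 \<alpha> + v3 (beta_ang \<alpha> \<gamma>)"

text \<open>
  The cosine of half of the angle \<open>beta_ang \<alpha> \<gamma>\<close>.
\<close>

definition beta_root :: "real \<Rightarrow> real \<Rightarrow> real" where
  "beta_root \<alpha> \<gamma> = sqrt (1 - (sin \<alpha> * sin (\<gamma> / 2))\<^sup>2)"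

text \<open>
  The first and second derivative of \<open>beta_ang \<alpha> \<gamma>\<close> in \<open>\<alpha>\<close>.
\<close>

definition beta_deriv :: "real \<Rightarrow> real \<Rightarrow> real" where
  "beta_deriv \<alpha> \<gamma> = 2 * cos \<alpha> * sin (\<gamma> / 2) / beta_root \<alpha> \<gamma>"

definition beta_deriv2 :: "real \<Rightarrow> real \<Rightarrow> real" where
  "beta_deriv2 \<alpha> \<gamma> =
     ((- 2 * sin \<alpha> * sin (\<gamma> / 2)) * beta_root \<alpha> \<gamma>
       - (2 * cos \<alpha> * sin (\<gamma> / 2)) * (- (sin \<alpha> * cos \<alpha> * (sin (\<gamma> / 2))\<^sup>2) / beta_root \<alpha> \<gamma>))
     / (beta_root \<alpha> \<gamma> * beta_root \<alpha> \<gamma>)"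

definition angle_energy_deriv :: "(real \<Rightarrow> real) \<Rightarrow> real \<Rightarrow> real \<Rightarrow> real" where
  "angle_energy_deriv v3 \<gamma> \<alpha> = 2 * deriv v3 \<alpha> + deriv v3 (beta_ang \<alpha> \<gamma>) * beta_deriv \<alpha> \<gamma>"

definition angle_energy_deriv2 :: "(real \<Rightarrow> real) \<Rightarrow> real \<Rightarrow> real \<Rightarrow> real" where
  "angle_energy_deriv2 v3 \<gamma> \<alpha> =
     2 * deriv (deriv v3) \<alpha> + deriv (deriv v3) (beta_ang \<alpha> \<gamma>) * (beta_deriv \<alpha> \<gamma>)\<^sup>2
       + deriv v3 (beta_ang \<alpha> \<gamma>) * beta_deriv2 \<alpha> \<gamma>"

lemma sin_half_bounds:
  fixes \<gamma> :: real
  assumes "\<gamma> \<in> {0<..<pi}"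
  shows "0 < sin (\<gamma> / 2)" "sin (\<gamma> / 2) < 1"
proof -
  show "0 < sin (\<gamma> / 2)" using assms by (intro sin_gt_zero) auto
  have "sin (\<gamma> / 2) < sin (pi / 2)" using assms by (intro sin_monotone_2pi) auto
  then show "sin (\<gamma> / 2) < 1" by simp
qed

lemma sin_mult_sin_half_bounds:
  fixes \<alpha> \<gamma> :: real
  assumes "\<gamma> \<in> {0<..<pi}" "\<alpha> \<in> {0<..<pi}"
  shows "0 < sin \<alpha> * sin (\<gamma> / 2)" "sin \<alpha> * sin (\<gamma> / 2) < 1"
proof -
  have a: "0 < sin \<alpha>" using assms(2) by (intro sin_gt_zero) auto
  show "0 < sin \<alpha> * sin (\<gamma> / 2)" using a sin_half_bounds[OF assms(1)] by simp
  have "sin \<alpha> * sin (\<gamma> / 2) \<le> 1 * sin (\<gamma> / 2)"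
    using sin_half_bounds[OF assms(1)] by (intro mult_right_mono) auto
  then show "sin \<alpha> * sin (\<gamma> / 2) < 1" using sin_half_bounds(2)[OF assms(1)] by linarith
qed

lemma beta_ang_bounds:
  assumes "\<gamma> \<in> {0<..<pi}" "\<alpha> \<in> {0<..<pi}"
  shows "beta_ang \<alpha> \<gamma> \<in> {0<..<pi}"
proof -
  note s = sin_mult_sin_half_bounds[OF assms]
  have "arcsin 0 < arcsin (sin \<alpha> * sin (\<gamma> / 2))" using s by (intro arcsin_less_arcsin) auto
  moreover have "arcsin (sin \<alpha> * sin (\<gamma> / 2)) < pi / 2" using s arcsin_lt_bounded by auto
  ultimately show ?thesis by (simp add: beta_ang_def)
qed

lemma beta_root_pos:
  assumes "\<gamma> \<in> {0<..<pi}" "\<alpha> \<in> {0<..<pi}"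
  shows "beta_root \<alpha> \<gamma> > 0"
  using sin_mult_sin_half_bounds[OF assms] by (simp add: beta_root_def abs_square_less_1)

lemma beta_ang_has_deriv:
  assumes "\<gamma> \<in> {0<..<pi}" "\<alpha> \<in> {0<..<pi}"
  shows "((\<lambda>\<alpha>. beta_ang \<alpha> \<gamma>) has_real_derivative beta_deriv \<alpha> \<gamma>) (at \<alpha>)"
proof -
  have a: "((\<lambda>\<alpha>. sin \<alpha> * sin (\<gamma> / 2)) has_real_derivative cos \<alpha> * sin (\<gamma> / 2)) (at \<alpha>)"
    by (auto intro!: derivative_eq_intros)
  have b: "(arcsin has_real_derivative inverse (beta_root \<alpha> \<gamma>)) (at (sin \<alpha> * sin (\<gamma> / 2)))"
    unfolding beta_root_def by (rule DERIV_arcsin) (use sin_mult_sin_half_bounds[OF assms] in linarith)+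
  have "((\<lambda>\<alpha>. arcsin (sin \<alpha> * sin (\<gamma> / 2))) has_real_derivative
      inverse (beta_root \<alpha> \<gamma>) * (cos \<alpha> * sin (\<gamma> / 2))) (at \<alpha>)"
    by (rule DERIV_chain2[OF b a])
  from DERIV_cmult[OF this, of 2] show ?thesis
    unfolding beta_ang_def beta_deriv_def divide_inverse by (simp only: mult_ac)
qed

lemma beta_deriv_has_deriv:
  assumes "\<gamma> \<in> {0<..<pi}" "\<alpha> \<in> {0<..<pi}"
  shows "((\<lambda>\<alpha>. beta_deriv \<alpha> \<gamma>) has_real_derivative beta_deriv2 \<alpha> \<gamma>) (at \<alpha>)"
proof -
  have pos: "1 - (sin \<alpha> * sin (\<gamma> / 2))\<^sup>2 > 0"
    using beta_root_pos[OF assms] by (simp add: beta_root_def)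
  have "((\<lambda>\<alpha>. beta_root \<alpha> \<gamma>) has_real_derivative
      - (sin \<alpha> * cos \<alpha> * (sin (\<gamma> / 2))\<^sup>2) / beta_root \<alpha> \<gamma>) (at \<alpha>)"
    unfolding beta_root_def using pos
    by (auto intro!: derivative_eq_intros simp: field_simps power2_eq_square)
  moreover have "((\<lambda>\<alpha>. 2 * cos \<alpha> * sin (\<gamma> / 2)) has_real_derivative - 2 * sin \<alpha> * sin (\<gamma> / 2)) (at \<alpha>)"
    by (auto intro!: derivative_eq_intros)
  ultimately show ?thesis unfolding beta_deriv_def beta_deriv2_def
    using beta_root_pos[OF assms] by (intro DERIV_divide) auto
qed

context
  fixes v3 :: "real \<Rightarrow> real"
  assumes v3: "three_body_potential v3"
begin

lemma v3_smooth: "smooth_on {0<..<2 * pi} v3"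
proof -
  have "smooth_on {0..2 * pi} v3" using v3 unfolding three_body_potential_def by blast
  then show ?thesis by (rule smooth_on_subset) auto
qed

lemma v3_deriv:
  assumes "x \<in> {0<..<2 * pi}"
  shows "(v3 has_real_derivative deriv v3 x) (at x)"
    and "(deriv v3 has_real_derivative deriv (deriv v3) x) (at x)"
    and "isCont (deriv (deriv v3)) x"
  using assms smooth_on_has_deriv[OF v3_smooth] smooth_on_has_deriv[OF smooth_on_deriv[OF v3_smooth]]
    smooth_on_isCont[OF smooth_on_deriv[OF smooth_on_deriv[OF v3_smooth]]] by auto

lemma v3_nonneg: "x \<in> {0..2 * pi} \<Longrightarrow> v3 x \<ge> 0"
  using v3 unfolding three_body_potential_def by (metis less_eq_real_def)

lemma v3_pos:
  assumes "x \<in> {0..pi}" "x \<noteq> 2 * pi / 3"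
  shows "v3 x > 0"
proof -
  have "x \<in> {0..2 * pi}" using assms(1) by auto
  moreover have "x \<noteq> 4 * pi / 3" using assms(1) pi_gt_zero unfolding atLeastAtMost_iff by linarith
  ultimately show ?thesis using v3 assms(2) unfolding three_body_potential_def by blast
qed

lemma v3_deriv_min: "deriv v3 (2 * pi / 3) = 0"
proof (rule DERIV_local_min[of v3 _ "2 * pi / 3" "pi / 3"])
  show "(v3 has_real_derivative deriv v3 (2 * pi / 3)) (at (2 * pi / 3))" by (rule v3_deriv) auto
  show "\<forall>y. \<bar>2 * pi / 3 - y\<bar> < pi / 3 \<longrightarrow> v3 (2 * pi / 3) \<le> v3 y"
  proof (intro allI impI)
    fix y assume "\<bar>2 * pi / 3 - y\<bar> < pi / 3"
    then have "y \<in> {0..2 * pi}" unfolding atLeastAtMost_iff using pi_gt_zero by linarith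
    then have "v3 y \<ge> 0" by (rule v3_nonneg)
    moreover have "v3 (2 * pi / 3) = 0" using v3 unfolding three_body_potential_def by blast
    ultimately show "v3 (2 * pi / 3) \<le> v3 y" by simp
  qed
qed simp

lemma angle_energy_smooth:
  assumes "\<gamma> \<in> {0<..<pi}"
  shows "smooth_on {0<..<pi} (angle_energy v3 \<gamma>)"
proof -
  have "smooth_on {0<..<pi} (\<lambda>\<alpha>. arcsin (sin \<alpha> * sin (\<gamma> / 2)))"
  proof (intro smooth_on_compose[OF _ smooth_on_arcsin] smooth_on_mult smooth_on_sin smooth_on_const)
    show "sin \<alpha> * sin (\<gamma> / 2) \<in> {-1<..<1}" if "\<alpha> \<in> {0<..<pi}" for \<alpha>
      using sin_mult_sin_half_bounds[OF assms that] by simp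
  qed auto
  then have "smooth_on {0<..<pi} (\<lambda>\<alpha>. beta_ang \<alpha> \<gamma>)"
    unfolding beta_ang_def by (intro smooth_on_mult smooth_on_const) auto
  then have "smooth_on {0<..<pi} (\<lambda>\<alpha>. v3 (beta_ang \<alpha> \<gamma>))"
  proof (intro smooth_on_compose[OF _ v3_smooth])
    show "beta_ang \<alpha> \<gamma> \<in> {0<..<2 * pi}" if "\<alpha> \<in> {0<..<pi}" for \<alpha>
      using beta_ang_bounds[OF assms that] pi_gt_zero by simp
  qed auto
  moreover have "smooth_on {0<..<pi} v3" by (rule smooth_on_subset[OF v3_smooth]) auto
  ultimately show ?thesis unfolding angle_energy_def
    by (intro smooth_on_add smooth_on_mult smooth_on_const) auto
qed

lemma angle_energy_has_deriv:
  assumes "\<gamma> \<in> {0<..<pi}" "\<alpha> \<in> {0<..<pi}"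
  shows "(angle_energy v3 \<gamma> has_real_derivative angle_energy_deriv v3 \<gamma> \<alpha>) (at \<alpha>)"
    and "(angle_energy_deriv v3 \<gamma> has_real_derivative angle_energy_deriv2 v3 \<gamma> \<alpha>) (at \<alpha>)"
proof -
  have b: "beta_ang \<alpha> \<gamma> \<in> {0<..<2 * pi}" "\<alpha> \<in> {0<..<2 * pi}"
    using beta_ang_bounds[OF assms] assms(2) by auto
  note d = v3_deriv[OF b(1)] v3_deriv[OF b(2)]
  note \<beta> = beta_ang_has_deriv[OF assms] beta_deriv_has_deriv[OF assms]
  show "(angle_energy v3 \<gamma> has_real_derivative angle_energy_deriv v3 \<gamma> \<alpha>) (at \<alpha>)"
    unfolding angle_energy_def[abs_def] angle_energy_deriv_def
    by (intro DERIV_add DERIV_cmult d DERIV_chain2[OF d(1) \<beta>(1)])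
  have "((\<lambda>\<alpha>. deriv v3 (beta_ang \<alpha> \<gamma>) * beta_deriv \<alpha> \<gamma>) has_real_derivative
      (deriv (deriv v3) (beta_ang \<alpha> \<gamma>) * beta_deriv \<alpha> \<gamma>) * beta_deriv \<alpha> \<gamma> +
      beta_deriv2 \<alpha> \<gamma> * deriv v3 (beta_ang \<alpha> \<gamma>)) (at \<alpha>)"
    by (intro DERIV_mult DERIV_chain2[OF d(2) \<beta>(1)] \<beta>(2))
  from DERIV_add[OF DERIV_cmult[OF d(5), of 2] this]
  show "(angle_energy_deriv v3 \<gamma> has_real_derivative angle_energy_deriv2 v3 \<gamma> \<alpha>) (at \<alpha>)"
    unfolding angle_energy_deriv_def[abs_def] angle_energy_deriv2_def
    by (simp add: algebra_simps power2_eq_square)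
qed

text \<open>
  At \<open>\<gamma> = pi\<close> and \<open>\<alpha> = 2 * pi / 3\<close> also \<open>beta_ang \<alpha> \<gamma> = 2 * pi / 3\<close>, its derivative is \<open>-2\<close> and the first
  derivative of \<open>v3\<close> vanishes: the limit is \<open>(2 + 4) * v3'' (2 * pi / 3)\<close>. It is a limit in both
  variables, which gives bounds that are uniform in \<open>ell\<close>.
\<close>

lemma tendsto_angle_energy_deriv2:
  "((\<lambda>z. angle_energy_deriv2 v3 (fst z) (snd z)) \<longlongrightarrow> 6 * deriv (deriv v3) (2 * pi / 3))
     (nhds pi \<times>\<^sub>F nhds (2 * pi / 3))"
proof -
  let ?F = "nhds pi \<times>\<^sub>F nhds (2 * pi / 3)"
  have g: "((\<lambda>z. sin (fst z / 2)) \<longlongrightarrow> 1) ?F"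
    using tendsto_sin[OF tendsto_divide[OF filterlim_fst[of "nhds pi" "nhds (2 * pi / 3)"] tendsto_const[of 2]]]
    by simp
  have a: "(snd \<longlongrightarrow> 2 * pi / 3) ?F" by (rule filterlim_snd)
  have sc: "((\<lambda>z. sin (snd z)) \<longlongrightarrow> sqrt 3 / 2) ?F" "((\<lambda>z. cos (snd z)) \<longlongrightarrow> - 1 / 2) ?F"
    using tendsto_sin[OF a] tendsto_cos[OF a] by (simp_all add: sin_120 cos_120)
  have root: "((\<lambda>z. beta_root (snd z) (fst z)) \<longlongrightarrow> sqrt (1 - (sqrt 3 / 2 * 1)\<^sup>2)) ?F"
    unfolding beta_root_def by (intro tendsto_intros sc g)
  have "sqrt (1 - (sqrt 3 / 2 * 1)\<^sup>2) = sqrt ((1 / 2)\<^sup>2)" by (simp add: power_divide)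
  then have r: "sqrt (1 - (sqrt 3 / 2 * 1)\<^sup>2) = (1 / 2 :: real)" by (simp only: real_sqrt_abs)
  note root = root[unfolded r]
  have b1: "((\<lambda>z. beta_deriv (snd z) (fst z)) \<longlongrightarrow> 2 * (- 1 / 2) * 1 / (1 / 2)) ?F"
    unfolding beta_deriv_def by (intro tendsto_intros sc g root) auto
  have b2: "((\<lambda>z. beta_deriv2 (snd z) (fst z)) \<longlongrightarrow>
      ((- 2 * (sqrt 3 / 2) * 1) * (1 / 2)
       - (2 * (- 1 / 2) * 1) * (- (sqrt 3 / 2 * (- 1 / 2) * 1\<^sup>2) / (1 / 2))) / (1 / 2 * (1 / 2))) ?F"
    unfolding beta_deriv2_def by (intro tendsto_intros sc g root) auto
  have "((\<lambda>z. beta_ang (snd z) (fst z)) \<longlongrightarrow> 2 * arcsin (sqrt 3 / 2 * 1)) ?F"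
    unfolding beta_ang_def
  proof (intro tendsto_intros isCont_tendsto_compose[OF isCont_arcsin] sc g)
    have "sqrt 3 < sqrt 4" by (rule real_sqrt_less_mono) simp
    then show "sqrt 3 / 2 * 1 < (1::real)" by simp
    have "0 \<le> sqrt (3::real)" by simp
    then show "-1 < sqrt 3 / 2 * (1::real)" by linarith
  qed
  moreover have "arcsin (sqrt 3 / 2) = pi / 3" using arcsin_sin[of "pi / 3"] by (simp add: sin_60)
  ultimately have b: "((\<lambda>z. beta_ang (snd z) (fst z)) \<longlongrightarrow> 2 * pi / 3) ?F" by simp
  have m: "2 * pi / 3 \<in> {0<..<2 * pi}" using pi_gt_zero by auto
  have "((\<lambda>z. angle_energy_deriv2 v3 (fst z) (snd z)) \<longlongrightarrow>
      2 * deriv (deriv v3) (2 * pi / 3) + deriv (deriv v3) (2 * pi / 3) * (2 * (- 1 / 2) * 1 / (1 / 2))\<^sup>2 +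
      deriv v3 (2 * pi / 3) * (((- 2 * (sqrt 3 / 2) * 1) * (1 / 2)
       - (2 * (- 1 / 2) * 1) * (- (sqrt 3 / 2 * (- 1 / 2) * 1\<^sup>2) / (1 / 2))) / (1 / 2 * (1 / 2)))) ?F"
    unfolding angle_energy_deriv2_def
    by (intro tendsto_add tendsto_mult tendsto_power tendsto_const b1 b2
        isCont_tendsto_compose[OF v3_deriv(3)[OF m]] a b
        isCont_tendsto_compose[OF DERIV_isCont[OF v3_deriv(2)[OF m]]])
  then show ?thesis by (simp add: v3_deriv_min)
qed

end

lemma beta_ang_120:
  assumes "\<gamma> \<in> {0<..<pi}"
  shows "beta_ang (2 * pi / 3) \<gamma> < 2 * pi / 3"
proof -
  have p: "2 * pi / 3 \<in> {0<..<pi}" by auto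
  note s = sin_mult_sin_half_bounds[OF assms p]
  have "sin (2 * pi / 3) * sin (\<gamma> / 2) < sin (2 * pi / 3) * 1"
    using sin_half_bounds[OF assms] by (intro mult_strict_left_mono) (auto simp: sin_120)
  then have "arcsin (sin (2 * pi / 3) * sin (\<gamma> / 2)) < arcsin (sin (pi / 3))"
    using s sin_le_one[of "pi / 3"] by (intro arcsin_less_arcsin) (auto simp: sin_120 sin_60)
  also have "\<dots> = pi / 3" using pi_gt_zero by (intro arcsin_sin) linarith+
  finally show ?thesis by (simp add: beta_ang_def)
qed

lemma beta_deriv_neg:
  assumes "\<gamma> \<in> {0<..<pi}" "\<alpha> \<in> {pi/2<..<pi}"
  shows "beta_deriv \<alpha> \<gamma> < 0" "2 + beta_deriv \<alpha> \<gamma> > 0"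
proof -
  have a: "\<alpha> \<in> {0<..<pi}" using assms(2) by auto
  note r = beta_root_pos[OF assms(1) a] and s = sin_half_bounds[OF assms(1)]
  have c: "cos \<alpha> < 0" using assms(2) cos_monotone_0_pi[of "pi/2" \<alpha>] by auto
  then have "cos \<alpha> * sin (\<gamma> / 2) < 0" using s by (simp add: mult_neg_pos)
  then show "beta_deriv \<alpha> \<gamma> < 0" unfolding beta_deriv_def using r by (simp add: divide_neg_pos)
  have "(- cos \<alpha> * sin (\<gamma> / 2))\<^sup>2 = (1 - (sin \<alpha>)\<^sup>2) * (sin (\<gamma> / 2))\<^sup>2"
    by (simp add: power_mult_distrib cos_squared_eq)
  also have "\<dots> = (sin (\<gamma> / 2))\<^sup>2 - (sin \<alpha> * sin (\<gamma> / 2))\<^sup>2" by (simp add: algebra_simps power_mult_distrib)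
  also have "\<dots> < 1 - (sin \<alpha> * sin (\<gamma> / 2))\<^sup>2" using s by (simp add: abs_square_less_1)
  finally have "- cos \<alpha> * sin (\<gamma> / 2) < beta_root \<alpha> \<gamma>" unfolding beta_root_def by (rule real_less_rsqrt)
  then show "2 + beta_deriv \<alpha> \<gamma> > 0" unfolding beta_deriv_def using r by (simp add: field_simps)
qed

lemma gamma_ang_bounds: "ell \<ge> 2 \<Longrightarrow> gamma_ang ell \<in> {0<..<pi}"
  by (simp add: gamma_ang_def field_simps)

lemma gamma_ang_tendsto: "gamma_ang \<longlonglongrightarrow> pi"
proof -
  have "(\<lambda>ell. pi * (1 - 1 / real ell)) \<longlonglongrightarrow> pi * (1 - 0)"
    by (intro tendsto_intros lim_1_over_n)
  then show ?thesis by (simp add: gamma_ang_def[abs_def])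
qed

text \<open>
  By the double angle formula, \<open>beta_ang \<alpha> \<gamma> = \<alpha>\<close> is equivalent to \<open>2 * cos (\<alpha> / 2) * sin (\<gamma> / 2) = 1\<close>, which is
  solved explicitly.
\<close>

lemma alpha_ch:
  assumes "ell \<ge> 4"
  shows "beta_ang (alpha_ch ell) (gamma_ang ell) = alpha_ch ell"
    and "alpha_ch ell = arccos (1 / (2 * (sin (gamma_ang ell / 2))\<^sup>2) - 1)"
    and "pi / 2 < alpha_ch ell" "alpha_ch ell < alpha_ru"
proof -
  let ?s = "sin (gamma_ang ell / 2)"
  have g: "gamma_ang ell \<in> {0<..<pi}" using assms gamma_ang_bounds by simp
  note s = sin_half_bounds[OF g]
  have "sin (3 * pi / 8) \<le> ?s"
    using assms by (intro sin_monotone_2pi_le) (auto simp: gamma_ang_def field_simps)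
  moreover have "sin (3 * pi / 8) > 0" by (intro sin_gt_zero) auto
  ultimately have "(sin (3 * pi / 8))\<^sup>2 \<le> ?s\<^sup>2" by (intro power_mono) auto
  moreover have "(sin (3 * pi / 8))\<^sup>2 = (1 + cos (pi / 4)) / 2"
  proof -
    have "cos (2 * (3 * pi / 8)) = - cos (pi / 4)" using cos_pi_minus[of "pi / 4"] by (simp add: field_simps)
    then show ?thesis using cos_double_sin[of "3 * pi / 8"] by simp
  qed
  moreover have "cos (pi / 4) > 0.68"
    unfolding cos_45 using real_less_rsqrt[of "1.36" 2] by (simp add: power2_eq_square)
  ultimately have s2: "?s\<^sup>2 > 0.84" by simp
  have s2': "?s\<^sup>2 < 1" using s by (simp add: abs_square_less_1)
  let ?c = "1 / (2 * ?s\<^sup>2) - 1"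
  have "1 / 2 < 1 / (2 * ?s\<^sup>2)" using s2 s2' by (intro divide_strict_left_mono) auto
  moreover have "1 / (2 * ?s\<^sup>2) < 1 / (2 * 0.84)" using s2 by (intro divide_strict_left_mono) auto
  ultimately have c: "- 1 / 2 < ?c" "?c < - 0.4" by simp_all
  let ?a = "arccos ?c"
  have eq: "beta_ang \<alpha> (gamma_ang ell) = \<alpha> \<longleftrightarrow> cos \<alpha> = ?c" if "\<alpha> \<in> {0<..<pi}" for \<alpha>
  proof -
    have ch: "cos (\<alpha> / 2) > 0" using that by (intro cos_gt_zero_pi) auto
    have sh: "sin (\<alpha> / 2) > 0" using that by (intro sin_gt_zero) auto
    note b = sin_mult_sin_half_bounds[OF g that]
    have "beta_ang \<alpha> (gamma_ang ell) = \<alpha> \<longleftrightarrow> arcsin (sin \<alpha> * ?s) = \<alpha> / 2"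
      by (auto simp: beta_ang_def)
    also have "\<dots> \<longleftrightarrow> sin \<alpha> * ?s = sin (\<alpha> / 2)"
    proof
      assume "arcsin (sin \<alpha> * ?s) = \<alpha> / 2"
      then have "sin (\<alpha> / 2) = sin (arcsin (sin \<alpha> * ?s))" by (simp only:)
      then show "sin \<alpha> * ?s = sin (\<alpha> / 2)" using b by simp
    next
      assume "sin \<alpha> * ?s = sin (\<alpha> / 2)"
      then show "arcsin (sin \<alpha> * ?s) = \<alpha> / 2" using that arcsin_sin[of "\<alpha> / 2"] by simp
    qed
    also have "\<dots> \<longleftrightarrow> 2 * (cos (\<alpha> / 2) * ?s) = 1"
      using sin_double[of "\<alpha> / 2"] sh by auto
    also have "\<dots> \<longleftrightarrow> (2 * (cos (\<alpha> / 2) * ?s))\<^sup>2 = 1\<^sup>2"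
      using ch s by (subst power2_eq_iff_nonneg) auto
    also have "\<dots> \<longleftrightarrow> 4 * (cos (\<alpha> / 2))\<^sup>2 * ?s\<^sup>2 = 1" by (simp add: power_mult_distrib mult.assoc)
    also have "4 * (cos (\<alpha> / 2))\<^sup>2 = 2 * (cos \<alpha> + 1)" using cos_double_cos[of "\<alpha> / 2"] by simp
    also have "2 * (cos \<alpha> + 1) * ?s\<^sup>2 = 1 \<longleftrightarrow> cos \<alpha> = ?c"
    proof -
      have "2 * (c + 1) * q = 1 \<longleftrightarrow> c = 1 / (2 * q) - 1" if "q \<noteq> 0" for c q :: real
        using that by (auto simp: field_simps)
      moreover have "?s\<^sup>2 \<noteq> 0" using s by simp
      ultimately show ?thesis by blast
    qed
    finally show ?thesis .
  qed
  have ac: "arccos x \<in> {0<..<pi}" if "-1 < x" "x < 1" for x using arccos_lt_bounded that by auto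
  have ca: "cos ?a = ?c" using c by (intro cos_arccos) auto
  have a: "?a \<in> {0<..<pi}" by (rule ac) (use c in linarith)+
  have "alpha_ch ell = ?a"
    unfolding alpha_ch_def
  proof (rule the_equality)
    show "?a \<in> {arccos (-0.4)<..<arccos (-0.6)} \<and> beta_ang ?a (gamma_ang ell) = ?a"
      using eq[OF a] ca c by (auto intro!: arccos_less_arccos)
  next
    fix \<alpha> assume a: "\<alpha> \<in> {arccos (-0.4)<..<arccos (-0.6)} \<and> beta_ang \<alpha> (gamma_ang ell) = \<alpha>"
    then have p: "\<alpha> \<in> {0<..<pi}" using ac[of "-0.4"] ac[of "-0.6"] by auto
    then have "cos \<alpha> = ?c" using a eq by blast
    then show "\<alpha> = ?a" using p arccos_cos[of \<alpha>] by auto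
  qed
  then show e: "alpha_ch ell = ?a" .
  show "beta_ang (alpha_ch ell) (gamma_ang ell) = alpha_ch ell"
    unfolding e using eq[OF a] ca by blast
  have "arccos 0 < ?a" using c by (intro arccos_less_arccos) auto
  then show "pi / 2 < alpha_ch ell" unfolding e by simp
  have "?a < arccos (- 1 / 2)" using c by (intro arccos_less_arccos) auto
  also have "\<dots> = arccos (cos (2 * pi / 3))" by (simp add: cos_120)
  also have "\<dots> = 2 * pi / 3" by (rule arccos_cos) auto
  finally show "alpha_ch ell < alpha_ru" unfolding e alpha_ru_def .
qed

lemma alpha_ch_tendsto: "alpha_ch \<longlonglongrightarrow> alpha_ru"
proof -
  have "(\<lambda>ell. arccos (1 / (2 * (sin (gamma_ang ell / 2))\<^sup>2) - 1)) \<longlonglongrightarrow>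
      arccos (1 / (2 * (sin (pi / 2))\<^sup>2) - 1)"
    by (intro isCont_tendsto_compose[OF isCont_arccos] tendsto_intros gamma_ang_tendsto) auto
  moreover have "arccos (1 / (2 * (sin (pi / 2))\<^sup>2) - 1) = arccos (cos (2 * pi / 3))"
    by (simp add: cos_120)
  moreover have "arccos (cos (2 * pi / 3)) = 2 * pi / 3" by (rule arccos_cos) auto
  ultimately have "(\<lambda>ell. arccos (1 / (2 * (sin (gamma_ang ell / 2))\<^sup>2) - 1)) \<longlonglongrightarrow> alpha_ru"
    by (simp add: alpha_ru_def)
  moreover have "\<forall>\<^sub>F ell in sequentially. alpha_ch ell = arccos (1 / (2 * (sin (gamma_ang ell / 2))\<^sup>2) - 1)"
    using eventually_ge_at_top[of 4] by eventually_elim (rule alpha_ch(2))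
  ultimately show ?thesis by (simp add: tendsto_cong)
qed

section \<open>The unstretched angle\<close>

text \<open>
  \<open>a0\<close> is a critical point of the angle energy and its strict minimizer among all obtuse angles, and
  the second derivative there is within \<open>e\<close> of its limit for large \<open>ell\<close>.
\<close>

definition strict_angle_minimizer :: "(real \<Rightarrow> real) \<Rightarrow> real \<Rightarrow> real \<Rightarrow> real \<Rightarrow> bool" where
  "strict_angle_minimizer v3 e \<gamma> a0 \<longleftrightarrow>
     angle_energy_deriv v3 \<gamma> a0 = 0 \<and>
     \<bar>angle_energy_deriv2 v3 \<gamma> a0 - 6 * deriv (deriv v3) (2 * pi / 3)\<bar> < e \<and>
     (\<forall>\<alpha>\<in>{pi/2<..<pi}. \<alpha> \<noteq> a0 \<longrightarrow> angle_energy v3 \<gamma> a0 < angle_energy v3 \<gamma> \<alpha>)"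

text \<open>
  Near \<open>2 * pi / 3\<close> the angle energy is strictly convex for large \<open>ell\<close>, and its derivative is negative at
  \<open>alpha_ch ell\<close>, where both angles coincide, and positive at \<open>alpha_ru\<close>. This gives a critical point
  between them. Away from \<open>2 * pi / 3\<close> the angle energy is bounded below by a positive constant, while
  its value at \<open>2 * pi / 3\<close> tends to zero, so the critical point is the strict minimizer among all
  obtuse angles.
\<close>

lemma unstretched_angle_exists:
  assumes v3: "three_body_potential v3" and e: "e > 0"
  shows "\<exists>a>0. \<exists>N\<ge>3. {2 * pi / 3 - a<..<2 * pi / 3 + a} \<subseteq> {pi/2<..<5 * pi / 6} \<and>
    (\<forall>\<alpha>\<in>{2 * pi / 3 - a<..<2 * pi / 3 + a}. 2 * (1 - cos \<alpha>) \<in> {2.6<..<3.1}) \<and>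
    (\<forall>ell>N. {alpha_ch ell<..<alpha_ru} \<subseteq> {2 * pi / 3 - a<..<2 * pi / 3 + a} \<and>
      (\<exists>a0\<in>{alpha_ch ell<..<alpha_ru}. strict_angle_minimizer v3 e (gamma_ang ell) a0))"
proof -
  let ?r = "2 * pi / 3" and ?V1 = "deriv v3" and ?V2 = "deriv (deriv v3)"
  let ?k = "deriv (deriv v3) (2 * pi / 3)"
  have k: "?k > 0" using v3 by (simp add: three_body_potential_def)
  have r: "?r \<in> {0<..<2 * pi}" by auto
  \<comment> \<open>The bound \<open>3 * ?k\<close> makes the second derivative, which is close to \<open>6 * ?k\<close>, positive.\<close>
  define e' where "e' = min e (3 * ?k)"
  have e': "e' > 0" using e k by (simp add: e'_def)
  have "\<forall>\<^sub>F z in nhds pi \<times>\<^sub>F nhds ?r. \<bar>angle_energy_deriv2 v3 (fst z) (snd z) - 6 * ?k\<bar> < e'"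
    using tendstoD[OF tendsto_angle_energy_deriv2[OF v3] e'] by (simp add: dist_real_def)
  then obtain Pf Pg where Pf: "\<forall>\<^sub>F \<gamma> in nhds pi. Pf \<gamma>" and Pg: "\<forall>\<^sub>F \<alpha> in nhds ?r. Pg \<alpha>"
    and P: "\<And>\<gamma> \<alpha>. Pf \<gamma> \<Longrightarrow> Pg \<alpha> \<Longrightarrow> \<bar>angle_energy_deriv2 v3 \<gamma> \<alpha> - 6 * ?k\<bar> < e'"
    unfolding eventually_prod_filter by auto
  have "(?V2 \<longlongrightarrow> ?k) (nhds ?r)"
    using v3_deriv(3)[OF v3 r] by (simp add: continuous_at tendsto_nhds_iff)
  then have ev2: "\<forall>\<^sub>F \<alpha> in nhds ?r. ?V2 \<alpha> > 0" using k by (rule order_tendstoD)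
  have "((\<lambda>\<alpha>. 2 * (1 - cos \<alpha>)) \<longlongrightarrow> 2 * (1 - cos ?r)) (nhds ?r)"
    by (intro tendsto_intros) (simp add: filterlim_def)
  then have evc: "\<forall>\<^sub>F \<alpha> in nhds ?r. 2 * (1 - cos \<alpha>) \<in> {2.6<..<3.1}"
    by (rule topological_tendstoD) (auto simp: cos_120)
  have evi: "\<forall>\<^sub>F \<alpha> in nhds ?r. \<alpha> \<in> {pi/2<..<5 * pi / 6}"
    by (rule eventually_nhds_in_open) auto
  have "\<forall>\<^sub>F \<alpha> in nhds ?r. Pg \<alpha> \<and> ?V2 \<alpha> > 0 \<and> 2 * (1 - cos \<alpha>) \<in> {2.6<..<3.1} \<and> \<alpha> \<in> {pi/2<..<5 * pi / 6}"
    using Pg ev2 evc evi by eventually_elim blast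
  then obtain a where a: "a > 0" and
    "\<And>\<alpha>. \<alpha> \<in> {?r - a<..<?r + a} \<Longrightarrow>
       Pg \<alpha> \<and> ?V2 \<alpha> > 0 \<and> 2 * (1 - cos \<alpha>) \<in> {2.6<..<3.1} \<and> \<alpha> \<in> {pi/2<..<5 * pi / 6}"
    by (rule eventually_nhds_real_interval) blast
  define A where "A = {?r - a<..<?r + a}"
  have A: "Pg \<alpha>" "?V2 \<alpha> > 0" "2 * (1 - cos \<alpha>) \<in> {2.6<..<3.1}" "\<alpha> \<in> {pi/2<..<5 * pi / 6}"
    if "\<alpha> \<in> A" for \<alpha>
    using \<open>\<And>\<alpha>. \<alpha> \<in> {?r - a<..<?r + a} \<Longrightarrow> _ \<alpha>\<close> that unfolding A_def by blast+
  have rA: "?r \<in> A" using a by (simp add: A_def)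
  have Ai: "\<alpha> \<in> {0<..<pi}" "\<alpha> \<in> {0<..<2 * pi}" "\<alpha> \<in> {pi/2<..<pi}" if "\<alpha> \<in> A" for \<alpha>
    using A(4)[OF that] pi_gt_zero by auto
  have conv: "x \<in> A" if "p \<in> A" "q \<in> A" "p \<le> x" "x \<le> q" for p q x
    using that by (auto simp: A_def)
  have V1mono: "strict_mono_on A ?V1"
    unfolding A_def by (rule deriv_pos_imp_strict_mono_on[where f' = ?V2])
      (use A(2) Ai(2) v3_deriv(2)[OF v3] in \<open>auto simp: A_def\<close>)
  have V1neg: "?V1 x < 0" if "x \<in> A" "x < ?r" for x
    using strict_mono_onD[OF V1mono that(1) rA that(2)] v3_deriv_min[OF v3] by simp
  \<comment> \<open>Outside \<open>A\<close> the energy is at least the minimum \<open>v3 x0 > 0\<close> of \<open>v3\<close> over the compact set \<open>K\<close>.\<close>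
  define K where "K = {pi/2..pi} - A"
  have "compact K" unfolding K_def A_def by (intro compact_diff) auto
  moreover have "pi \<notin> A" using A(4)[of pi] by auto
  then have "pi \<in> K" using pi_gt_zero unfolding K_def by simp
  moreover have "continuous_on K v3"
  proof (rule continuous_on_subset[OF smooth_on_continuous[OF v3_smooth[OF v3]]])
    show "K \<subseteq> {0<..<2 * pi}"
    proof
      fix x assume "x \<in> K"
      then have "pi / 2 \<le> x" "x \<le> pi" by (auto simp: K_def)
      then show "x \<in> {0<..<2 * pi}" using pi_gt_zero unfolding greaterThanLessThan_iff by linarith
    qed
  qed simp
  ultimately obtain x0 where x0: "x0 \<in> K" "\<And>x. x \<in> K \<Longrightarrow> v3 x0 \<le> v3 x"
    using continuous_attains_inf[of K v3] by blast
  have "x0 \<notin> A" using x0(1) by (simp add: K_def)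
  then have "x0 \<noteq> ?r" using rA by blast
  moreover have "x0 \<in> {0..pi}" using x0(1) pi_half_gt_zero unfolding K_def by (auto intro: order.trans[of 0 "pi/2"])
  ultimately have d: "v3 x0 > 0" using v3_pos[OF v3] by blast
  let ?B = "\<lambda>ell. beta_ang ?r (gamma_ang ell)"
  have "?B \<longlonglongrightarrow> 2 * arcsin (sin ?r * sin (pi / 2))"
    unfolding beta_ang_def
  proof (intro tendsto_intros isCont_tendsto_compose[OF isCont_arcsin] gamma_ang_tendsto)
    have "sqrt 3 < sqrt 4" by (rule real_sqrt_less_mono) simp
    then show "sin ?r * sin (pi / 2) < 1" by (simp add: sin_120)
    have "0 \<le> sqrt (3::real)" by simp
    then show "-1 < sin ?r * sin (pi / 2)" unfolding sin_120 sin_pi_half by linarith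
  qed auto
  moreover have "arcsin (sqrt 3 / 2) = pi / 3" using arcsin_sin[of "pi / 3"] by (simp add: sin_60)
  ultimately have B: "?B \<longlonglongrightarrow> ?r" by (simp add: sin_120)
  have "isCont v3 ?r" by (rule DERIV_isCont[OF v3_deriv(1)[OF v3 r]])
  then have "(\<lambda>ell. v3 (?B ell)) \<longlonglongrightarrow> v3 ?r" using B by (rule isCont_tendsto_compose)
  moreover have "v3 ?r = 0" using v3 by (simp add: three_body_potential_def)
  ultimately have ev_v: "\<forall>\<^sub>F ell in sequentially. v3 (?B ell) < v3 x0" using d order_tendstoD(2) by metis
  have lb: "?r - a < ?r" using a by simp
  have "\<forall>\<^sub>F ell in sequentially. ell \<ge> 4 \<and> Pf (gamma_ang ell) \<and> ?r - a < alpha_ch ell \<and> ?r - a < ?B ell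
      \<and> v3 (?B ell) < v3 x0"
    using eventually_ge_at_top[of 4] eventually_compose_filterlim[OF Pf gamma_ang_tendsto]
      order_tendstoD(1)[OF alpha_ch_tendsto lb[folded alpha_ru_def]] order_tendstoD(1)[OF B lb] ev_v
    unfolding alpha_ru_def by eventually_elim blast
  then obtain N where N: "\<And>ell. ell \<ge> N \<Longrightarrow> ell \<ge> 4 \<and> Pf (gamma_ang ell) \<and> ?r - a < alpha_ch ell \<and> ?r - a < ?B ell
      \<and> v3 (?B ell) < v3 x0"
    unfolding eventually_sequentially by blast
  have main: "{alpha_ch ell<..<alpha_ru} \<subseteq> A \<and>
      (\<exists>a0\<in>{alpha_ch ell<..<alpha_ru}. strict_angle_minimizer v3 e (gamma_ang ell) a0)"
    if "ell > max 3 N" for ell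
  proof -
    let ?g = "gamma_ang ell" and ?c = "alpha_ch ell"
    let ?G = "angle_energy v3 ?g" and ?G1 = "angle_energy_deriv v3 ?g" and ?G2 = "angle_energy_deriv2 v3 ?g"
    have n: "ell \<ge> 4" "Pf ?g" "?r - a < ?c" "?r - a < ?B ell" "v3 (?B ell) < v3 x0"
      using N[of ell] that by auto
    have g: "?g \<in> {0<..<pi}" using n(1) gamma_ang_bounds by simp
    note ch = alpha_ch[OF n(1)]
    have cA: "?c \<in> A" using n(3) ch(4) a by (simp add: A_def alpha_ru_def)
    have BA: "?B ell \<in> A" using n(4) beta_ang_120[OF g] a by (simp add: A_def)
    have G2: "\<bar>?G2 \<alpha> - 6 * ?k\<bar> < e'" "?G2 \<alpha> > 0" if "\<alpha> \<in> A" for \<alpha>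
    proof -
      show *: "\<bar>?G2 \<alpha> - 6 * ?k\<bar> < e'" using P[OF n(2) A(1)[OF that]] .
      have "e' \<le> 3 * ?k" by (simp add: e'_def)
      then show "?G2 \<alpha> > 0" using * k by linarith
    qed
    have dG: "(?G has_real_derivative ?G1 \<alpha>) (at \<alpha>)" "(?G1 has_real_derivative ?G2 \<alpha>) (at \<alpha>)"
      if "\<alpha> \<in> A" for \<alpha> using angle_energy_has_deriv[OF v3 g Ai(1)[OF that]] .
    have rpos: "?G1 ?r > 0"
      unfolding angle_energy_deriv_def
      using v3_deriv_min[OF v3] V1neg[OF BA beta_ang_120[OF g]] beta_deriv_neg(1)[OF g Ai(3)[OF rA]]
      by (simp add: mult_neg_neg)
    have "?G1 ?c = ?V1 ?c * (2 + beta_deriv ?c ?g)"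
      unfolding angle_energy_deriv_def ch(1) by (simp add: algebra_simps)
    then have cneg: "?G1 ?c < 0"
      using V1neg[OF cA] ch(4) beta_deriv_neg(2)[OF g Ai(3)[OF cA]] by (simp add: mult_neg_pos alpha_ru_def)
    have cr: "?c < ?r" using ch(4) by (simp add: alpha_ru_def)
    have "\<exists>x\<ge>?c. x \<le> ?r \<and> ?G1 x = 0"
      using cneg rpos cr conv[OF cA rA] DERIV_isCont[OF dG(2)] by (intro IVT) auto
    then obtain a0 where a0: "?c \<le> a0" "a0 \<le> ?r" "?G1 a0 = 0" by blast
    have "a0 \<noteq> ?c" "a0 \<noteq> ?r" using a0(3) cneg rpos by force+
    then have a0i: "a0 \<in> {?c<..<alpha_ru}" using a0(1,2) unfolding alpha_ru_def by force
    have a0A: "a0 \<in> A" using conv[OF cA rA] a0 by blast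
    have G1mono: "strict_mono_on A ?G1"
      unfolding A_def by (rule deriv_pos_imp_strict_mono_on[where f' = ?G2])
        (use G2(2) dG(2) in \<open>auto simp: A_def\<close>)
    have minA: "?G a0 < ?G \<alpha>" if \<alpha>: "\<alpha> \<in> A" "\<alpha> \<noteq> a0" for \<alpha>
    proof (cases "\<alpha> < a0")
      case True
      show ?thesis
      proof (rule DERIV_neg_imp_decreasing_open[OF True])
        fix x assume x: "\<alpha> < x" "x < a0"
        then have "x \<in> A" using conv[OF \<alpha>(1) a0A] by simp
        then show "\<exists>y. DERIV ?G x :> y \<and> y < 0"
          using dG(1) strict_mono_onD[OF G1mono _ a0A x(2)] a0(3) by auto
      next
        show "continuous_on {\<alpha>..a0} ?G"
          using conv[OF \<alpha>(1) a0A] DERIV_isCont[OF dG(1)] by (auto intro!: continuous_at_imp_continuous_on)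
      qed
    next
      case False
      then have lt: "a0 < \<alpha>" using \<alpha> by simp
      show ?thesis
      proof (rule DERIV_pos_imp_increasing_open[OF lt])
        fix x assume x: "a0 < x" "x < \<alpha>"
        then have "x \<in> A" using conv[OF a0A \<alpha>(1)] by simp
        then show "\<exists>y. DERIV ?G x :> y \<and> y > 0"
          using dG(1) strict_mono_onD[OF G1mono a0A _ x(1)] a0(3) by auto
      next
        show "continuous_on {a0..\<alpha>} ?G"
          using conv[OF a0A \<alpha>(1)] DERIV_isCont[OF dG(1)] by (auto intro!: continuous_at_imp_continuous_on)
      qed
    qed
    have "?G a0 \<le> ?G ?r" using minA[OF rA] by (cases "?r = a0") auto
    also have "?G ?r = v3 (?B ell)" using v3 by (simp add: angle_energy_def three_body_potential_def)
    also have "\<dots> < v3 x0" by (rule n(5))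
    finally have lt: "?G a0 < v3 x0" .
    have "?G a0 < ?G \<alpha>" if \<alpha>: "\<alpha> \<in> {pi/2<..<pi}" "\<alpha> \<noteq> a0" for \<alpha>
    proof (cases "\<alpha> \<in> A")
      case False
      then have "v3 x0 \<le> v3 \<alpha>" using x0(2)[of \<alpha>] \<alpha>(1) by (simp add: K_def)
      moreover have "\<alpha> \<in> {0<..<pi}" using \<alpha>(1) by auto
      then have "v3 (beta_ang \<alpha> ?g) \<ge> 0"
        using beta_ang_bounds[OF g, of \<alpha>] by (intro v3_nonneg[OF v3]) auto
      ultimately show ?thesis using lt d by (simp add: angle_energy_def)
    qed (use minA \<alpha>(2) in blast)
    moreover have "\<bar>?G2 a0 - 6 * ?k\<bar> < e" using G2(1)[OF a0A] by (simp add: e'_def)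
    moreover have "{?c<..<alpha_ru} \<subseteq> A" using conv[OF cA rA] by (auto simp: alpha_ru_def)
    ultimately show ?thesis using a0i a0(3) unfolding strict_angle_minimizer_def by blast
  qed
  have "A \<subseteq> {pi/2<..<5 * pi / 6}" "\<forall>\<alpha>\<in>A. 2 * (1 - cos \<alpha>) \<in> {2.6<..<3.1}" using A(3,4) by blast+
  then show ?thesis using main a unfolding A_def by (intro exI[of _ a] conjI exI[of _ "max 3 N"] allI impI) simp_all
qed

lemma alpha_of:
  assumes "0 < sigma_of \<mu> lam1" "sigma_of \<mu> lam1 < lam2"
  shows "alpha_of \<mu> lam1 lam2 = arccos (- sigma_of \<mu> lam1 / lam2)"
    and "arccos (- sigma_of \<mu> lam1 / lam2) \<in> {pi/2<..<pi}"
    and "cos (arccos (- sigma_of \<mu> lam1 / lam2)) = - sigma_of \<mu> lam1 / lam2"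
proof -
  let ?c = "- sigma_of \<mu> lam1 / lam2" and ?a = "arccos (- sigma_of \<mu> lam1 / lam2)"
  have c: "-1 < ?c" "?c < 0" using assms by (auto simp: field_simps)
  then show ca: "cos ?a = ?c" by (intro cos_arccos) auto
  have "arccos 0 < ?a" by (rule arccos_less_arccos) (use c in linarith)+
  moreover have "?a < arccos (-1)" by (rule arccos_less_arccos) (use c in linarith)+
  ultimately show ai: "?a \<in> {pi/2<..<pi}" unfolding arccos_0 arccos_minus_1 greaterThanLessThan_iff by blast
  show "alpha_of \<mu> lam1 lam2 = ?a"
    unfolding alpha_of_def
  proof (rule the_equality)
    have sa: "sin ?a = sqrt (1 - ?c\<^sup>2)" using c by (intro sin_arccos) auto
    then show "?a \<in> {pi/2<..<pi} \<and> sin ?a = sqrt (1 - (sigma_of \<mu> lam1 / lam2)\<^sup>2)"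
      using ai by (simp only: power_divide power2_minus)
    fix x assume x: "x \<in> {pi/2<..<pi} \<and> sin x = sqrt (1 - (sigma_of \<mu> lam1 / lam2)\<^sup>2)"
    then have "sin (pi - x) = sin (pi - ?a)" using sa by (simp only: sin_pi_minus power_divide power2_minus)
    moreover have "- (pi / 2) \<le> pi - y" "pi - y \<le> pi / 2" if "y \<in> {pi/2<..<pi}" for y
      using that pi_gt_zero unfolding greaterThanLessThan_iff by linarith+
    ultimately have "pi - x = pi - ?a" using x ai sin_inj_pi by blast
    then show "x = ?a" by simp
  qed
qed

lemma zigzag_energy_unit:
  assumes ell: "ell \<ge> 4" and m: "m \<ge> 1" and \<alpha>: "\<alpha> \<in> {pi/2<..<pi}" "2 * (1 - cos \<alpha>) \<in> {2.6<..<3.1}"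
  shows "zigzag_energy v2 v3 ell m 1 1 (2 * (1 - cos \<alpha>)) =
    real (4 * m * ell) * (3 / 2 * v2 1 + angle_energy v3 (gamma_ang ell) \<alpha>)"
proof -
  have "- (sigma_of (2 * (1 - cos \<alpha>)) 1) / 1 = cos \<alpha>" by (simp add: sigma_of_def field_simps)
  moreover have "arccos (cos \<alpha>) = \<alpha>" using \<alpha>(1) pi_half_gt_zero by (intro arccos_cos) auto
  ultimately have "arccos (- (sigma_of (2 * (1 - cos \<alpha>)) 1) / 1) = \<alpha>" by simp
  then show ?thesis
    using zigzag_energy_eq[OF ell m, of 1 1 "2 * (1 - cos \<alpha>)" v2 v3] \<alpha>(2)
    by (simp add: angle_energy_def)
qed

text \<open>
  The angle just found is \<open>alpha_us v3 ell\<close>. The potential \<open>v2\<close> enters only because \<open>us_angle\<close>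
  quantifies over two-body potentials and would hold for every angle if there were none.
\<close>

lemma unstretched_angle:
  assumes v2: "two_body_potential v2" and v3: "three_body_potential v3" and e: "e > 0"
  shows "\<exists>N\<ge>4. \<forall>ell\<ge>N. 
      alpha_us v3 ell \<in> {alpha_ch ell<..<alpha_ru} \<and>
      alpha_us v3 ell \<in> {pi/2<..<5 * pi / 6} \<and> mu_us v3 ell \<in> {2.6<..<3.1} \<and>
      strict_angle_minimizer v3 e (gamma_ang ell) (alpha_us v3 ell)"
proof -
  obtain a N where a: "a > 0" and N: "N \<ge> 3" and
    A: "{2 * pi / 3 - a<..<2 * pi / 3 + a} \<subseteq> {pi/2<..<5 * pi / 6}"
    "\<And>\<alpha>. \<alpha> \<in> {2 * pi / 3 - a<..<2 * pi / 3 + a} \<Longrightarrow> 2 * (1 - cos \<alpha>) \<in> {2.6<..<3.1}" and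
    main: "\<And>ell. ell > N \<Longrightarrow> {alpha_ch ell<..<alpha_ru} \<subseteq> {2 * pi / 3 - a<..<2 * pi / 3 + a} \<and>
      (\<exists>a0\<in>{alpha_ch ell<..<alpha_ru}. strict_angle_minimizer v3 e (gamma_ang ell) a0)"
    using unstretched_angle_exists[OF v3 e] by blast
  let ?A = "{2 * pi / 3 - a<..<2 * pi / 3 + a}"
  have us: "us_angle v3 ?A ell a0"
    if ell: "ell > N" and a0: "a0 \<in> {alpha_ch ell<..<alpha_ru}"
      and min: "strict_angle_minimizer v3 e (gamma_ang ell) a0" for ell a0
    unfolding us_angle_def
  proof (intro allI impI; elim conjE)
    fix w2 :: "real \<Rightarrow> real" and m :: nat and \<alpha>' assume m: "m \<ge> 1"
    let ?E = "\<lambda>x. zigzag_energy w2 v3 ell m 1 1 (2 * (1 - cos x))"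
    have ell4: "ell \<ge> 4" using ell N by simp
    have a0A: "a0 \<in> ?A" using main[OF ell] a0 by blast
    have E: "?E x = real (4 * m * ell) * (3 / 2 * w2 1 + angle_energy v3 (gamma_ang ell) x)" "x \<in> {pi/2<..<pi}"
      if "x \<in> ?A" for x
    proof -
      show "x \<in> {pi/2<..<pi}" using A(1) that pi_gt_zero by fastforce
      then show "?E x = real (4 * m * ell) * (3 / 2 * w2 1 + angle_energy v3 (gamma_ang ell) x)"
        using zigzag_energy_unit[OF ell4 m] A(2)[OF that] by blast
    qed
    have lt: "?E a0 < ?E x" if "x \<in> ?A" "x \<noteq> a0" for x
    proof -
      have "real (4 * m * ell) > 0" using m ell4 by simp
      moreover have "angle_energy v3 (gamma_ang ell) a0 < angle_energy v3 (gamma_ang ell) x"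
        using min E(2)[OF that(1)] that(2) unfolding strict_angle_minimizer_def by blast
      ultimately show ?thesis
        unfolding E(1)[OF that(1)] E(1)[OF a0A] by (intro mult_strict_left_mono) auto
    qed
    show "is_arg_min ?E (\<lambda>x. x \<in> ?A) \<alpha>' \<longleftrightarrow> \<alpha>' = a0"
    proof
      assume "is_arg_min ?E (\<lambda>x. x \<in> ?A) \<alpha>'"
      then have "\<alpha>' \<in> ?A" "\<not> ?E a0 < ?E \<alpha>'" using a0A unfolding is_arg_min_def by blast+
      then show "\<alpha>' = a0" using lt by blast
    next
      assume "\<alpha>' = a0"
      then show "is_arg_min ?E (\<lambda>x. x \<in> ?A) \<alpha>'"
        using lt a0A unfolding is_arg_min_def by (metis less_asym')
    qed
  qed
  have int: "us_interval v3 ?A N"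
    unfolding us_interval_def using N A(2) main us by (intro conjI) (blast | metis)+
  \<comment> \<open>For any other admissible interval, both minimizers lie in both intervals and hence coincide.\<close>
  have "alpha_us v3 ell = a0"
    if ell: "ell > N" and a0: "a0 \<in> {alpha_ch ell<..<alpha_ru}" "us_angle v3 ?A ell a0" for ell a0
    unfolding alpha_us_def
  proof (rule the_equality)
    show "\<exists>A N. us_interval v3 A N \<and> ell > N \<and> us_angle v3 A ell a0" using int ell a0 by blast
    fix x assume "\<exists>A N. us_interval v3 A N \<and> ell > N \<and> us_angle v3 A ell x"
    then obtain A' N' where A': "us_interval v3 A' N'" "ell > N'" "us_angle v3 A' ell x" by blast
    let ?E = "\<lambda>x. zigzag_energy v2 v3 ell 1 1 1 (2 * (1 - cos x))"
    have ax: "is_arg_min ?E (\<lambda>x. x \<in> A') y \<longleftrightarrow> y = x" for y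
      using A'(3) v2 unfolding us_angle_def by blast
    have aa: "is_arg_min ?E (\<lambda>x. x \<in> ?A) y \<longleftrightarrow> y = a0" for y
      using a0(2) v2 unfolding us_angle_def by blast
    obtain z where z: "z \<in> {alpha_ch ell<..<alpha_ru}" "us_angle v3 A' ell z"
      and sub: "{alpha_ch ell<..<alpha_ru} \<subseteq> A'"
      using A'(1,2) unfolding us_interval_def by blast
    have "is_arg_min ?E (\<lambda>x. x \<in> A') z" using z(2) v2 unfolding us_angle_def by blast
    then have "z = x" using ax by blast
    then have xA: "x \<in> ?A" using z(1) main[OF ell] by blast
    have "a0 \<in> A'" using sub a0(1) by blast
    then have "\<not> ?E a0 < ?E x" using ax[of x] unfolding is_arg_min_def by blast
    moreover have "\<And>y. y \<in> ?A \<Longrightarrow> \<not> ?E y < ?E a0" using aa[of a0] unfolding is_arg_min_def by blast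
    ultimately have "is_arg_min ?E (\<lambda>x. x \<in> ?A) x"
      using xA unfolding is_arg_min_def by (meson less_trans linorder_neqE_linordered_idom not_less order.strict_trans1)
    then show "x = a0" using aa by blast
  qed
  then have "\<exists>a0\<in>{alpha_ch ell<..<alpha_ru}. alpha_us v3 ell = a0 \<and> a0 \<in> ?A \<and>
      strict_angle_minimizer v3 e (gamma_ang ell) a0"
    if "ell > N" for ell
    using main[OF that] us[OF that] that by blast
  then have fin: "alpha_us v3 ell \<in> {alpha_ch ell<..<alpha_ru} \<and> alpha_us v3 ell \<in> ?A \<and>
      strict_angle_minimizer v3 e (gamma_ang ell) (alpha_us v3 ell)"
    if "ell > N" for ell
    using that by blast
  show ?thesis
  proof (intro exI[of _ "Suc N"] conjI allI impI)
    fix ell assume "Suc N \<le> ell"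
    then have ell: "ell > N" by simp
    note f = fin[OF ell]
    have mu: "mu_us v3 ell = 2 * (1 - cos (alpha_us v3 ell))" by (simp add: mu_us_def)
    show "mu_us v3 ell \<in> {2.6<..<3.1}" unfolding mu using A(2) f by blast
    show "alpha_us v3 ell \<in> {pi/2<..<5 * pi / 6}" using A(1) f by blast
  qed (use N fin in \<open>auto simp: less_eq_Suc_le\<close>)
qed

section \<open>The curve of equilibria\<close>

lemma isCont_eventually_in:
  fixes f :: "real \<Rightarrow> real"
  assumes "isCont f x" "open S" "f x \<in> S"
  shows "\<forall>\<^sub>F y in nhds x. f y \<in> S"
proof -
  have "(f \<longlongrightarrow> f x) (nhds x)" using assms(1) by (simp add: continuous_at tendsto_nhds_iff)
  then show ?thesis using assms(2,3) by (rule topological_tendstoD)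
qed

context
  fixes v2 :: "real \<Rightarrow> real"
  assumes v2: "two_body_potential v2"
begin

lemma v2_smooth: "smooth_on {0<..} v2"
  using v2 unfolding two_body_potential_def by blast

lemma v2_deriv:
  assumes "x > 0"
  shows "(v2 has_real_derivative deriv v2 x) (at x)"
    and "(deriv v2 has_real_derivative deriv (deriv v2) x) (at x)"
  using assms smooth_on_has_deriv[OF v2_smooth] smooth_on_has_deriv[OF smooth_on_deriv[OF v2_smooth]] by auto

lemma v2_ge: "x > 0 \<Longrightarrow> v2 x \<ge> -1" and v2_gt: "x > 0 \<Longrightarrow> x \<noteq> 1 \<Longrightarrow> v2 x > -1" and v2_one: "v2 1 = -1"
  using v2 unfolding two_body_potential_def by (metis order.refl order_less_imp_le, blast+)

lemma v2_deriv_one: "deriv v2 1 = 0"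
proof (rule DERIV_local_min[of v2 _ 1 1])
  show "(v2 has_real_derivative deriv v2 1) (at 1)" by (rule v2_deriv) simp
  show "\<forall>y. \<bar>1 - y\<bar> < 1 \<longrightarrow> v2 1 \<le> v2 y" using v2_ge v2_one by auto
qed simp

text \<open>
  Let \<open>G\<close> be an angle energy with nondegenerate critical point \<open>a0\<close>. With the tension
  \<open>T = G' \<alpha> / (l2 * sin \<alpha>)\<close>, stationarity of \<open>v2 l1 / 2 + v2 l2 + G \<alpha>\<close> in the bond lengths at fixed period
  means \<open>v2' l1 = 2 * T\<close> and \<open>v2' l2 = - T * cos \<alpha>\<close>. Eliminating \<open>T\<close> from the second equation gives
  \<open>l2 * v2' l2 = - G' \<alpha> * cot \<alpha>\<close>. Since \<open>r * v2' r\<close> and \<open>v2' r\<close> are invertible near \<open>r = 1\<close>, this determines \<open>l2\<close>,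
  then \<open>T\<close>, \<open>l1\<close> and the period \<open>mu\<close> as smooth functions of \<open>\<alpha>\<close>. Their derivatives at \<open>a0\<close> are
  positive. The product \<open>l2 * sin \<alpha>\<close> is proportional to the radius of the tube; the sign of its
  derivative is that of \<open>g2 - \<kappa>\<close>.
\<close>

lemma equilibrium_curve:
  fixes G :: "real \<Rightarrow> real" and a0 c1 c2 :: real
  defines "\<kappa> \<equiv> deriv (deriv v2) 1" and "g2 \<equiv> deriv (deriv G) a0"
  assumes G: "smooth_on {0<..<pi} G"
    and a0: "a0 \<in> {c1<..<c2}" and c: "{c1<..<c2} \<subseteq> {pi/2<..<pi}"
    and G1: "deriv G a0 = 0" and g2: "g2 > 0"
  obtains e d L1 L2 T mu where
    "e > 0" "d > 0" "d < 0.1" "{a0 - e<..<a0 + e} \<subseteq> {c1<..<c2}"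
    "smooth_on {a0 - e<..<a0 + e} L1" "smooth_on {a0 - e<..<a0 + e} L2"
    "smooth_on {a0 - e<..<a0 + e} T" "smooth_on {a0 - e<..<a0 + e} mu"
    "L1 a0 = 1" "L2 a0 = 1" "T a0 = 0" "mu a0 = 2 - 2 * cos a0"
    "\<And>\<alpha>. \<alpha> \<in> {a0 - e<..<a0 + e} \<Longrightarrow> L1 \<alpha> \<in> {0.9<..<1.1} \<and> L2 \<alpha> \<in> {0.9<..<1.1} \<and>
       deriv v2 (L1 \<alpha>) = 2 * T \<alpha> \<and> deriv v2 (L2 \<alpha>) = - T \<alpha> * cos \<alpha> \<and> deriv G \<alpha> = T \<alpha> * (L2 \<alpha> * sin \<alpha>) \<and>
       mu \<alpha> = 2 * (L1 \<alpha> - L2 \<alpha> * cos \<alpha>)"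
    "\<And>\<alpha>. \<alpha> \<in> {a0 - e<..<a0 + e} \<Longrightarrow> deriv L1 \<alpha> > 0 \<and> deriv L2 \<alpha> > 0 \<and> deriv T \<alpha> > 0 \<and> deriv mu \<alpha> > 0"
    "\<And>\<alpha>. \<alpha> \<in> {a0 - e<..<a0 + e} \<Longrightarrow> (g2 > \<kappa> \<longrightarrow> deriv (\<lambda>\<alpha>. L2 \<alpha> * sin \<alpha>) \<alpha> > 0) \<and>
       (g2 < \<kappa> \<longrightarrow> deriv (\<lambda>\<alpha>. L2 \<alpha> * sin \<alpha>) \<alpha> < 0)"
    "\<And>\<alpha> l1 l2. \<lbrakk>\<alpha> \<in> {a0 - e<..<a0 + e}; \<bar>l1 - 1\<bar> < d; \<bar>l2 - 1\<bar> < d;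
       deriv v2 l1 / 2 = deriv G \<alpha> / (l2 * sin \<alpha>); deriv v2 l2 = - (deriv G \<alpha> * cos \<alpha> / (l2 * sin \<alpha>))\<rbrakk>
       \<Longrightarrow> l1 = L1 \<alpha> \<and> l2 = L2 \<alpha>"
    "deriv T a0 = g2 / sin a0"
    "deriv mu a0 = 2 * (2 * g2 / (\<kappa> * sin a0) + g2 * (cos a0)\<^sup>2 / (\<kappa> * sin a0) + sin a0)"
proof -
  let ?V = "deriv v2" and ?h = "\<lambda>r. r * deriv v2 r" and ?P = "{0<..<pi} :: real set"
  have \<kappa>: "\<kappa> > 0" using v2 by (simp add: \<kappa>_def two_body_potential_def)
  have Vs: "smooth_on {0<..} ?V" by (rule smooth_on_deriv[OF v2_smooth]) simp
  have hs: "smooth_on {0<..} ?h" by (intro smooth_on_mult smooth_on_ident Vs) simp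
  have "(?h has_real_derivative 1 * ?V 1 + \<kappa> * 1) (at 1)"
    unfolding \<kappa>_def by (intro DERIV_mult DERIV_ident v2_deriv) simp
  then have h1: "deriv ?h 1 = \<kappa>" using v2_deriv_one by (simp add: DERIV_imp_deriv)
  have "\<forall>\<^sub>F r in nhds 1. (r \<in> {0<..} \<and> deriv ?V r > 0) \<and> (r \<in> {0<..} \<and> deriv ?h r > 0) \<and> r \<in> {0.9<..<1.1}"
  proof (rule eventually_conj[OF _ eventually_conj])
    show "\<forall>\<^sub>F r in nhds 1. r \<in> {0<..} \<and> deriv ?V r > 0"
      using \<kappa> by (intro smooth_deriv_pos_nbhd[OF Vs]) (auto simp: \<kappa>_def)
    show "\<forall>\<^sub>F r in nhds 1. r \<in> {0<..} \<and> deriv ?h r > 0"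
      using \<kappa> h1 by (intro smooth_deriv_pos_nbhd[OF hs]) auto
  qed (rule eventually_nhds_in_open, auto)
  then obtain d where d: "d > 0" and
    I0: "\<And>r. r \<in> {1 - d<..<1 + d} \<Longrightarrow> deriv ?V r > 0 \<and> deriv ?h r > 0 \<and> r \<in> {0.9<..<1.1}"
    by (rule eventually_nhds_real_interval) blast
  let ?I = "{1 - d<..<1 + d}"
  have Ipos: "?I \<subseteq> {0<..}" using I0 by fastforce
  have one: "1 \<in> ?I" using d by simp
  obtain p where p: "open (?V ` ?I)" "smooth_on (?V ` ?I) p" "\<And>r. r \<in> ?I \<Longrightarrow> p (?V r) = r"
    "\<And>y. y \<in> ?V ` ?I \<Longrightarrow> (p has_real_derivative inverse (deriv ?V (p y))) (at y)"
    using smooth_inverse[OF smooth_on_subset[OF Vs Ipos]] I0 by blast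
  obtain q where q: "open (?h ` ?I)" "smooth_on (?h ` ?I) q" "\<And>r. r \<in> ?I \<Longrightarrow> q (?h r) = r"
    "\<And>y. y \<in> ?h ` ?I \<Longrightarrow> (q has_real_derivative inverse (deriv ?h (q y))) (at y)"
    using smooth_inverse[OF smooth_on_subset[OF hs Ipos]] I0 by blast
  have V0: "0 \<in> ?V ` ?I" "p 0 = 1" using one p(3)[OF one] v2_deriv_one by (force, simp)
  have h0: "0 \<in> ?h ` ?I" "q 0 = 1" using one q(3)[OF one] v2_deriv_one by (force, simp)
  have a0P: "a0 \<in> ?P" "a0 \<in> {pi/2<..<pi}" using a0 c by auto
  have sn: "sin \<alpha> > 0" if "\<alpha> \<in> ?P" for \<alpha> using that by (intro sin_gt_zero) auto
  have cn: "cos a0 < 0" using a0P(2) cos_monotone_0_pi[of "pi/2" a0] by auto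
  note s0 = sn[OF a0P(1)]
  have Gs: "smooth_on ?P (deriv G)" by (rule smooth_on_deriv[OF G]) simp
  have dG: "(deriv G has_real_derivative g2) (at a0)"
    unfolding g2_def by (rule smooth_on_has_deriv[OF Gs _ a0P(1)]) simp
  define Q where "Q = (\<lambda>\<alpha>. - (deriv G \<alpha> * (cos \<alpha> / sin \<alpha>)))"
  have Qs: "smooth_on ?P Q"
    unfolding Q_def using sn
    by (intro smooth_on_minus smooth_on_mult smooth_on_divide smooth_on_cos smooth_on_sin Gs) force+
  have Q0: "Q a0 = 0" by (simp add: Q_def G1)
  have dQ: "(Q has_real_derivative - (g2 * (cos a0 / sin a0))) (at a0)"
    unfolding Q_def using dG s0 G1 by (auto intro!: derivative_eq_intros)
  have "\<forall>\<^sub>F \<alpha> in nhds a0. Q \<alpha> \<in> ?h ` ?I \<and> \<alpha> \<in> {c1<..<c2}"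
  proof (intro eventually_conj eventually_nhds_in_open isCont_eventually_in q(1))
    show "isCont Q a0" by (rule smooth_on_isCont[OF Qs _ a0P(1)]) simp
  qed (use Q0 h0 a0 in auto)
  then obtain e1 where e1: "e1 > 0" and
    J1: "\<And>\<alpha>. \<alpha> \<in> {a0 - e1<..<a0 + e1} \<Longrightarrow> Q \<alpha> \<in> ?h ` ?I \<and> \<alpha> \<in> {c1<..<c2}"
    by (rule eventually_nhds_real_interval) blast
  let ?J1 = "{a0 - e1<..<a0 + e1}"
  have J1P: "?J1 \<subseteq> ?P" using J1 c pi_half_gt_zero by (smt (verit, del_insts) greaterThanLessThan_iff subset_eq)
  define L2 where "L2 = (\<lambda>\<alpha>. q (Q \<alpha>))"
  have L2s: "smooth_on ?J1 L2"
    unfolding L2_def using J1 by (intro smooth_on_compose[OF _ q(2)] smooth_on_subset[OF Qs J1P]) auto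
  have L2I: "L2 \<alpha> \<in> ?I" "?h (L2 \<alpha>) = Q \<alpha>" if "\<alpha> \<in> ?J1" for \<alpha>
    using J1[OF that] q(3) unfolding L2_def by auto
  have L2pos: "L2 \<alpha> > 0" if "\<alpha> \<in> ?J1" for \<alpha> using L2I(1)[OF that] Ipos by auto
  have L20: "L2 a0 = 1" by (simp add: L2_def Q0 h0)
  have dL2: "(L2 has_real_derivative - (g2 * cos a0 / (\<kappa> * sin a0))) (at a0)"
  proof -
    have "(q has_real_derivative inverse \<kappa>) (at (Q a0))" using q(4)[OF h0(1)] by (simp add: Q0 h0(2) h1)
    from DERIV_chain2[OF this dQ] show ?thesis unfolding L2_def by (simp add: field_simps)
  qed
  define T where "T = (\<lambda>\<alpha>. deriv G \<alpha> / (L2 \<alpha> * sin \<alpha>))"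
  have Ls0: "L2 \<alpha> * sin \<alpha> > 0" if "\<alpha> \<in> ?J1" for \<alpha> using L2pos[OF that] sn J1P that by auto
  have Ts: "smooth_on ?J1 T"
    unfolding T_def
    by (intro smooth_on_divide smooth_on_mult L2s smooth_on_sin smooth_on_subset[OF Gs J1P]) (use Ls0 in force)+
  have T0: "T a0 = 0" by (simp add: T_def G1)
  have dLs: "((\<lambda>\<alpha>. L2 \<alpha> * sin \<alpha>) has_real_derivative - (g2 * cos a0 / (\<kappa> * sin a0)) * sin a0 + cos a0 * L2 a0) (at a0)"
    by (intro DERIV_mult dL2 DERIV_sin)
  have dT: "(T has_real_derivative g2 / sin a0) (at a0)"
    using DERIV_divide[OF dG dLs] s0 by (simp add: T_def[abs_def] L20 G1)
  have a0J1: "a0 \<in> ?J1" using e1 by simp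
  have "\<forall>\<^sub>F \<alpha> in nhds a0. 2 * T \<alpha> \<in> ?V ` ?I \<and> \<alpha> \<in> ?J1"
  proof (intro eventually_conj eventually_nhds_in_open isCont_eventually_in p(1))
    have "isCont T a0" by (rule smooth_on_isCont[OF Ts _ a0J1]) simp
    then show "isCont (\<lambda>\<alpha>. 2 * T \<alpha>) a0" by (intro continuous_intros)
  qed (use T0 V0 a0J1 in auto)
  then obtain e2 where e2: "e2 > 0" and
    J2: "\<And>\<alpha>. \<alpha> \<in> {a0 - e2<..<a0 + e2} \<Longrightarrow> 2 * T \<alpha> \<in> ?V ` ?I \<and> \<alpha> \<in> ?J1"
    by (rule eventually_nhds_real_interval) blast
  let ?J2 = "{a0 - e2<..<a0 + e2}"
  have J2J1: "?J2 \<subseteq> ?J1" using J2 by blast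
  have a0J2: "a0 \<in> ?J2" using e2 by simp
  define L1 where "L1 = (\<lambda>\<alpha>. p (2 * T \<alpha>))"
  have L1s: "smooth_on ?J2 L1"
    unfolding L1_def using J2
    by (intro smooth_on_compose[OF _ p(2)] smooth_on_mult smooth_on_const smooth_on_subset[OF Ts J2J1]) auto
  have L1I: "L1 \<alpha> \<in> ?I" "?V (L1 \<alpha>) = 2 * T \<alpha>" if "\<alpha> \<in> ?J2" for \<alpha>
    using J2[OF that] p(3) unfolding L1_def by auto
  have L10: "L1 a0 = 1" by (simp add: L1_def T0 V0)
  have dL1: "(L1 has_real_derivative 2 * g2 / (\<kappa> * sin a0)) (at a0)"
  proof -
    have "(p has_real_derivative inverse \<kappa>) (at (2 * T a0))"
      using p(4)[OF V0(1)] by (simp add: T0 V0(2) \<kappa>_def)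
    from DERIV_chain2[OF this DERIV_cmult[OF dT, of 2]] show ?thesis unfolding L1_def by (simp add: field_simps)
  qed
  define mu where "mu = (\<lambda>\<alpha>. 2 * (L1 \<alpha> - L2 \<alpha> * cos \<alpha>))"
  have mus: "smooth_on ?J2 mu"
    unfolding mu_def
    by (intro smooth_on_mult smooth_on_const smooth_on_diff L1s smooth_on_subset[OF L2s J2J1] smooth_on_cos) auto
  have "(mu has_real_derivative 2 * (2 * g2 / (\<kappa> * sin a0) -
      (- (g2 * cos a0 / (\<kappa> * sin a0)) * cos a0 + - sin a0 * L2 a0))) (at a0)"
    unfolding mu_def by (intro DERIV_cmult DERIV_diff DERIV_mult dL1 dL2 DERIV_cos)
  also have "2 * (2 * g2 / (\<kappa> * sin a0) - (- (g2 * cos a0 / (\<kappa> * sin a0)) * cos a0 + - sin a0 * L2 a0)) =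
      2 * (2 * g2 / (\<kappa> * sin a0) + g2 * (cos a0)\<^sup>2 / (\<kappa> * sin a0) + sin a0)"
    by (simp add: L20 power2_eq_square)
  finally have dmu: "deriv mu a0 = 2 * (2 * g2 / (\<kappa> * sin a0) + g2 * (cos a0)\<^sup>2 / (\<kappa> * sin a0) + sin a0)"
    by (rule DERIV_imp_deriv)
  define w where "w = (\<lambda>\<alpha>. L2 \<alpha> * sin \<alpha>)"
  have ws: "smooth_on ?J2 w"
    unfolding w_def by (intro smooth_on_mult smooth_on_subset[OF L2s J2J1] smooth_on_sin) auto
  have dw: "deriv w a0 = (- cos a0) * ((g2 - \<kappa>) / \<kappa>)"
    unfolding w_def using DERIV_imp_deriv[OF dLs] s0 \<kappa> by (simp add: L20 field_simps)
  have opn: "open ?J2" by simp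
  have "\<forall>\<^sub>F \<alpha> in nhds a0. deriv L1 \<alpha> > 0" "\<forall>\<^sub>F \<alpha> in nhds a0. deriv L2 \<alpha> > 0"
    "\<forall>\<^sub>F \<alpha> in nhds a0. deriv T \<alpha> > 0" "\<forall>\<^sub>F \<alpha> in nhds a0. deriv mu \<alpha> > 0"
  proof -
    have ev: "\<forall>\<^sub>F \<alpha> in nhds a0. deriv f \<alpha> > 0" if "smooth_on ?J2 f" "deriv f a0 > 0" for f
      using smooth_deriv_pos_nbhd[OF that(1) opn a0J2 that(2)] by eventually_elim blast
    have "- (g2 * cos a0 / (\<kappa> * sin a0)) > 0" using g2 \<kappa> s0 cn by (simp add: divide_neg_pos mult_pos_neg)
    then show "\<forall>\<^sub>F \<alpha> in nhds a0. deriv L2 \<alpha> > 0"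
      using DERIV_imp_deriv[OF dL2] by (intro ev smooth_on_subset[OF L2s J2J1]) simp
    show "\<forall>\<^sub>F \<alpha> in nhds a0. deriv L1 \<alpha> > 0"
      using DERIV_imp_deriv[OF dL1] g2 \<kappa> s0 by (intro ev L1s) simp
    show "\<forall>\<^sub>F \<alpha> in nhds a0. deriv T \<alpha> > 0"
      using DERIV_imp_deriv[OF dT] g2 \<kappa> s0 by (intro ev smooth_on_subset[OF Ts J2J1]) simp
    have "2 * g2 / (\<kappa> * sin a0) > 0" "g2 * (cos a0)\<^sup>2 / (\<kappa> * sin a0) \<ge> 0" using g2 \<kappa> s0 by simp_all
    then show "\<forall>\<^sub>F \<alpha> in nhds a0. deriv mu \<alpha> > 0"
      using s0 by (intro ev mus) (simp add: dmu add_pos_nonneg)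
  qed
  moreover have "\<forall>\<^sub>F \<alpha> in nhds a0. (g2 > \<kappa> \<longrightarrow> deriv w \<alpha> > 0) \<and> (g2 < \<kappa> \<longrightarrow> deriv w \<alpha> < 0)"
  proof -
    have t: "(deriv w \<longlongrightarrow> deriv w a0) (nhds a0)"
      using smooth_on_isCont[OF smooth_on_deriv[OF ws opn] opn a0J2] by (simp add: continuous_at tendsto_nhds_iff)
    consider "g2 > \<kappa>" | "g2 < \<kappa>" | "g2 = \<kappa>" by linarith
    then show ?thesis
    proof cases
      case 1
      then have "deriv w a0 > 0" unfolding dw using cn \<kappa> by (intro mult_pos_pos) auto
      then have "\<forall>\<^sub>F \<alpha> in nhds a0. deriv w \<alpha> > 0" using order_tendstoD(1)[OF t] by blast
      then show ?thesis by (rule eventually_mono) (use 1 in auto)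
    next
      case 2
      then have "deriv w a0 < 0" unfolding dw using cn \<kappa> by (intro mult_pos_neg) (auto simp: divide_neg_pos)
      then have "\<forall>\<^sub>F \<alpha> in nhds a0. deriv w \<alpha> < 0" using order_tendstoD(2)[OF t] by blast
      then show ?thesis by (rule eventually_mono) (use 2 in auto)
    qed auto
  qed
  moreover have "\<forall>\<^sub>F \<alpha> in nhds a0. \<alpha> \<in> ?J2" using opn a0J2 by (rule eventually_nhds_in_open)
  ultimately have "\<forall>\<^sub>F \<alpha> in nhds a0. \<alpha> \<in> ?J2 \<and> (deriv L1 \<alpha> > 0 \<and> deriv L2 \<alpha> > 0 \<and> deriv T \<alpha> > 0 \<and> deriv mu \<alpha> > 0) \<and>
      ((g2 > \<kappa> \<longrightarrow> deriv w \<alpha> > 0) \<and> (g2 < \<kappa> \<longrightarrow> deriv w \<alpha> < 0))"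
    by eventually_elim blast
  then obtain e where e: "e > 0" and J: "\<And>\<alpha>. \<alpha> \<in> {a0 - e<..<a0 + e} \<Longrightarrow>
      \<alpha> \<in> ?J2 \<and> (deriv L1 \<alpha> > 0 \<and> deriv L2 \<alpha> > 0 \<and> deriv T \<alpha> > 0 \<and> deriv mu \<alpha> > 0) \<and>
      ((g2 > \<kappa> \<longrightarrow> deriv w \<alpha> > 0) \<and> (g2 < \<kappa> \<longrightarrow> deriv w \<alpha> < 0))"
    by (rule eventually_nhds_real_interval) blast
  let ?J = "{a0 - e<..<a0 + e}"
  have JJ2: "?J \<subseteq> ?J2" using J by blast
  have eqs: "deriv v2 (L2 \<alpha>) = - T \<alpha> * cos \<alpha>" "deriv G \<alpha> = T \<alpha> * (L2 \<alpha> * sin \<alpha>)" if "\<alpha> \<in> ?J1" for \<alpha>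
  proof -
    have s: "sin \<alpha> > 0" using sn J1P that by blast
    note l = L2pos[OF that]
    show *: "deriv G \<alpha> = T \<alpha> * (L2 \<alpha> * sin \<alpha>)" using s l by (simp add: T_def)
    have "L2 \<alpha> * deriv v2 (L2 \<alpha>) = - (T \<alpha> * (L2 \<alpha> * sin \<alpha>) * (cos \<alpha> / sin \<alpha>))"
      using L2I(2)[OF that] unfolding Q_def * .
    also have "\<dots> = L2 \<alpha> * (- T \<alpha> * cos \<alpha>)" using s by simp
    finally show "deriv v2 (L2 \<alpha>) = - T \<alpha> * cos \<alpha>"
      using l by (subst (asm) mult_cancel_left) simp
  qed
  have uniq: "l1 = L1 \<alpha> \<and> l2 = L2 \<alpha>" if \<alpha>: "\<alpha> \<in> ?J" and l: "\<bar>l1 - 1\<bar> < d" "\<bar>l2 - 1\<bar> < d"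
    and e1: "deriv v2 l1 / 2 = deriv G \<alpha> / (l2 * sin \<alpha>)" and e2: "deriv v2 l2 = - (deriv G \<alpha> * cos \<alpha> / (l2 * sin \<alpha>))"
    for \<alpha> l1 l2
  proof
    have lI: "l1 \<in> ?I" "l2 \<in> ?I" using l by auto
    then have "l2 > 0" using Ipos by auto
    then have "?h l2 = Q \<alpha>" unfolding e2 Q_def by simp
    then show l2: "l2 = L2 \<alpha>" using q(3)[OF lI(2)] by (simp add: L2_def)
    have "?V l1 = 2 * T \<alpha>" using e1 unfolding T_def l2 by simp
    then show "l1 = L1 \<alpha>" using p(3)[OF lI(1)] by (simp add: L1_def)
  qed
  \<comment> \<open>The radius of uniqueness is halved below to make it strictly smaller than \<open>0.1\<close>.\<close>
  have dlt: "d \<le> 0.1"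
  proof (rule ccontr)
    assume "\<not> d \<le> 0.1"
    then have "1.1 \<in> ?I" by auto
    then show False using I0[of "1.1"] by simp
  qed
  show thesis
  proof (rule that[of e "d / 2" L1 L2 T mu])
    show "smooth_on ?J L1" "smooth_on ?J L2" "smooth_on ?J T" "smooth_on ?J mu"
      using smooth_on_subset[OF _ JJ2] L1s mus smooth_on_subset[OF smooth_on_subset[OF _ J2J1] JJ2] L2s Ts by blast+
    show "{a0 - e<..<a0 + e} \<subseteq> {c1<..<c2}" using J J2 J1 by blast
    show "mu a0 = 2 - 2 * cos a0" by (simp add: mu_def L10 L20)
    fix \<alpha> assume \<alpha>: "\<alpha> \<in> ?J"
    show "L1 \<alpha> \<in> {0.9<..<1.1} \<and> L2 \<alpha> \<in> {0.9<..<1.1} \<and>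
       deriv v2 (L1 \<alpha>) = 2 * T \<alpha> \<and> deriv v2 (L2 \<alpha>) = - T \<alpha> * cos \<alpha> \<and> deriv G \<alpha> = T \<alpha> * (L2 \<alpha> * sin \<alpha>) \<and>
       mu \<alpha> = 2 * (L1 \<alpha> - L2 \<alpha> * cos \<alpha>)"
    proof -
      have a: "\<alpha> \<in> ?J2" "\<alpha> \<in> ?J1" using \<alpha> JJ2 J2J1 by blast+
      show ?thesis
        using I0[OF L1I(1)[OF a(1)]] I0[OF L2I(1)[OF a(2)]] L1I(2)[OF a(1)] eqs[OF a(2)] by (simp add: mu_def)
    qed
    show "deriv L1 \<alpha> > 0 \<and> deriv L2 \<alpha> > 0 \<and> deriv T \<alpha> > 0 \<and> deriv mu \<alpha> > 0" using J[OF \<alpha>] by blast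
    show "(g2 > \<kappa> \<longrightarrow> deriv (\<lambda>\<alpha>. L2 \<alpha> * sin \<alpha>) \<alpha> > 0) \<and> (g2 < \<kappa> \<longrightarrow> deriv (\<lambda>\<alpha>. L2 \<alpha> * sin \<alpha>) \<alpha> < 0)"
      using J[OF \<alpha>] unfolding w_def by blast
    show "\<And>l1 l2. \<lbrakk>\<bar>l1 - 1\<bar> < d / 2; \<bar>l2 - 1\<bar> < d / 2;
       deriv v2 l1 / 2 = deriv G \<alpha> / (l2 * sin \<alpha>); deriv v2 l2 = - (deriv G \<alpha> * cos \<alpha> / (l2 * sin \<alpha>))\<rbrakk>
       \<Longrightarrow> l1 = L1 \<alpha> \<and> l2 = L2 \<alpha>"
      by (rule uniq[OF \<alpha>]) (use d in simp_all)
  qed (use e d dlt L10 L20 T0 dmu DERIV_imp_deriv[OF dT] in auto)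
qed

end

section \<open>Minimizers at prescribed period\<close>

text \<open>
  A continuous function exceeding \<open>c\<close> on a compact set exceeds it by a margin; the set may be empty.
\<close>

lemma compact_gap:
  fixes f :: "real \<Rightarrow> real"
  assumes "compact K" "continuous_on K f" "\<And>x. x \<in> K \<Longrightarrow> f x > c"
  obtains \<delta> where "\<delta> > 0" "\<And>x. x \<in> K \<Longrightarrow> f x \<ge> c + \<delta>"
proof (cases "K = {}")
  case False
  then obtain x0 where "x0 \<in> K" "\<And>x. x \<in> K \<Longrightarrow> f x0 \<le> f x"
    using continuous_attains_inf[OF assms(1) _ assms(2)] by blast
  with assms(3)[of x0] that[of "f x0 - c"] show thesis by simp
qed (use that[of 1] in auto)

text \<open>
  The minimizer at prescribed period, per point. Both \<open>v2\<close> and, over the obtuse angles,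
  \<open>G\<close> have strict global minimizers, at \<open>1\<close> and \<open>a0\<close>, and these are attained simultaneously only at the period \<open>mu0\<close>. Hence for \<open>\<mu>\<close> near \<open>mu0\<close> every
  minimizer over the closed square of bond lengths has bond lengths near \<open>1\<close> and angle near \<open>a0\<close>. It is
  then interior, hence stationary, hence on the curve of \<open>equilibrium_curve\<close>, where the period determines
  it. The derivative of the minimal energy with respect to \<open>\<mu>\<close> is half of the tension.
\<close>

lemma tube_minimizer:
  fixes v2 G :: "real \<Rightarrow> real" and a0 c1 c2 :: real
  defines "\<kappa> \<equiv> deriv (deriv v2) 1" and "g2 \<equiv> deriv (deriv G) a0" and "mu0 \<equiv> 2 - 2 * cos a0"
    and "\<Phi> \<equiv> \<lambda>l1 l2 \<mu>. v2 l1 / 2 + v2 l2 + G (arccos (- sigma_of \<mu> l1 / l2))"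
  assumes v2: "two_body_potential v2" and G: "smooth_on {0<..<pi} G"
    and a0: "a0 \<in> {c1<..<c2}" and c: "{c1<..<c2} \<subseteq> {pi/2<..<pi}"
    and G1: "deriv G a0 = 0" and g2: "g2 > 0"
    and Gmin: "\<And>\<alpha>. \<alpha> \<in> {pi/2<..<pi} \<Longrightarrow> \<alpha> \<noteq> a0 \<Longrightarrow> G a0 < G \<alpha>"
    and mu0: "mu0 \<in> {2.6<..<3.1}"
  obtains a b and \<Lambda>1 \<Lambda>2 \<tau> A :: "real \<Rightarrow> real" where
    "mu0 \<in> {a<..<b}" "{a<..<b} \<subseteq> {2.6<..<3.1}"
    "\<And>\<mu>. \<mu> \<in> {a<..<b} \<Longrightarrow> \<Lambda>1 \<mu> \<in> {0.9<..<1.1} \<and> \<Lambda>2 \<mu> \<in> {0.9<..<1.1} \<and>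
       A \<mu> \<in> {c1<..<c2} \<and> arccos (- sigma_of \<mu> (\<Lambda>1 \<mu>) / \<Lambda>2 \<mu>) = A \<mu>"
    "\<And>\<mu> l1 l2. \<lbrakk>\<mu> \<in> {a<..<b}; l1 \<in> {0.9<..<1.1}; l2 \<in> {0.9<..<1.1}; (l1, l2) \<noteq> (\<Lambda>1 \<mu>, \<Lambda>2 \<mu>)\<rbrakk> \<Longrightarrow>
       \<Phi> (\<Lambda>1 \<mu>) (\<Lambda>2 \<mu>) \<mu> < \<Phi> l1 l2 \<mu>"
    "\<Lambda>1 mu0 = 1" "\<Lambda>2 mu0 = 1"
    "continuous_on {a<..<b} \<Lambda>1" "continuous_on {a<..<b} \<Lambda>2" "continuous_on {a<..<b} A"
    "strict_mono_on {a<..<b} \<Lambda>1" "strict_mono_on {a<..<b} \<Lambda>2"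
    "g2 > \<kappa> \<Longrightarrow> strict_mono_on {a<..<b} (\<lambda>\<mu>. \<Lambda>2 \<mu> * sin (A \<mu>))"
    "g2 < \<kappa> \<Longrightarrow> strict_antimono_on {a<..<b} (\<lambda>\<mu>. \<Lambda>2 \<mu> * sin (A \<mu>))"
    "\<And>\<mu>. \<mu> \<in> {a<..<b} \<Longrightarrow> ((\<lambda>\<mu>. \<Phi> (\<Lambda>1 \<mu>) (\<Lambda>2 \<mu>) \<mu>) has_real_derivative \<tau> \<mu> / 2) (at \<mu>)"
    "smooth_on {a<..<b} \<tau>" "strict_mono_on {a<..<b} \<tau>"
    "deriv \<tau> mu0 =
       (g2 / sin a0) / (2 * (2 * g2 / (\<kappa> * sin a0) + g2 * (cos a0)\<^sup>2 / (\<kappa> * sin a0) + sin a0))"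
proof -
  obtain e d L1 L2 T mu where ed: "e > 0" "d > 0" "d < 0.1" and Jc: "{a0 - e<..<a0 + e} \<subseteq> {c1<..<c2}"
    and sm: "smooth_on {a0 - e<..<a0 + e} L1" "smooth_on {a0 - e<..<a0 + e} L2"
      "smooth_on {a0 - e<..<a0 + e} T" "smooth_on {a0 - e<..<a0 + e} mu"
    and at0: "L1 a0 = 1" "L2 a0 = 1" "T a0 = 0" "mu a0 = 2 - 2 * cos a0"
    and eqs: "\<And>\<alpha>. \<alpha> \<in> {a0 - e<..<a0 + e} \<Longrightarrow> L1 \<alpha> \<in> {0.9<..<1.1} \<and> L2 \<alpha> \<in> {0.9<..<1.1} \<and>
       deriv v2 (L1 \<alpha>) = 2 * T \<alpha> \<and> deriv v2 (L2 \<alpha>) = - T \<alpha> * cos \<alpha> \<and> deriv G \<alpha> = T \<alpha> * (L2 \<alpha> * sin \<alpha>) \<and>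
       mu \<alpha> = 2 * (L1 \<alpha> - L2 \<alpha> * cos \<alpha>)"
    and pos: "\<And>\<alpha>. \<alpha> \<in> {a0 - e<..<a0 + e} \<Longrightarrow> deriv L1 \<alpha> > 0 \<and> deriv L2 \<alpha> > 0 \<and> deriv T \<alpha> > 0 \<and> deriv mu \<alpha> > 0"
    and wsgn: "\<And>\<alpha>. \<alpha> \<in> {a0 - e<..<a0 + e} \<Longrightarrow> (g2 > \<kappa> \<longrightarrow> deriv (\<lambda>\<alpha>. L2 \<alpha> * sin \<alpha>) \<alpha> > 0) \<and>
       (g2 < \<kappa> \<longrightarrow> deriv (\<lambda>\<alpha>. L2 \<alpha> * sin \<alpha>) \<alpha> < 0)"
    and uniq: "\<And>\<alpha> l1 l2. \<lbrakk>\<alpha> \<in> {a0 - e<..<a0 + e}; \<bar>l1 - 1\<bar> < d; \<bar>l2 - 1\<bar> < d;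
       deriv v2 l1 / 2 = deriv G \<alpha> / (l2 * sin \<alpha>); deriv v2 l2 = - (deriv G \<alpha> * cos \<alpha> / (l2 * sin \<alpha>))\<rbrakk>
       \<Longrightarrow> l1 = L1 \<alpha> \<and> l2 = L2 \<alpha>"
    and dT0: "deriv T a0 = g2 / sin a0"
    and dmu0: "deriv mu a0 = 2 * (2 * g2 / (\<kappa> * sin a0) + g2 * (cos a0)\<^sup>2 / (\<kappa> * sin a0) + sin a0)"
    by (rule equilibrium_curve[OF v2 G a0 c G1 g2[unfolded g2_def], folded \<kappa>_def g2_def]) blast
  let ?J = "{a0 - e<..<a0 + e}"
  have a0J: "a0 \<in> ?J" using ed by simp
  have Jpi: "\<alpha> \<in> {pi/2<..<pi}" "\<alpha> \<in> {0<..<pi}" if "\<alpha> \<in> ?J" for \<alpha>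
    using that Jc c pi_half_gt_zero by (blast, smt (verit) greaterThanLessThan_iff subset_eq)
  have a0pi: "a0 \<in> {pi/2<..<pi}" using Jpi(1)[OF a0J] .
  have sd: "(f has_real_derivative deriv f \<alpha>) (at \<alpha>)" if "smooth_on ?J f" "\<alpha> \<in> ?J" for f \<alpha>
    by (rule smooth_on_has_deriv[OF that(1) _ that(2)]) simp
  have dG: "(G has_real_derivative deriv G \<alpha>) (at \<alpha>)" if "\<alpha> \<in> {0<..<pi}" for \<alpha>
    by (rule smooth_on_has_deriv[OF G _ that]) simp
  have mon: "strict_mono_on ?J f" if "smooth_on ?J f" "\<And>\<alpha>. \<alpha> \<in> ?J \<Longrightarrow> deriv f \<alpha> > 0" for f
    by (rule deriv_pos_imp_strict_mono_on[OF sd[OF that(1)] that(2)])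
  obtain g where g: "open (mu ` ?J)" "smooth_on (mu ` ?J) g" "\<And>\<alpha>. \<alpha> \<in> ?J \<Longrightarrow> g (mu \<alpha>) = \<alpha>"
    "\<And>y. y \<in> mu ` ?J \<Longrightarrow> (g has_real_derivative inverse (deriv mu (g y))) (at y)"
    using smooth_inverse[OF sm(4)] pos by blast
  have gJ: "g y \<in> ?J" "mu (g y) = y" if "y \<in> mu ` ?J" for y using that g(3) by auto
  have mumono: "strict_mono_on ?J mu" using mon[OF sm(4)] pos by blast
  have gmono: "g y < g z" if yz: "y \<in> mu ` ?J" "z \<in> mu ` ?J" "y < z" for y z
  proof (rule ccontr)
    assume "\<not> g y < g z"
    then have "mu (g z) \<le> mu (g y)"
      using strict_mono_on_leD[OF mumono, of "g z" "g y"] gJ(1)[OF yz(1)] gJ(1)[OF yz(2)] by simp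
    then show False using gJ(2)[OF yz(1)] gJ(2)[OF yz(2)] yz(3) by simp
  qed

  \<comment> \<open>Energy gaps \<open>\<delta>1\<close> and \<open>\<delta>2\<close> away from the minimizers of \<open>v2\<close> and \<open>G\<close>.\<close>
  obtain \<delta>1 where \<delta>1: "\<delta>1 > 0" "\<And>r. r \<in> {0.9..1.1} - {1 - d<..<1 + d} \<Longrightarrow> v2 r \<ge> -1 + \<delta>1"
  proof (rule compact_gap[of "{0.9..1.1} - {1 - d<..<1 + d}" v2 "-1"])
    show "compact ({0.9..1.1} - {1 - d<..<1 + d})" by (intro compact_diff) auto
    show "continuous_on ({0.9..1.1} - {1 - d<..<1 + d}) v2"
      by (rule continuous_on_subset[OF smooth_on_continuous[OF v2_smooth[OF v2]]]) auto
    show "v2 r > -1" if "r \<in> {0.9..1.1} - {1 - d<..<1 + d}" for r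
      using that ed by (intro v2_gt[OF v2]) auto
  qed blast
  \<comment> \<open>For bond lengths in \<open>{0.9..1.1}\<close> and \<open>\<mu> \<in> {2.6<..<3.1}\<close> the cosine lies between \<open>-0.8\<close> and \<open>-0.1\<close>.\<close>
  let ?K = "{arccos (-0.1)..arccos (-0.8)}"
  have K: "\<alpha> \<in> {pi/2<..<pi}" if "\<alpha> \<in> ?K" for \<alpha>
  proof -
    have "arccos 0 < arccos (-0.1)" "arccos (-0.8) < arccos (-1)" by (intro arccos_less_arccos; simp)+
    then show ?thesis using that unfolding arccos_0 arccos_minus_1 by auto
  qed
  obtain \<delta>2 where \<delta>2: "\<delta>2 > 0" "\<And>\<alpha>. \<alpha> \<in> ?K - ?J \<Longrightarrow> G \<alpha> \<ge> G a0 + \<delta>2"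
  proof (rule compact_gap[of "?K - ?J" G "G a0"])
    show "compact (?K - ?J)" by (intro compact_diff) auto
    have "?K - ?J \<subseteq> {0<..<pi}" using K pi_half_gt_zero by fastforce
    then show "continuous_on (?K - ?J) G"
      using continuous_on_subset[OF smooth_on_continuous[OF G]] by simp
    show "G \<alpha> > G a0" if "\<alpha> \<in> ?K - ?J" for \<alpha>
      using that K a0J by (intro Gmin) auto
  qed blast
  have cosa0: "1 - mu0 / 2 = cos a0" by (simp add: mu0_def field_simps)
  have aca0: "arccos (cos a0) = a0" using a0pi pi_half_gt_zero by (intro arccos_cos) auto
  \<comment> \<open>The angle \<open>arccos (1 - \<mu> / 2)\<close> belongs to unit bonds, which serve as competitor.\<close>
  have "isCont (\<lambda>\<mu>. G (arccos (1 - \<mu> / 2))) mu0"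
  proof (rule isCont_o2[of mu0 "\<lambda>\<mu>. arccos (1 - \<mu> / 2)"])
    show "isCont (\<lambda>\<mu>. arccos (1 - \<mu> / 2)) mu0"
      by (rule isCont_o2[of mu0 "\<lambda>\<mu>. 1 - \<mu> / 2"], intro continuous_intros, simp,
          rule isCont_arccos) (use mu0 in auto)
    show "isCont G (arccos (1 - mu0 / 2))"
      unfolding cosa0 aca0 using DERIV_isCont[OF dG] Jpi(2)[OF a0J] by blast
  qed
  then have "\<forall>\<^sub>F \<mu> in nhds mu0. G (arccos (1 - \<mu> / 2)) \<in> {..<G a0 + min (\<delta>1 / 2) \<delta>2}"
    by (rule isCont_eventually_in) (use \<delta>1(1) \<delta>2(1) cosa0 aca0 in auto)
  moreover have "mu0 \<in> mu ` ?J" unfolding mu0_def by (rule image_eqI[OF _ a0J]) (simp add: at0)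
  then have "\<forall>\<^sub>F \<mu> in nhds mu0. \<mu> \<in> mu ` ?J" using g(1) by (rule eventually_nhds_in_open[rotated])
  moreover have "\<forall>\<^sub>F \<mu> in nhds mu0. \<mu> \<in> {2.6<..<3.1}"
    by (rule eventually_nhds_in_open[OF _ mu0]) simp
  ultimately have "\<forall>\<^sub>F \<mu> in nhds mu0. G (arccos (1 - \<mu> / 2)) < G a0 + min (\<delta>1 / 2) \<delta>2 \<and>
      \<mu> \<in> mu ` ?J \<and> \<mu> \<in> {2.6<..<3.1}"
    by eventually_elim auto
  then obtain e' where e': "e' > 0" and M: "\<And>\<mu>. \<mu> \<in> {mu0 - e'<..<mu0 + e'} \<Longrightarrow>
      G (arccos (1 - \<mu> / 2)) < G a0 + min (\<delta>1 / 2) \<delta>2 \<and> \<mu> \<in> mu ` ?J \<and> \<mu> \<in> {2.6<..<3.1}"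
    by (rule eventually_nhds_real_interval) blast
  let ?M = "{mu0 - e'<..<mu0 + e'}" and ?B = "{0.9..1.1} \<times> {0.9..1.1} :: (real \<times> real) set"
  have MJ: "?M \<subseteq> mu ` ?J" using M by blast
  have gM: "g \<mu> \<in> ?J" "mu (g \<mu>) = \<mu>" if "\<mu> \<in> ?M" for \<mu> using gJ MJ that by blast+

  have crit: "l1 = L1 (g \<mu>) \<and> l2 = L2 (g \<mu>)"
    if \<mu>: "\<mu> \<in> ?M" and l: "l1 \<in> {0.9..1.1}" "l2 \<in> {0.9..1.1}"
      and min: "\<And>k1 k2. k1 \<in> {0.9..1.1} \<Longrightarrow> k2 \<in> {0.9..1.1} \<Longrightarrow> \<Phi> l1 l2 \<mu> \<le> \<Phi> k1 k2 \<mu>" for \<mu> l1 l2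
  proof -
    let ?y = "- sigma_of \<mu> l1 / l2"
    let ?\<alpha> = "arccos ?y"
    have \<mu>r: "2.6 < \<mu>" "\<mu> < 3.1" using M[OF \<mu>] by auto
    have l2: "l2 > 0" using l by simp
    have "sigma_of \<mu> l1 \<le> 0.8 * l2" "0.1 * l2 \<le> sigma_of \<mu> l1"
      using \<mu>r l unfolding sigma_of_def by auto
    then have y: "-0.8 \<le> ?y" "?y \<le> -0.1" using l2 by (auto simp: field_simps)
    have "arccos (-0.1) \<le> ?\<alpha>" by (rule arccos_le_arccos) (use y in linarith)+
    moreover have "?\<alpha> \<le> arccos (-0.8)" by (rule arccos_le_arccos) (use y in linarith)+
    ultimately have \<alpha>K: "?\<alpha> \<in> ?K" unfolding atLeastAtMost_iff by blast
    note \<alpha>pi = K[OF \<alpha>K]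
    have \<alpha>pi': "?\<alpha> \<in> {0<..<pi}" using \<alpha>pi pi_half_gt_zero by auto
    have cy: "cos ?\<alpha> = ?y" by (rule cos_arccos) (use y in linarith)+
    have sy: "sin ?\<alpha> = sqrt (1 - ?y\<^sup>2)" by (rule sin_arccos) (use y in linarith)+
    have s0: "sin ?\<alpha> > 0" using \<alpha>pi' by (intro sin_gt_zero) auto
    have ge: "G a0 \<le> G ?\<alpha>" using Gmin[OF \<alpha>pi] by (cases "?\<alpha> = a0") auto
    have "\<Phi> l1 l2 \<mu> \<le> \<Phi> 1 1 \<mu>" by (rule min) auto
    also have "\<Phi> 1 1 \<mu> = - 3 / 2 + G (arccos (1 - \<mu> / 2))"
      unfolding \<Phi>_def using v2_one[OF v2] by (simp add: sigma_of_def)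
    also have "\<dots> < - 3 / 2 + (G a0 + min (\<delta>1 / 2) \<delta>2)" using M[OF \<mu>] by simp
    finally have lt: "v2 l1 / 2 + v2 l2 + G ?\<alpha> < - 3 / 2 + (G a0 + min (\<delta>1 / 2) \<delta>2)" unfolding \<Phi>_def .
    have ge1: "v2 l1 \<ge> -1" "v2 l2 \<ge> -1" using l by (auto intro!: v2_ge[OF v2])
    have mn: "min (\<delta>1 / 2) \<delta>2 \<le> \<delta>1 / 2" "min (\<delta>1 / 2) \<delta>2 \<le> \<delta>2" by auto
    have "v2 l1 < -1 + \<delta>1" "v2 l2 < -1 + \<delta>1" "G ?\<alpha> < G a0 + \<delta>2"
      using lt ge ge1 mn \<delta>1(1) by linarith+
    then have "l1 \<in> {1 - d<..<1 + d}" "l2 \<in> {1 - d<..<1 + d}" and \<alpha>J: "?\<alpha> \<in> ?J"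
      using \<delta>1(2)[of l1] \<delta>1(2)[of l2] \<delta>2(2)[of ?\<alpha>] l \<alpha>K by (meson DiffI not_le)+
    then have ld: "\<bar>l1 - 1\<bar> < d" "\<bar>l2 - 1\<bar> < d" by (auto simp: abs_less_iff)
    have box: "x \<in> {0.9..1.1}" if "\<bar>l - x\<bar> < 0.1 - d" "\<bar>l - 1\<bar> < d" for l x :: real
      using that ed unfolding atLeastAtMost_iff abs_less_iff by linarith
    have dac: "(arccos has_real_derivative inverse (- sin ?\<alpha>)) (at ?y)"
      unfolding sy by (rule DERIV_arccos) (use y in linarith)+
    have "deriv v2 l1 / 2 + deriv G ?\<alpha> * (inverse (- sin ?\<alpha>) * (1 / l2)) = 0"
    proof (rule DERIV_local_min[of "\<lambda>x. \<Phi> x l2 \<mu>" _ l1 "0.1 - d"])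
      have "((\<lambda>x. - sigma_of \<mu> x / l2) has_real_derivative 1 / l2) (at l1)"
        unfolding sigma_of_def using l2 by (auto intro!: derivative_eq_intros)
      from DERIV_chain2[OF dG[OF \<alpha>pi'] DERIV_chain2[OF dac this]]
      have "((\<lambda>x. v2 x / 2 + v2 l2 + G (arccos (- sigma_of \<mu> x / l2))) has_real_derivative
          deriv v2 l1 / 2 + 0 + deriv G ?\<alpha> * (inverse (- sin ?\<alpha>) * (1 / l2))) (at l1)"
        using l by (intro DERIV_add DERIV_cdivide v2_deriv[OF v2] DERIV_const) auto
      then show "((\<lambda>x. \<Phi> x l2 \<mu>) has_real_derivative
          deriv v2 l1 / 2 + deriv G ?\<alpha> * (inverse (- sin ?\<alpha>) * (1 / l2))) (at l1)"
        unfolding \<Phi>_def by simp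
      show "\<forall>x. \<bar>l1 - x\<bar> < 0.1 - d \<longrightarrow> \<Phi> l1 l2 \<mu> \<le> \<Phi> x l2 \<mu>"
        using min box ld(1) l(2) by blast
    qed (use ed in simp)
    then have e1: "deriv v2 l1 / 2 = deriv G ?\<alpha> / (l2 * sin ?\<alpha>)" by (simp add: field_simps)
    have "deriv v2 l2 + deriv G ?\<alpha> * (inverse (- sin ?\<alpha>) * (- ?y / l2)) = 0"
    proof (rule DERIV_local_min[of "\<lambda>x. \<Phi> l1 x \<mu>" _ l2 "0.1 - d"])
      have "((\<lambda>x. - sigma_of \<mu> l1 / x) has_real_derivative - ?y / l2) (at l2)"
        using l2 by (auto intro!: derivative_eq_intros simp: field_simps power2_eq_square)
      from DERIV_chain2[OF dG[OF \<alpha>pi'] DERIV_chain2[OF dac this]]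
      have "((\<lambda>x. v2 l1 / 2 + v2 x + G (arccos (- sigma_of \<mu> l1 / x))) has_real_derivative
          0 + deriv v2 l2 + deriv G ?\<alpha> * (inverse (- sin ?\<alpha>) * (- ?y / l2))) (at l2)"
        using l by (intro DERIV_add v2_deriv[OF v2] DERIV_const) auto
      then show "((\<lambda>x. \<Phi> l1 x \<mu>) has_real_derivative
          deriv v2 l2 + deriv G ?\<alpha> * (inverse (- sin ?\<alpha>) * (- ?y / l2))) (at l2)"
        unfolding \<Phi>_def by simp
      show "\<forall>x. \<bar>l2 - x\<bar> < 0.1 - d \<longrightarrow> \<Phi> l1 l2 \<mu> \<le> \<Phi> l1 x \<mu>"
        using min box ld(2) l(1) by blast
    qed (use ed in simp)
    then have e2: "deriv v2 l2 = - (deriv G ?\<alpha> * cos ?\<alpha> / (l2 * sin ?\<alpha>))" unfolding cy by (simp add: field_simps)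
    have LL: "l1 = L1 ?\<alpha> \<and> l2 = L2 ?\<alpha>" by (rule uniq[OF \<alpha>J ld e1 e2])
    have "l2 * cos ?\<alpha> = l1 - \<mu> / 2" unfolding cy using l2 by (simp add: sigma_of_def)
    then have "mu ?\<alpha> = \<mu>" using eqs[OF \<alpha>J] LL by simp
    then have "g \<mu> = ?\<alpha>" using g(3)[OF \<alpha>J] by simp
    then show ?thesis using LL by simp
  qed

  have best: "\<Phi> (L1 (g \<mu>)) (L2 (g \<mu>)) \<mu> < \<Phi> k1 k2 \<mu>"
    if \<mu>: "\<mu> \<in> ?M" and k: "k1 \<in> {0.9..1.1}" "k2 \<in> {0.9..1.1}" "(k1, k2) \<noteq> (L1 (g \<mu>), L2 (g \<mu>))" for \<mu> k1 k2
  proof -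
    have y: "-1 \<le> - sigma_of \<mu> x / y \<and> - sigma_of \<mu> x / y < 0 \<and> -1 < - sigma_of \<mu> x / y"
      if "x \<in> {0.9..1.1}" "y \<in> {0.9..1.1}" for x y
      using that M[OF \<mu>] unfolding sigma_of_def by (auto simp: field_simps)
    have acP: "arccos (- sigma_of \<mu> x / y) \<in> {0<..<pi}" if "x \<in> {0.9..1.1}" "y \<in> {0.9..1.1}" for x y
      using y[OF that] arccos_lt_bounded[of "- sigma_of \<mu> x / y"] by auto
    have v2c: "continuous_on {0<..} v2" by (rule smooth_on_continuous[OF v2_smooth[OF v2]]) simp
    have Gc: "continuous_on {0<..<pi} G" by (rule smooth_on_continuous[OF G]) simp
    have "continuous_on ?B (\<lambda>p. \<Phi> (fst p) (snd p) \<mu>)"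
      unfolding \<Phi>_def
    proof (intro continuous_on_add continuous_on_divide continuous_on_const)
      show "continuous_on ?B (\<lambda>p. v2 (fst p))" "continuous_on ?B (\<lambda>p. v2 (snd p))"
        by (rule continuous_on_compose2[OF v2c]; auto intro!: continuous_intros)+
      show "continuous_on ?B (\<lambda>p. G (arccos (- sigma_of \<mu> (fst p) / snd p)))"
      proof (rule continuous_on_compose2[OF Gc])
        show "continuous_on ?B (\<lambda>p. arccos (- sigma_of \<mu> (fst p) / snd p))"
        proof (rule continuous_on_arccos)
          show "continuous_on ?B (\<lambda>p. - sigma_of \<mu> (fst p) / snd p)"
            unfolding sigma_of_def by (intro continuous_intros) auto
          show "\<forall>p\<in>?B. -1 \<le> - sigma_of \<mu> (fst p) / snd p \<and> - sigma_of \<mu> (fst p) / snd p \<le> 1"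
            using y by (auto simp: less_imp_le intro: order.trans[of _ 0])
        qed
        show "(\<lambda>p. arccos (- sigma_of \<mu> (fst p) / snd p)) ` ?B \<subseteq> {0<..<pi}" using acP by auto
      qed
    qed simp
    moreover have "compact ?B" "?B \<noteq> {}" by (auto intro!: compact_Times)
    ultimately obtain p where p: "p \<in> ?B" "\<And>q. q \<in> ?B \<Longrightarrow> \<Phi> (fst p) (snd p) \<mu> \<le> \<Phi> (fst q) (snd q) \<mu>"
      using continuous_attains_inf[of ?B "\<lambda>p. \<Phi> (fst p) (snd p) \<mu>"] by blast
    have pP: "fst p = L1 (g \<mu>) \<and> snd p = L2 (g \<mu>)"
      by (rule crit[OF \<mu>]) (use p in auto)
    show ?thesis
    proof (rule ccontr)
      assume "\<not> ?thesis"
      then have "\<Phi> k1 k2 \<mu> \<le> \<Phi> (fst q) (snd q) \<mu>" if "q \<in> ?B" for q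
        using p(2)[OF that] pP by simp
      then have "k1 = L1 (g \<mu>) \<and> k2 = L2 (g \<mu>)" by (intro crit[OF \<mu> k(1,2)]) force
      then show False using k(3) by simp
    qed
  qed

  define F where "F = (\<lambda>\<alpha>. v2 (L1 \<alpha>) / 2 + v2 (L2 \<alpha>) + G \<alpha>)"
  have dF: "(F has_real_derivative T \<alpha> * (deriv mu \<alpha> / 2)) (at \<alpha>)" if \<alpha>: "\<alpha> \<in> ?J" for \<alpha>
  proof -
    note q = eqs[OF \<alpha>]
    have "((\<lambda>\<alpha>. 2 * (L1 \<alpha> - L2 \<alpha> * cos \<alpha>)) has_real_derivative
        2 * (deriv L1 \<alpha> - (deriv L2 \<alpha> * cos \<alpha> + - sin \<alpha> * L2 \<alpha>))) (at \<alpha>)"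
      by (intro DERIV_cmult DERIV_diff DERIV_mult sd[OF sm(1) \<alpha>] sd[OF sm(2) \<alpha>] DERIV_cos)
    then have "(mu has_real_derivative 2 * (deriv L1 \<alpha> - (deriv L2 \<alpha> * cos \<alpha> + - sin \<alpha> * L2 \<alpha>))) (at \<alpha>)"
      by (rule has_field_derivative_transform_within_open[of _ _ _ ?J]) (use eqs \<alpha> in auto)
    then have dm: "deriv mu \<alpha> = 2 * (deriv L1 \<alpha> - (deriv L2 \<alpha> * cos \<alpha> + - sin \<alpha> * L2 \<alpha>))"
      by (rule DERIV_imp_deriv)
    have "(F has_real_derivative deriv v2 (L1 \<alpha>) * deriv L1 \<alpha> / 2 + deriv v2 (L2 \<alpha>) * deriv L2 \<alpha> + deriv G \<alpha>) (at \<alpha>)"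
      unfolding F_def
      by (intro DERIV_add DERIV_cdivide DERIV_chain2[OF v2_deriv(1)[OF v2] sd[OF sm(1) \<alpha>]]
          DERIV_chain2[OF v2_deriv(1)[OF v2] sd[OF sm(2) \<alpha>]] dG[OF Jpi(2)[OF \<alpha>]]) (use q in auto)
    moreover have "deriv v2 (L1 \<alpha>) * deriv L1 \<alpha> / 2 + deriv v2 (L2 \<alpha>) * deriv L2 \<alpha> + deriv G \<alpha> =
        T \<alpha> * (deriv mu \<alpha> / 2)"
      unfolding dm using q by (simp add: algebra_simps)
    ultimately show ?thesis by simp
  qed
  have ang: "arccos (- sigma_of \<mu> (L1 (g \<mu>)) / L2 (g \<mu>)) = g \<mu>" if \<mu>: "\<mu> \<in> ?M" for \<mu>
  proof -
    note q = eqs[OF gM(1)[OF \<mu>]] and P = Jpi(2)[OF gM(1)[OF \<mu>]]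
    have "\<mu> = 2 * (L1 (g \<mu>) - L2 (g \<mu>) * cos (g \<mu>))" using q gM(2)[OF \<mu>] by simp
    then have "- sigma_of \<mu> (L1 (g \<mu>)) = cos (g \<mu>) * L2 (g \<mu>)" unfolding sigma_of_def by argo
    moreover have "L2 (g \<mu>) \<noteq> 0" using q by auto
    ultimately have "- sigma_of \<mu> (L1 (g \<mu>)) / L2 (g \<mu>) = cos (g \<mu>)" by simp
    then show ?thesis using P by (simp add: arccos_cos)
  qed
  have \<Phi>F: "\<Phi> (L1 (g \<mu>)) (L2 (g \<mu>)) \<mu> = F (g \<mu>)" if "\<mu> \<in> ?M" for \<mu>
    unfolding \<Phi>_def F_def ang[OF that] ..
  have gs: "smooth_on ?M g" by (rule smooth_on_subset[OF g(2) MJ])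
  have comp: "smooth_on ?M (\<lambda>\<mu>. f (g \<mu>))" if "smooth_on ?J f" for f
    by (rule smooth_on_compose[OF _ that gs]) (use gM in auto)
  have compc: "continuous_on ?M (\<lambda>\<mu>. f (g \<mu>))" if "smooth_on ?J f" for f
    by (rule smooth_on_continuous[OF comp[OF that]]) simp
  have compm: "strict_mono_on ?M (\<lambda>\<mu>. f (g \<mu>))" if "strict_mono_on ?J f" for f
  proof (rule strict_mono_onI)
    fix x y assume x: "x \<in> ?M" and y: "y \<in> ?M" and xy: "x < y"
    have "x \<in> mu ` ?J" "y \<in> mu ` ?J" using x y MJ by auto
    then show "f (g x) < f (g y)"
      by (intro strict_mono_onD[OF that gM(1)[OF x] gM(1)[OF y]] gmono xy)
  qed
  have mu0M: "mu0 \<in> ?M" using e' by simp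
  have g0: "g mu0 = a0" using g(3)[OF a0J] at0(4) by (simp add: mu0_def)
  have ws: "smooth_on ?J (\<lambda>\<alpha>. L2 \<alpha> * sin \<alpha>)" by (intro smooth_on_mult sm smooth_on_sin) simp
  show thesis
  proof (rule that[of "mu0 - e'" "mu0 + e'" "\<lambda>\<mu>. L1 (g \<mu>)" "\<lambda>\<mu>. L2 (g \<mu>)" g "\<lambda>\<mu>. T (g \<mu>)"])
    show "?M \<subseteq> {2.6<..<3.1}" using M by blast
    show "continuous_on ?M (\<lambda>\<mu>. L1 (g \<mu>))" "continuous_on ?M (\<lambda>\<mu>. L2 (g \<mu>))"
      by (rule compc[OF sm(1)], rule compc[OF sm(2)])
    show "continuous_on ?M g" using smooth_on_continuous[OF gs] by simp
    show "strict_mono_on ?M (\<lambda>\<mu>. L1 (g \<mu>))" "strict_mono_on ?M (\<lambda>\<mu>. L2 (g \<mu>))" "strict_mono_on ?M (\<lambda>\<mu>. T (g \<mu>))"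
      using pos by (auto intro!: compm[OF mon[OF sm(1)]] compm[OF mon[OF sm(2)]] compm[OF mon[OF sm(3)]])
    show "smooth_on ?M (\<lambda>\<mu>. T (g \<mu>))" by (rule comp[OF sm(3)])
    show "strict_mono_on ?M (\<lambda>\<mu>. L2 (g \<mu>) * sin (g \<mu>))" if "g2 > \<kappa>"
      by (rule compm[OF mon[OF ws]]) (use wsgn that in blast)
    show "strict_antimono_on ?M (\<lambda>\<mu>. L2 (g \<mu>) * sin (g \<mu>))" if lt: "g2 < \<kappa>"
    proof -
      have "strict_mono_on ?J (\<lambda>\<alpha>. - (L2 \<alpha> * sin \<alpha>))"
        by (rule deriv_pos_imp_strict_mono_on[OF DERIV_minus[OF sd[OF ws]]]) (use wsgn lt in auto)
      from compm[OF this] show ?thesis unfolding monotone_on_def by simp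
    qed
    show "((\<lambda>\<mu>. \<Phi> (L1 (g \<mu>)) (L2 (g \<mu>)) \<mu>) has_real_derivative T (g \<mu>) / 2) (at \<mu>)" if \<mu>: "\<mu> \<in> ?M" for \<mu>
    proof -
      have "deriv mu (g \<mu>) \<noteq> 0" using pos[OF gM(1)[OF \<mu>]] by auto
      then have "((\<lambda>\<mu>. F (g \<mu>)) has_real_derivative T (g \<mu>) / 2) (at \<mu>)"
        using DERIV_chain2[OF dF[OF gM(1)[OF \<mu>]] g(4)] MJ \<mu> by (auto simp: mult.assoc)
      then show ?thesis
        by (rule has_field_derivative_transform_within_open[of _ _ _ ?M]) (use \<mu> \<Phi>F in auto)
    qed
    have "((\<lambda>\<mu>. T (g \<mu>)) has_real_derivative deriv T a0 * inverse (deriv mu a0)) (at mu0)"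
    proof (rule DERIV_chain2[where g = g])
      show "(T has_real_derivative deriv T a0) (at (g mu0))" unfolding g0 by (rule sd[OF sm(3) a0J])
      have "mu0 \<in> mu ` ?J" using mu0M MJ by blast
      from g(4)[OF this] show "(g has_real_derivative inverse (deriv mu a0)) (at mu0)" unfolding g0 .
    qed
    then show "deriv (\<lambda>\<mu>. T (g \<mu>)) mu0 =
       (g2 / sin a0) / (2 * (2 * g2 / (\<kappa> * sin a0) + g2 * (cos a0)\<^sup>2 / (\<kappa> * sin a0) + sin a0))"
      unfolding dT0 dmu0 divide_inverse[of "g2 / sin a0"] by (rule DERIV_imp_deriv)
    show "L1 (g \<mu>) \<in> {0.9<..<1.1} \<and> L2 (g \<mu>) \<in> {0.9<..<1.1} \<and>
       g \<mu> \<in> {c1<..<c2} \<and> arccos (- sigma_of \<mu> (L1 (g \<mu>)) / L2 (g \<mu>)) = g \<mu>" if "\<mu> \<in> ?M" for \<mu>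
      using eqs[OF gM(1)[OF that]] gM(1)[OF that] Jc ang[OF that] by blast
    show "\<Phi> (L1 (g \<mu>)) (L2 (g \<mu>)) \<mu> < \<Phi> l1 l2 \<mu>"
      if "\<mu> \<in> ?M" "l1 \<in> {0.9<..<1.1}" "l2 \<in> {0.9<..<1.1}" "(l1, l2) \<noteq> (L1 (g \<mu>), L2 (g \<mu>))" for \<mu> l1 l2
      using that by (intro best) auto
  qed (use mu0M g0 at0 in auto)
qed

section \<open>Convexity of the minimal energy and monotonicity of the minimizers\<close>

lemma strictly_convex_onI:
  fixes f :: "real \<Rightarrow> real"
  assumes d: "\<And>x. x \<in> {a<..<b} \<Longrightarrow> (f has_real_derivative f' x) (at x)"
    and mono: "strict_mono_on {a<..<b} f'"
  shows "strictly_convex_on {a<..<b} f"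
proof -
  have lt: "f ((1 - t) * x + t * y) < (1 - t) * f x + t * f y"
    if x: "x \<in> {a<..<b}" and y: "y \<in> {a<..<b}" and t: "t \<in> {0<..<1}" and xy: "x < y" for x y t
  proof -
    define z where "z = (1 - t) * x + t * y"
    have zx: "z - x = t * (y - x)" unfolding z_def by algebra
    have yz: "y - z = (1 - t) * (y - x)" unfolding z_def by algebra
    have "0 < t * (y - x)" "0 < (1 - t) * (y - x)" using t xy by simp_all
    then have "0 < z - x" "0 < y - z" unfolding zx yz by blast+
    then have z: "x < z" "z < y" by simp_all
    obtain u where u: "x < u" "u < z" "f z - f x = (z - x) * f' u"
      using MVT2[OF z(1), of f f'] d x y z by auto
    obtain v where v: "z < v" "v < y" "f y - f z = (y - z) * f' v"
      using MVT2[OF z(2), of f f'] d x y z by auto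
    have "f' u < f' v" using strict_mono_onD[OF mono, of u v] u v x y z by auto
    then have "0 < t * (1 - t) * (y - x) * (f' v - f' u)" using t xy by simp
    also have "\<dots> = t * (f y - f z) - (1 - t) * (f z - f x)"
      unfolding u(3) v(3) zx yz by (simp add: algebra_simps)
    also have "\<dots> = (1 - t) * f x + t * f y - f z" by (simp add: algebra_simps)
    finally show ?thesis unfolding z_def by simp
  qed
  show ?thesis
    unfolding strictly_convex_on_def
  proof (intro conjI ballI impI)
    fix x y t assume x: "x \<in> {a<..<b}" and y: "y \<in> {a<..<b}" and t: "t \<in> {0<..<1::real}" and ne: "x \<noteq> y"
    show "f ((1 - t) * x + t * y) < (1 - t) * f x + t * f y"
    proof (cases "x < y")
      case False
      then have "f ((1 - (1 - t)) * y + (1 - t) * x) < (1 - (1 - t)) * f y + (1 - t) * f x"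
        using ne t by (intro lt[OF y x]) auto
      then show ?thesis by (simp add: add.commute)
    qed (rule lt[OF x y t])
  qed simp
qed

text \<open>
  The period intervals may be constructed separately for each \<open>ell\<close>.
\<close>

lemma interval_choice:
  fixes R :: "nat \<Rightarrow> real set \<Rightarrow> bool"
  assumes P Q and "\<And>ell. N \<le> ell \<Longrightarrow> \<exists>a b. R ell {a<..<b}"
  shows "\<exists>M. P \<and> Q \<and> (\<forall>ell\<ge>N. (\<exists>a b. M ell = {a<..<b}) \<and> R ell (M ell))"
proof -
  have "\<forall>ell. \<exists>M. N \<le> ell \<longrightarrow> (\<exists>a b. M = {a<..<b}) \<and> R ell M" using assms(3) by blast
  then show ?thesis using assms(1,2) by metis
qed

theorem proposition3p4:
  fixes v2 v3 :: "real \<Rightarrow> real"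
  assumes "two_body_potential v2"
    and "three_body_potential v3"
  shows "\<exists>(ell0::nat) (c::real) (M :: nat \<Rightarrow> real set).
    ell0 > 3 \<and> c > 0 \<and>
    (\<forall>ell\<ge>ell0.
      (\<exists>a b. M ell = {a<..<b}) \<and> M ell \<subseteq> {2.6<..<3.1} \<and> mu_us v3 ell \<in> M ell \<and>
      (\<forall>m::nat. m \<ge> 1 \<longrightarrow>
        (\<forall>\<mu>\<in>M ell. \<exists>!p. is_minimizing_pair v2 v3 ell m \<mu> p) \<and>
        \<comment> \<open>1.\<close>
        (\<forall>\<mu>\<in>M ell. zigzag_energy v2 v3 ell m (lambda1_min v2 v3 ell m \<mu>) (lambda2_min v2 v3 ell m \<mu>) \<mu>
                  = E_min v2 v3 ell m \<mu>) \<and>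
        smooth_on (M ell) (E_min v2 v3 ell m) \<and>
        strictly_convex_on (M ell) (E_min v2 v3 ell m) \<and>
        is_arg_min (E_min v2 v3 ell m) (\<lambda>\<mu>. \<mu> \<in> M ell) (mu_us v3 ell) \<and>
        deriv (deriv (E_min v2 v3 ell m)) (mu_us v3 ell) \<ge> c * real (4 * m * ell) \<and>
        \<comment> \<open>2.\<close>
        continuous_on (M ell) (lambda1_min v2 v3 ell m) \<and>
        strict_mono_on (M ell) (lambda1_min v2 v3 ell m) \<and>
        continuous_on (M ell) (lambda2_min v2 v3 ell m) \<and>
        strict_mono_on (M ell) (lambda2_min v2 v3 ell m) \<and>
        (\<forall>\<mu>\<in>M ell. \<mu> > mu_us v3 ell \<longrightarrow>
           lambda1_min v2 v3 ell m \<mu> > 1 \<and> lambda2_min v2 v3 ell m \<mu> > 1) \<and>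
        (\<forall>\<mu>\<in>M ell. \<mu> < mu_us v3 ell \<longrightarrow>
           lambda1_min v2 v3 ell m \<mu> < 1 \<and> lambda2_min v2 v3 ell m \<mu> < 1) \<and>
        \<comment> \<open>3.\<close>
        (\<forall>\<mu>\<in>M ell. alpha_min v2 v3 ell m \<mu> \<in> {alpha_ch ell<..<alpha_ru}) \<and>
        \<comment> \<open>4.\<close>
        (deriv (deriv v2) 1 < 6 * deriv (deriv v3) (2 * pi / 3) \<longrightarrow>
           continuous_on (M ell) (rho_min v2 v3 ell m) \<and>
           strict_mono_on (M ell) (rho_min v2 v3 ell m)) \<and>
        (deriv (deriv v2) 1 > 6 * deriv (deriv v3) (2 * pi / 3) \<longrightarrow>
           continuous_on (M ell) (rho_min v2 v3 ell m) \<and>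
           strict_antimono_on (M ell) (rho_min v2 v3 ell m))))"
proof -
  note v2 = assms(1) and v3 = assms(2)
  let ?\<kappa> = "deriv (deriv v2) 1" and ?k = "deriv (deriv v3) (2 * pi / 3)"
  have \<kappa>: "?\<kappa> > 0" using v2 by (simp add: two_body_potential_def)
  have k: "?k > 0" using v3 by (simp add: three_body_potential_def)
  \<comment> \<open>The second derivative of the angle energy at its minimizer is kept between \<open>3 * ?k\<close> and \<open>9 * ?k\<close>, and on
    the same side of \<open>?\<kappa>\<close> as its limit \<open>6 * ?k\<close>.\<close>
  define \<epsilon> where "\<epsilon> = (if ?\<kappa> = 6 * ?k then 3 * ?k else min (3 * ?k) \<bar>?\<kappa> - 6 * ?k\<bar>)"
  have \<epsilon>: "\<epsilon> > 0" "\<epsilon> \<le> 3 * ?k" "?\<kappa> \<noteq> 6 * ?k \<Longrightarrow> \<epsilon> \<le> \<bar>?\<kappa> - 6 * ?k\<bar>" using k by (auto simp: \<epsilon>_def)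
  \<comment> \<open>The second derivative per point is half of \<open>deriv T / deriv mu\<close> at \<open>a0\<close> on the equilibrium curve, with
    \<open>deriv T \<ge> 3 * ?k\<close> and \<open>deriv mu \<le> 2 * (54 * ?k / ?\<kappa> + 1)\<close>.\<close>
  define c where "c = 3 * ?k / (4 * (54 * ?k / ?\<kappa> + 1))"
  have c: "c > 0" using k \<kappa> by (simp add: c_def add_pos_pos)
  obtain N where N: "N \<ge> 4" and us: "\<And>ell. ell \<ge> N \<Longrightarrow>
      alpha_us v3 ell \<in> {alpha_ch ell<..<alpha_ru} \<and>
      alpha_us v3 ell \<in> {pi/2<..<5 * pi / 6} \<and> mu_us v3 ell \<in> {2.6<..<3.1} \<and>
      strict_angle_minimizer v3 \<epsilon> (gamma_ang ell) (alpha_us v3 ell)"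
    using unstretched_angle[OF v2 v3 \<epsilon>(1)] by blast
  show ?thesis
  proof (rule exI[of _ N], rule exI[of _ c], rule interval_choice, goal_cases)
    case (3 ell)
    then have ell: "ell \<ge> N" .
    have ell4: "ell \<ge> 4" using N ell by simp
    let ?\<mu>0 = "mu_us v3 ell" and ?\<gamma> = "gamma_ang ell" and ?a0 = "alpha_us v3 ell"
    define G where "G = angle_energy v3 ?\<gamma>"
    have \<gamma>: "?\<gamma> \<in> {0<..<pi}" using gamma_ang_bounds ell4 by simp
    note u = us[OF ell, unfolded strict_angle_minimizer_def] and ch = alpha_ch[OF ell4]
    have Gs: "smooth_on {0<..<pi} G" unfolding G_def by (rule angle_energy_smooth[OF v3 \<gamma>])
    have a0: "?a0 \<in> {pi/2<..<5 * pi / 6}" using u by blast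
    have a0pi: "?a0 \<in> {0<..<pi}" using a0 pi_half_gt_zero by auto
    have dG: "deriv G \<alpha> = angle_energy_deriv v3 ?\<gamma> \<alpha>" if "\<alpha> \<in> {0<..<pi}" for \<alpha>
      unfolding G_def by (rule DERIV_imp_deriv[OF angle_energy_has_deriv(1)[OF v3 \<gamma> that]])
    have "(deriv G has_real_derivative angle_energy_deriv2 v3 ?\<gamma> ?a0) (at ?a0)"
      by (rule has_field_derivative_transform_within_open[OF angle_energy_has_deriv(2)[OF v3 \<gamma> a0pi], of "{0<..<pi}"])
        (use dG a0pi in auto)
    then have d2G: "deriv (deriv G) ?a0 = angle_energy_deriv2 v3 ?\<gamma> ?a0" by (rule DERIV_imp_deriv)
    let ?g2 = "deriv (deriv G) ?a0"
    have g2b: "\<bar>?g2 - 6 * ?k\<bar> < \<epsilon>" unfolding d2G using u by blast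
    then have g2: "?g2 > 3 * ?k" "?g2 < 9 * ?k" using \<epsilon>(2) by (auto simp: abs_less_iff)
    have g2pos: "?g2 > 0" using g2 k by linarith
    have sg: "?\<kappa> < 6 * ?k \<Longrightarrow> ?g2 > ?\<kappa>" "?\<kappa> > 6 * ?k \<Longrightarrow> ?g2 < ?\<kappa>" using g2b \<epsilon>(3) by (auto simp: abs_if split: if_splits)
    have mu: "?\<mu>0 = 2 - 2 * cos ?a0" by (simp add: mu_us_def)
    have csub: "{alpha_ch ell<..<alpha_ru} \<subseteq> {pi/2<..<pi}"
      using ch(3) pi_gt_zero by (auto simp: alpha_ru_def)
    have a0c: "?a0 \<in> {alpha_ch ell<..<alpha_ru}" and mu0: "?\<mu>0 \<in> {2.6<..<3.1}" using u by blast+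
    have G1: "deriv G ?a0 = 0" unfolding dG[OF a0pi] using u by blast
    have gmin: "G ?a0 < G \<alpha>" if "\<alpha> \<in> {pi/2<..<pi}" "\<alpha> \<noteq> ?a0" for \<alpha>
      using u that unfolding G_def by blast
    let ?\<Phi> = "\<lambda>l1 l2 \<mu>. v2 l1 / 2 + v2 l2 + G (arccos (- sigma_of \<mu> l1 / l2))"
    obtain a b and \<Lambda>1 \<Lambda>2 \<tau> A :: "real \<Rightarrow> real" where
      M: "?\<mu>0 \<in> {a<..<b}" "{a<..<b} \<subseteq> {2.6<..<3.1}"
      and rng: "\<And>\<mu>. \<mu> \<in> {a<..<b} \<Longrightarrow> \<Lambda>1 \<mu> \<in> {0.9<..<1.1} \<and> \<Lambda>2 \<mu> \<in> {0.9<..<1.1} \<and>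
         A \<mu> \<in> {alpha_ch ell<..<alpha_ru} \<and> arccos (- sigma_of \<mu> (\<Lambda>1 \<mu>) / \<Lambda>2 \<mu>) = A \<mu>"
      and best: "\<And>\<mu> l1 l2. \<lbrakk>\<mu> \<in> {a<..<b}; l1 \<in> {0.9<..<1.1}; l2 \<in> {0.9<..<1.1}; (l1, l2) \<noteq> (\<Lambda>1 \<mu>, \<Lambda>2 \<mu>)\<rbrakk> \<Longrightarrow>
         ?\<Phi> (\<Lambda>1 \<mu>) (\<Lambda>2 \<mu>) \<mu> < ?\<Phi> l1 l2 \<mu>"
      and one: "\<Lambda>1 ?\<mu>0 = 1" "\<Lambda>2 ?\<mu>0 = 1"
      and cont: "continuous_on {a<..<b} \<Lambda>1" "continuous_on {a<..<b} \<Lambda>2" "continuous_on {a<..<b} A"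
      and mono: "strict_mono_on {a<..<b} \<Lambda>1" "strict_mono_on {a<..<b} \<Lambda>2"
      and w: "?g2 > ?\<kappa> \<Longrightarrow> strict_mono_on {a<..<b} (\<lambda>\<mu>. \<Lambda>2 \<mu> * sin (A \<mu>))"
        "?g2 < ?\<kappa> \<Longrightarrow> strict_antimono_on {a<..<b} (\<lambda>\<mu>. \<Lambda>2 \<mu> * sin (A \<mu>))"
      and der: "\<And>\<mu>. \<mu> \<in> {a<..<b} \<Longrightarrow> ((\<lambda>\<mu>. ?\<Phi> (\<Lambda>1 \<mu>) (\<Lambda>2 \<mu>) \<mu>) has_real_derivative \<tau> \<mu> / 2) (at \<mu>)"
      and \<tau>: "smooth_on {a<..<b} \<tau>" "strict_mono_on {a<..<b} \<tau>"
        "deriv \<tau> ?\<mu>0 = (?g2 / sin ?a0) /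
          (2 * (2 * ?g2 / (?\<kappa> * sin ?a0) + ?g2 * (cos ?a0)\<^sup>2 / (?\<kappa> * sin ?a0) + sin ?a0))"
      by (rule tube_minimizer[OF v2 Gs a0c csub G1 g2pos gmin, folded mu, OF _ _ mu0]) blast+
    let ?M = "{a<..<b}"
    show ?case
    proof (rule exI[of _ a], rule exI[of _ b], intro conjI M allI impI)
      fix m :: nat assume m: "1 \<le> m"
      let ?Z = "zigzag_energy v2 v3 ell m" and ?E = "E_min v2 v3 ell m" and ?min = "is_minimizing_pair v2 v3 ell m"
      let ?l1 = "lambda1_min v2 v3 ell m" and ?l2 = "lambda2_min v2 v3 ell m" and ?\<rho> = "rho_min v2 v3 ell m"
      let ?n = "real (4 * m * ell)"
      have n: "?n > 0" using m ell4 by simp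
      have E: "?Z l1 l2 \<mu> = ?n * ?\<Phi> l1 l2 \<mu>"
        if "\<mu> \<in> ?M" "l1 \<in> {0.9<..<1.1}" "l2 \<in> {0.9<..<1.1}" for l1 l2 \<mu>
        using zigzag_energy_eq[OF ell4 m that(2,3), of \<mu> v2 v3] that(1) M(2)
        unfolding G_def angle_energy_def by blast
      have Elt: "?Z (\<Lambda>1 \<mu>) (\<Lambda>2 \<mu>) \<mu> < ?Z l1 l2 \<mu>"
        if "\<mu> \<in> ?M" "l1 \<in> {0.9<..<1.1}" "l2 \<in> {0.9<..<1.1}" "(l1, l2) \<noteq> (\<Lambda>1 \<mu>, \<Lambda>2 \<mu>)" for l1 l2 \<mu>
        using best[OF that] n rng[OF that(1)] E[OF that(1)] that by (simp add: mult_strict_left_mono)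
      have pair: "?min \<mu> p \<longleftrightarrow> p = (\<Lambda>1 \<mu>, \<Lambda>2 \<mu>)" if \<mu>: "\<mu> \<in> ?M" for \<mu> p
      proof
        assume p: "?min \<mu> p"
        obtain l1 l2 where l: "p = (l1, l2)" by (cases p)
        show "p = (\<Lambda>1 \<mu>, \<Lambda>2 \<mu>)"
        proof (rule ccontr)
          assume "p \<noteq> (\<Lambda>1 \<mu>, \<Lambda>2 \<mu>)"
          then have "?Z (\<Lambda>1 \<mu>) (\<Lambda>2 \<mu>) \<mu> < ?Z l1 l2 \<mu>"
            using p l by (intro Elt[OF \<mu>]) (auto simp: is_minimizing_pair_def is_arg_min_def)
          then show False using p l rng[OF \<mu>] unfolding is_minimizing_pair_def is_arg_min_def by fastforce
        qed
      next
        assume "p = (\<Lambda>1 \<mu>, \<Lambda>2 \<mu>)"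
        then show "?min \<mu> p"
          using Elt[OF \<mu>] rng[OF \<mu>] unfolding is_minimizing_pair_def is_arg_min_def
          by (auto dest: less_asym)
      qed
      have lam: "?l1 \<mu> = \<Lambda>1 \<mu>" "?l2 \<mu> = \<Lambda>2 \<mu>" if "\<mu> \<in> ?M" for \<mu>
        unfolding lambda1_min_def lambda2_min_def pair[OF that] by simp_all
      have Emin: "?E \<mu> = ?n * ?\<Phi> (\<Lambda>1 \<mu>) (\<Lambda>2 \<mu>) \<mu>" if \<mu>: "\<mu> \<in> ?M" for \<mu>
        unfolding E_min_def
      proof (rule Least_equality)
        show "?n * ?\<Phi> (\<Lambda>1 \<mu>) (\<Lambda>2 \<mu>) \<mu> \<in> {?Z lam1 lam2 \<mu> | lam1 lam2.
                      lam1 \<in> {0.9<..<1.1} \<and> lam2 \<in> {0.9<..<1.1}}"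
          using E[OF \<mu>] rng[OF \<mu>] by (smt (verit) mem_Collect_eq)
        fix y assume "y \<in> {?Z lam1 lam2 \<mu> | lam1 lam2.
                      lam1 \<in> {0.9<..<1.1} \<and> lam2 \<in> {0.9<..<1.1}}"
        then obtain l1 l2 where l: "y = ?Z l1 l2 \<mu>"
          "l1 \<in> {0.9<..<1.1}" "l2 \<in> {0.9<..<1.1}" by blast
        show "?n * ?\<Phi> (\<Lambda>1 \<mu>) (\<Lambda>2 \<mu>) \<mu> \<le> y"
        proof (cases "(l1, l2) = (\<Lambda>1 \<mu>, \<Lambda>2 \<mu>)")
          case True
          then show ?thesis using l E[OF \<mu> l(2,3)] by simp
        next
          case False
          then show ?thesis using Elt[OF \<mu> l(2,3) False] l(1) E[OF \<mu>] rng[OF \<mu>] by simp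
        qed
      qed
      have dE: "(?E has_real_derivative ?n * (\<tau> \<mu> / 2)) (at \<mu>)" if \<mu>: "\<mu> \<in> ?M" for \<mu>
        by (rule has_field_derivative_transform_within_open[OF DERIV_cmult[OF der[OF \<mu>]], of ?M])
          (use \<mu> Emin in auto)
      have half: "?n * (\<tau> \<mu> / 2) = (?n / 2) * \<tau> \<mu>" for \<mu> by simp
      show "\<forall>\<mu>\<in>?M. \<exists>!p. ?min \<mu> p" using pair by auto
      show "\<forall>\<mu>\<in>?M. ?Z (?l1 \<mu>) (?l2 \<mu>) \<mu>
                  = ?E \<mu>"
        using lam Emin E rng by (smt (verit))
      show "smooth_on ?M ?E"
      proof (rule smooth_onI)
        show "smooth_on ?M (\<lambda>\<mu>. (?n / 2) * \<tau> \<mu>)" by (intro smooth_on_mult smooth_on_const \<tau>) simp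
        show "(?E has_real_derivative (?n / 2) * \<tau> \<mu>) (at \<mu> within ?M)" if "\<mu> \<in> ?M" for \<mu>
          using has_field_derivative_at_within[OF dE[OF that]] unfolding half .
      qed
      show "strictly_convex_on ?M ?E"
      proof (rule strictly_convex_onI[OF dE])
        show "strict_mono_on ?M (\<lambda>\<mu>. ?n * (\<tau> \<mu> / 2))"
        proof (rule strict_mono_onI)
          fix x y assume "x \<in> ?M" "y \<in> ?M" "x < y"
          then have "\<tau> x / 2 < \<tau> y / 2" using strict_mono_onD[OF \<tau>(2)] by simp
          then show "?n * (\<tau> x / 2) < ?n * (\<tau> y / 2)" using n by (rule mult_strict_left_mono)
        qed
      qed
      \<comment> \<open>At the unstretched period the two-body and three-body terms are minimal simultaneously.\<close>
      have uge: "G ?a0 \<le> G \<alpha>" if "\<alpha> \<in> {pi/2<..<pi}" for \<alpha>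
        using gmin[OF that] by (cases "\<alpha> = ?a0") (auto simp: less_imp_le)
      have A0: "A ?\<mu>0 = ?a0"
      proof -
        have "- sigma_of ?\<mu>0 1 / 1 = cos ?a0" by (simp add: sigma_of_def mu field_simps)
        then have "arccos (cos ?a0) = A ?\<mu>0" using rng[OF M(1)] by (simp add: one)
        then show ?thesis using a0pi by (simp add: arccos_cos)
      qed
      have "?E ?\<mu>0 \<le> ?E \<mu>" if \<mu>: "\<mu> \<in> ?M" for \<mu>
      proof -
        note r = rng[OF \<mu>] rng[OF M(1)]
        have "v2 (\<Lambda>1 \<mu>) \<ge> -1" "v2 (\<Lambda>2 \<mu>) \<ge> -1" using r by (auto intro!: v2_ge[OF v2])
        moreover have "G ?a0 \<le> G (A \<mu>)" using r csub by (intro uge) blast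
        ultimately have "?\<Phi> (\<Lambda>1 ?\<mu>0) (\<Lambda>2 ?\<mu>0) ?\<mu>0 \<le> ?\<Phi> (\<Lambda>1 \<mu>) (\<Lambda>2 \<mu>) \<mu>"
          using r A0 one v2_one[OF v2] by simp
        then show ?thesis unfolding Emin[OF \<mu>] Emin[OF M(1)] using n by (intro mult_left_mono) auto
      qed
      then show "is_arg_min ?E (\<lambda>\<mu>. \<mu> \<in> ?M) ?\<mu>0"
        using M(1) unfolding is_arg_min_def not_less[symmetric] by blast
      show "c * ?n \<le> deriv (deriv ?E) ?\<mu>0"
      proof -
        have "((\<lambda>\<mu>. (?n / 2) * \<tau> \<mu>) has_real_derivative (?n / 2) * deriv \<tau> ?\<mu>0) (at ?\<mu>0)"
          by (rule DERIV_cmult[OF smooth_on_has_deriv[OF \<tau>(1) _ M(1)]]) simp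
        then have "(deriv ?E has_real_derivative (?n / 2) * deriv \<tau> ?\<mu>0) (at ?\<mu>0)"
          by (rule has_field_derivative_transform_within_open[of _ _ _ ?M])
            (use M(1) DERIV_imp_deriv[OF dE] in auto)
        then have d2: "deriv (deriv ?E) ?\<mu>0 = (?n / 2) * deriv \<tau> ?\<mu>0"
          by (rule DERIV_imp_deriv)
        let ?s = "sin ?a0"
        have s: "1 / 2 < ?s" "?s \<le> 1"
        proof -
          have "sin (pi / 6) < sin (pi - ?a0)"
          proof (rule sin_monotone_2pi)
            show "pi / 6 < pi - ?a0" "- (pi / 2) \<le> pi / 6" "pi - ?a0 \<le> pi / 2"
              using a0 pi_gt_zero unfolding greaterThanLessThan_iff by linarith+
          qed
          then show "1 / 2 < ?s" by (simp add: sin_30)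
        qed simp
        let ?D = "2 * (2 * ?g2 / (?\<kappa> * ?s) + ?g2 * (cos ?a0)\<^sup>2 / (?\<kappa> * ?s) + ?s)"
        have h: "?g2 / (?\<kappa> * ?s) \<le> 18 * ?k / ?\<kappa>"
        proof -
          have "?g2 / (?\<kappa> * ?s) \<le> 9 * ?k / (?\<kappa> * (1 / 2))"
            using g2 s \<kappa> k by (intro frac_le mult_left_mono) auto
          then show ?thesis by (simp add: field_simps)
        qed
        define r X q where "r = ?g2 / (?\<kappa> * ?s)" and "X = 18 * ?k / ?\<kappa>" and "q = (cos ?a0)\<^sup>2 * r"
        have r: "0 < r" "r \<le> X" using g2pos \<kappa> s h by (simp_all add: r_def X_def)
        have "(cos ?a0)\<^sup>2 \<le> 1" by (simp add: abs_square_le_1)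
        then have "q \<le> 1 * r" unfolding q_def using r by (intro mult_right_mono) auto
        moreover have "0 \<le> q" unfolding q_def using r by (intro mult_nonneg_nonneg) auto
        ultimately have q: "q \<le> r" "0 \<le> q" by simp_all
        have "0 < 2 * r + q + ?s" using r q s(1) by simp
        moreover have "2 * r + q + ?s \<le> 3 * X + 1" by (rule add_mono[OF _ s(2)]) (use r q in simp)
        ultimately have "0 < 2 * (2 * r + q + ?s)" "2 * (2 * r + q + ?s) \<le> 2 * (3 * X + 1)" by simp_all
        note bd = this
        have De: "?D = 2 * (2 * r + q + ?s)" unfolding r_def q_def by (simp only: times_divide_eq_right mult.commute)
        have Xe: "54 * ?k / ?\<kappa> = 3 * X" unfolding X_def by simp
        have D: "0 < ?D" unfolding De by (rule bd(1))
        have D2: "?D \<le> 2 * (54 * ?k / ?\<kappa> + 1)" unfolding De Xe by (rule bd(2))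
        have "3 * ?k * ?s \<le> 3 * ?k * 1" using k s(2) by (intro mult_left_mono) auto
        then have "3 * ?k * ?s \<le> ?g2" using g2(1) by linarith
        moreover have s0: "?s > 0" by (rule less_trans[OF _ s(1)]) simp
        ultimately have "3 * ?k \<le> ?g2 / ?s" by (simp only: pos_le_divide_eq)
        then have "3 * ?k / (2 * (54 * ?k / ?\<kappa> + 1)) \<le> (?g2 / ?s) / ?D"
          using D D2 k g2pos s0 by (intro frac_le) (simp_all only: less_imp_le divide_pos_pos)
        moreover have "2 * (x / (4 * y)) = x / (2 * y)" for x y :: real by simp
        ultimately have "2 * c \<le> deriv \<tau> ?\<mu>0" unfolding \<tau>(3) c_def by (simp only:)
        then have "(?n / 2) * (2 * c) \<le> (?n / 2) * deriv \<tau> ?\<mu>0"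
          using n by (intro mult_left_mono) auto
        then show ?thesis unfolding d2 by (simp add: mult.commute)
      qed
      show "continuous_on ?M (?l1)" "continuous_on ?M (?l2)"
        by (rule continuous_on_eq[OF cont(1)], simp add: lam, rule continuous_on_eq[OF cont(2)], simp add: lam)
      show sm1: "strict_mono_on ?M (?l1)"
        using mono(1) lam unfolding monotone_on_def by simp
      show sm2: "strict_mono_on ?M (?l2)"
        using mono(2) lam unfolding monotone_on_def by simp
      show "\<forall>\<mu>\<in>?M. \<mu> > ?\<mu>0 \<longrightarrow> ?l1 \<mu> > 1 \<and> ?l2 \<mu> > 1"
        using strict_mono_onD[OF sm1 M(1)] strict_mono_onD[OF sm2 M(1)] lam[OF M(1)] one by simp
      show "\<forall>\<mu>\<in>?M. \<mu> < ?\<mu>0 \<longrightarrow> ?l1 \<mu> < 1 \<and> ?l2 \<mu> < 1"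
        using strict_mono_onD[OF sm1 _ M(1)] strict_mono_onD[OF sm2 _ M(1)] lam[OF M(1)] one by simp
      have sig: "0 < sigma_of \<mu> (\<Lambda>1 \<mu>)" "sigma_of \<mu> (\<Lambda>1 \<mu>) < \<Lambda>2 \<mu>" if \<mu>: "\<mu> \<in> ?M" for \<mu>
      proof -
        have "2.6 < \<mu>" "\<mu> < 3.1" "\<Lambda>1 \<mu> < 1.1" "\<Lambda>1 \<mu> > 0.9" "\<Lambda>2 \<mu> > 0.9" using rng[OF \<mu>] M(2) \<mu> by auto
        then show "0 < sigma_of \<mu> (\<Lambda>1 \<mu>)" "sigma_of \<mu> (\<Lambda>1 \<mu>) < \<Lambda>2 \<mu>" unfolding sigma_of_def by linarith+
      qed
      show "\<forall>\<mu>\<in>?M. alpha_min v2 v3 ell m \<mu> \<in> {alpha_ch ell<..<alpha_ru}"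
      proof
        fix \<mu> assume \<mu>: "\<mu> \<in> ?M"
        show "alpha_min v2 v3 ell m \<mu> \<in> {alpha_ch ell<..<alpha_ru}"
          unfolding alpha_min_def lam[OF \<mu>] alpha_of(1)[OF sig[OF \<mu>]] using rng[OF \<mu>] by simp
      qed
      have "pi / (2 * real ell) < pi" using ell4 by (simp add: field_simps)
      then have S: "sin (pi / (2 * real ell)) > 0" using ell4 by (intro sin_gt_zero) auto
      \<comment> \<open>\<open>sqrt (\<lambda>\<^sub>2\<^sup>2 - \<sigma>\<^sup>2) = \<lambda>\<^sub>2 * sin \<alpha>\<close>, since \<open>cos \<alpha> = - \<sigma> / \<lambda>\<^sub>2\<close>.\<close>
      have rho: "?\<rho> \<mu> = (\<Lambda>2 \<mu> * sin (A \<mu>)) / (2 * sin (pi / (2 * real ell)))" if \<mu>: "\<mu> \<in> ?M" for \<mu>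
      proof -
        note s = sig[OF \<mu>] and r = rng[OF \<mu>]
        have lt: "(sigma_of \<mu> (\<Lambda>1 \<mu>))\<^sup>2 < (\<Lambda>2 \<mu>)\<^sup>2" using s by (intro power_strict_mono) auto
        have cA: "cos (A \<mu>) = - sigma_of \<mu> (\<Lambda>1 \<mu>) / \<Lambda>2 \<mu>" using alpha_of(3)[OF s] r by simp
        have "A \<mu> \<in> {pi/2<..<pi}" using r csub by blast
        then have sA: "sin (A \<mu>) > 0" using pi_half_gt_zero by (intro sin_gt_zero) auto
        have "(\<Lambda>2 \<mu> * sin (A \<mu>))\<^sup>2 = (\<Lambda>2 \<mu>)\<^sup>2 - (sigma_of \<mu> (\<Lambda>1 \<mu>))\<^sup>2"
          unfolding power_mult_distrib sin_squared_eq cA using s by (simp add: power_divide right_diff_distrib)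
        then have "sqrt ((\<Lambda>2 \<mu>)\<^sup>2 - (sigma_of \<mu> (\<Lambda>1 \<mu>))\<^sup>2) = \<Lambda>2 \<mu> * sin (A \<mu>)"
          using s sA by (intro real_sqrt_unique) auto
        then show ?thesis unfolding rho_min_def lam[OF \<mu>] using rho_of(3)[OF _ lt] ell4 by simp
      qed
      have crho: "continuous_on ?M ?\<rho>"
      proof -
        have "continuous_on ?M (\<lambda>\<mu>. (\<Lambda>2 \<mu> * sin (A \<mu>)) / (2 * sin (pi / (2 * real ell))))"
          using S by (intro continuous_intros cont) auto
        then show ?thesis by (rule continuous_on_eq) (simp add: rho)
      qed
      show "continuous_on ?M ?\<rho>" "continuous_on ?M ?\<rho>" by (rule crho)+
      show "strict_mono_on ?M ?\<rho>" if "?\<kappa> < 6 * ?k"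
        using w(1)[OF sg(1)[OF that]] S rho unfolding monotone_on_def by (simp add: divide_strict_right_mono)
      show "strict_antimono_on ?M ?\<rho>" if "?\<kappa> > 6 * ?k"
        using w(2)[OF sg(2)[OF that]] S rho unfolding monotone_on_def by (simp add: divide_strict_right_mono)
    qed
  qed (use N c in simp_all)
qed

end
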